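(* Let $\lambda,\alpha\in\mathbb{C}^*$, $\beta,\gamma,\eta,\epsilon,\theta\in\mathbb{C}$, and let $M(\lambda,\alpha,\beta,\gamma)$ be one of the $\mathfrak{L}$-modules $\Omega(\lambda,\alpha,\beta,\gamma)$, $\Delta(\lambda,\alpha,\beta,\gamma)$, $\Theta(\lambda,\alpha,\beta,\gamma)$, where in the case $M=\Theta$ it is assumed that $2\beta\notin\mathbb{Z}_+$. Then the tensor product $\mathfrak{L}$-module $M(\lambda,\alpha,\beta,\gamma)\otimes V(\eta,\epsilon,\theta)$ is irreducible.
   Context: All vector spaces are over $\mathbb{C}$; $\mathbb{C}^*=\mathbb{C}\setminus\{0\}$, $\mathbb{Z}_+$ is the set of nonnegative integers, $\mathbb{N}$ the set of positive integers. The affine-Virasoro algebra of type $A_1$, denoted $\mathfrak{L}$, is the Lie algebra with basis $\{e_i,f_i,h_i,d_i,C\mid i\in\mathbb{Z}\}$ and brackets $[e_i,f_j]=h_{i+j}+i\delta_{i+j,0}C$, $[h_i,e_j]=2e_{i+j}$, $[h_i,f_j]=-2f_{i+j}$, $[d_i,d_j]=(j-i)d_{i+j}+\delta_{i+j,0}\frac{i^3-i}{12}C$, $[d_i,h_j]=jh_{i+j}$, $[h_i,h_j]=2i\delta_{i+j,0}C$, $[d_i,e_j]=je_{i+j}$, $[d_i,f_j]=jf_{i+j}$, $[e_i,e_j]=[f_i,f_j]=[C,\mathfrak{L}]=0$. For $\lambda,\alpha\in\mathbb{C}^*$, $\beta,\gamma\in\mathbb{C}$, the $\mathfrak{L}$-modules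 $\Omega(\lambda,\alpha,\beta,\gamma)$, $\Delta(\lambda,\alpha,\beta,\gamma)$, $\Theta(\lambda,\alpha,\beta,\gamma)$ are all equal to the polynomial algebra $\mathbb{C}[s,t]$ as vector spaces. In all three, for $i\in\mathbb{Z}$ and $g(s,t)\in\mathbb{C}[s,t]$: $h_i\cdot g(s,t)=\lambda^i t\,g(s-i,t)$, $d_i\cdot g(s,t)=\lambda^i(s+i\gamma)g(s-i,t)$, $C\cdot g(s,t)=0$. The remaining actions are: - $\Omega$: $e_i\cdot g(s,t)=\lambda^i\alpha\, g(s-i,t-2)$, $f_i\cdot g(s,t)=-\frac{\lambda^i}{\alpha}(\frac t2-\beta)(\frac t2+\beta+1)g(s-i,t+2)$; - $\Delta$: $e_i\cdot g(s,t)=-\frac{\lambda^i}{\alpha}(\frac t2+\beta)(\frac t2-\beta-1)g(s-i,t-2)$, $f_i\cdot g(s,t)=\lambda^i\alpha\, g(s-i,t+2)$; - $\Theta$: $e_i\cdot g(s,t)=\lambda^i\alpha(\frac t2+\beta)g(s-i,t-2)$, $f_i\cdot g(s,t)=-\frac{\lambda^i}{\alpha}(\frac t2-\beta)g(s-i,t+2)$. For $\eta,\epsilon,\theta\in\mathbb{C}$, the Verma module is $\overline{V}(\eta,\epsilon,\theta)=U(\mathfrak{L})/I(\eta,\epsilon,\theta)$, where $I(\eta,\epsilon,\theta)$ is the left ideal of $U(\mathfrak{L})$ generated by $\{e_0,e_i,f_i,h_i,d_i\mid i\in\mathbb{N}\}\cup\{d_0-\eta,h_0-\epsilon,C-\theta\}$.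 $V(\eta,\epsilon,\theta)$ denotes the irreducible highest weight module $\overline{V}(\eta,\epsilon,\theta)/J$, where $J$ is the unique maximal proper submodule of $\overline{V}(\eta,\epsilon,\theta)$. Tensor products carry the usual action $x(u\otimes v)=xu\otimes v+u\otimes xv$ for $x\in\mathfrak{L}$. *)

theory Defs
  imports
    Complex_Main
    "HOL-Library.Poly_Mapping"
    "HOL-Computational_Algebra.Polynomial"
    "HOL-Algebra.Algebraic_Closure_Type"
begin

abbreviation complex_field :: "complex ring" where
  "complex_field \<equiv> ring_of_type_algebra"

text \<open>The space with basis \<open>'b\<close> is the type of finitely supported functions
  \<open>'b \<Rightarrow>\<^sub>0 complex\<close>.\<close>

definition scale :: "complex \<Rightarrow> ('b \<Rightarrow>\<^sub>0 complex) \<Rightarrow> ('b \<Rightarrow>\<^sub>0 complex)" where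
  "scale c x = Poly_Mapping.map ((*) c) x"

text \<open>The linear extension of \<open>f\<close>, given on the basis, with respect to a scalar
  multiplication \<open>sc\<close> on the target.\<close>

definition lin_ext ::
    "(complex \<Rightarrow> 'v \<Rightarrow> 'v) \<Rightarrow> ('b \<Rightarrow> 'v::comm_monoid_add) \<Rightarrow> ('b \<Rightarrow>\<^sub>0 complex) \<Rightarrow> 'v" where
  "lin_ext sc f x = (\<Sum>b\<in>Poly_Mapping.keys x. sc (Poly_Mapping.lookup x b) (f b))"


section \<open>The affine-Virasoro algebra of type \<open>A\<^sub>1\<close>\<close>

datatype gen = E int | F int | H int | D int | Cen

type_synonym affvir = "gen \<Rightarrow>\<^sub>0 complex"

definition bas :: "gen \<Rightarrow> affvir" where
  "bas b = Poly_Mapping.single b 1"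

definition delta0 :: "int \<Rightarrow> complex" where
  "delta0 n = (if n = 0 then 1 else 0)"

fun gen_bracket :: "gen \<Rightarrow> gen \<Rightarrow> affvir" where
  "gen_bracket (E i) (F j) = bas (H (i + j)) + scale (of_int i * delta0 (i + j)) (bas Cen)"
| "gen_bracket (F j) (E i) = - (bas (H (i + j)) + scale (of_int i * delta0 (i + j)) (bas Cen))"
| "gen_bracket (H i) (E j) = scale 2 (bas (E (i + j)))"
| "gen_bracket (E j) (H i) = - scale 2 (bas (E (i + j)))"
| "gen_bracket (H i) (F j) = scale (-2) (bas (F (i + j)))"
| "gen_bracket (F j) (H i) = - scale (-2) (bas (F (i + j)))"
| "gen_bracket (D i) (D j) = scale (of_int (j - i)) (bas (D (i + j)))
     + scale (delta0 (i + j) * (of_int (i ^ 3 - i) / 12)) (bas Cen)"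
| "gen_bracket (D i) (H j) = scale (of_int j) (bas (H (i + j)))"
| "gen_bracket (H j) (D i) = - scale (of_int j) (bas (H (i + j)))"
| "gen_bracket (H i) (H j) = scale (2 * of_int i * delta0 (i + j)) (bas Cen)"
| "gen_bracket (D i) (E j) = scale (of_int j) (bas (E (i + j)))"
| "gen_bracket (E j) (D i) = - scale (of_int j) (bas (E (i + j)))"
| "gen_bracket (D i) (F j) = scale (of_int j) (bas (F (i + j)))"
| "gen_bracket (F j) (D i) = - scale (of_int j) (bas (F (i + j)))"
| "gen_bracket (E i) (E j) = 0"
| "gen_bracket (F i) (F j) = 0"
| "gen_bracket Cen b = 0"
| "gen_bracket b Cen = 0"

definition bracket :: "affvir \<Rightarrow> affvir \<Rightarrow> affvir" where
  "bracket x y = lin_ext scale (\<lambda>a. lin_ext scale (gen_bracket a) y) x"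


section \<open>Modules over the affine-Virasoro algebra\<close>

text \<open>The fields \<open>mult\<close> and \<open>one\<close> inherited from \<open>module\<close> play no role; no law below
  mentions them.\<close>

record 'v affvir_module = "(complex, 'v) module" +
  lact :: "affvir \<Rightarrow> 'v \<Rightarrow> 'v"  (infixr \<open>\<rhd>\<index>\<close> 75)

locale affvir_module = Module.module complex_field M
  for M :: "'v affvir_module" (structure) +
  assumes lact_closed: "v \<in> carrier M \<Longrightarrow> x \<rhd> v \<in> carrier M"
    and lact_add_left: "v \<in> carrier M \<Longrightarrow> (x + y) \<rhd> v = (x \<rhd> v) \<oplus> (y \<rhd> v)"
    and lact_scale_left: "v \<in> carrier M \<Longrightarrow> scale c x \<rhd> v = c \<odot> (x \<rhd> v)"
    and lact_add_right:
      "u \<in> carrier M \<Longrightarrow> v \<in> carrier M \<Longrightarrow> x \<rhd> (u \<oplus> v) = (x \<rhd> u) \<oplus> (x \<rhd> v)"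
    and lact_smult_right: "v \<in> carrier M \<Longrightarrow> x \<rhd> (c \<odot> v) = c \<odot> (x \<rhd> v)"
    and lact_bracket: "v \<in> carrier M \<Longrightarrow> bracket x y \<rhd> v = (x \<rhd> (y \<rhd> v)) \<ominus> (y \<rhd> (x \<rhd> v))"

locale affvir_submodule = submodule N complex_field M
  for N and M :: "'v affvir_module" (structure) +
  assumes lact_closed: "v \<in> N \<Longrightarrow> x \<rhd> v \<in> N"

locale irreducible_affvir_module = affvir_module M
  for M :: "'v affvir_module" (structure) +
  assumes nonzero: "carrier M \<noteq> {\<zero>}"
    and submodules: "affvir_submodule N M \<Longrightarrow> N = {\<zero>} \<or> N = carrier M"

definition maximal_proper_submodule :: "'v set \<Rightarrow> 'v affvir_module \<Rightarrow> bool" where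
  "maximal_proper_submodule J M \<longleftrightarrow> affvir_submodule J M \<and> J \<noteq> carrier M \<and>
     (\<forall>N. affvir_submodule N M \<and> N \<noteq> carrier M \<and> J \<subseteq> N \<longrightarrow> N = J)"

text \<open>Scalars and the algebra act on cosets through representatives, in the style of
  \<^const>\<open>rcoset_mult\<close>: for a subspace \<open>N\<close> stable under the action, the unions below are
  unions of one and the same coset.\<close>

definition quotient_module :: "'v affvir_module \<Rightarrow> 'v set \<Rightarrow> 'v set affvir_module" where
  "quotient_module M N =
     \<lparr>carrier = a_rcosets\<^bsub>M\<^esub> N, monoid.mult = undefined, one = undefined,
      ring.zero = N, add = set_add M,
      module.smult = (\<lambda>c A. \<Union>v\<in>A. N +>\<^bsub>M\<^esub> (c \<odot>\<^bsub>M\<^esub> v)),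
      lact = (\<lambda>x A. \<Union>v\<in>A. N +>\<^bsub>M\<^esub> (x \<rhd>\<^bsub>M\<^esub> v))\<rparr>"


subsection \<open>Tensor products\<close>

text \<open>The free vector space on the set \<open>M \<times> N\<close>, on which \<open>x\<close> acts by the linear map
  \<open>(u, v) \<mapsto> (x u, v) + (u, x v)\<close>. It becomes a module over the algebra only after dividing
  out the bilinearity relations.\<close>

definition free_product_space ::
    "'v affvir_module \<Rightarrow> 'w affvir_module \<Rightarrow> ('v \<times> 'w \<Rightarrow>\<^sub>0 complex) affvir_module" where
  "free_product_space M N =
     \<lparr>carrier = {z. Poly_Mapping.keys z \<subseteq> carrier M \<times> carrier N},
      monoid.mult = undefined, one = undefined, ring.zero = 0, add = (+),
      module.smult = scale,
      lact = (\<lambda>x. lin_ext scale (\<lambda>(u, v). Poly_Mapping.single (x \<rhd>\<^bsub>M\<^esub> u, v) 1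
                                      + Poly_Mapping.single (u, x \<rhd>\<^bsub>N\<^esub> v) 1))\<rparr>"

definition bilinear_relations ::
    "'v affvir_module \<Rightarrow> 'w affvir_module \<Rightarrow> ('v \<times> 'w \<Rightarrow>\<^sub>0 complex) set" where
  "bilinear_relations M N =
     (\<lambda>R. submodule R complex_field (free_product_space M N)) hull
       ({Poly_Mapping.single (u \<oplus>\<^bsub>M\<^esub> u', v) 1 - Poly_Mapping.single (u, v) 1
           - Poly_Mapping.single (u', v) 1 | u u' v.
           u \<in> carrier M \<and> u' \<in> carrier M \<and> v \<in> carrier N}
      \<union> {Poly_Mapping.single (u, v \<oplus>\<^bsub>N\<^esub> v') 1 - Poly_Mapping.single (u, v) 1
           - Poly_Mapping.single (u, v') 1 | u v v'.
           u \<in> carrier M \<and> v \<in> carrier N \<and> v' \<in> carrier N}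
      \<union> {Poly_Mapping.single (c \<odot>\<^bsub>M\<^esub> u, v) 1 - Poly_Mapping.single (u, v) c | c u v.
           u \<in> carrier M \<and> v \<in> carrier N}
      \<union> {Poly_Mapping.single (u, c \<odot>\<^bsub>N\<^esub> v) 1 - Poly_Mapping.single (u, v) c | c u v.
           u \<in> carrier M \<and> v \<in> carrier N})"

definition tensor_module ::
    "'v affvir_module \<Rightarrow> 'w affvir_module \<Rightarrow> ('v \<times> 'w \<Rightarrow>\<^sub>0 complex) set affvir_module"
    (infixr \<open>\<otimes>\<^sub>L\<close> 70) where
  "M \<otimes>\<^sub>L N = quotient_module (free_product_space M N) (bilinear_relations M N)"


section \<open>The modules on polynomials in two variables\<close>

text \<open>The polynomial ring in \<open>s\<close>, \<open>t\<close> is \<open>complex poly poly\<close>, with \<open>s\<close> the outer and \<open>t\<close> the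
  inner variable.\<close>

definition cst :: "complex \<Rightarrow> complex poly poly" where
  "cst c = [:[:c:]:]"

definition svar :: "complex poly poly" where
  "svar = [:0, 1:]"

definition tvar :: "complex poly poly" where
  "tvar = [:[:0, 1:]:]"

text \<open>\<open>shift i k g\<close> is \<open>g (s - i, t - k)\<close>.\<close>

definition shift :: "int \<Rightarrow> int \<Rightarrow> complex poly poly \<Rightarrow> complex poly poly" where
  "shift i k g = pcompose (map_poly (\<lambda>q. pcompose q [:- of_int k, 1:]) g) [:- of_int i, 1:]"

fun omega_act ::
    "complex \<Rightarrow> complex \<Rightarrow> complex \<Rightarrow> complex \<Rightarrow> gen \<Rightarrow> complex poly poly \<Rightarrow> complex poly poly" where
  "omega_act l a b c (E i) g = cst (l powi i * a) * shift i 2 g"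
| "omega_act l a b c (F i) g = - cst (l powi i / a) * (cst (1/2) * tvar - cst b)
     * (cst (1/2) * tvar + cst b + 1) * shift i (-2) g"
| "omega_act l a b c (H i) g = cst (l powi i) * tvar * shift i 0 g"
| "omega_act l a b c (D i) g = cst (l powi i) * (svar + cst (of_int i * c)) * shift i 0 g"
| "omega_act l a b c Cen g = 0"

fun delta_act ::
    "complex \<Rightarrow> complex \<Rightarrow> complex \<Rightarrow> complex \<Rightarrow> gen \<Rightarrow> complex poly poly \<Rightarrow> complex poly poly" where
  "delta_act l a b c (E i) g = - cst (l powi i / a) * (cst (1/2) * tvar + cst b)
     * (cst (1/2) * tvar - cst b - 1) * shift i 2 g"
| "delta_act l a b c (F i) g = cst (l powi i * a) * shift i (-2) g"
| "delta_act l a b c (H i) g = cst (l powi i) * tvar * shift i 0 g"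
| "delta_act l a b c (D i) g = cst (l powi i) * (svar + cst (of_int i * c)) * shift i 0 g"
| "delta_act l a b c Cen g = 0"

fun theta_act ::
    "complex \<Rightarrow> complex \<Rightarrow> complex \<Rightarrow> complex \<Rightarrow> gen \<Rightarrow> complex poly poly \<Rightarrow> complex poly poly" where
  "theta_act l a b c (E i) g = cst (l powi i * a) * (cst (1/2) * tvar + cst b) * shift i 2 g"
| "theta_act l a b c (F i) g = - cst (l powi i / a) * (cst (1/2) * tvar - cst b) * shift i (-2) g"
| "theta_act l a b c (H i) g = cst (l powi i) * tvar * shift i 0 g"
| "theta_act l a b c (D i) g = cst (l powi i) * (svar + cst (of_int i * c)) * shift i 0 g"
| "theta_act l a b c Cen g = 0"

definition poly_module ::
    "(gen \<Rightarrow> complex poly poly \<Rightarrow> complex poly poly) \<Rightarrow> complex poly poly affvir_module" where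
  "poly_module act =
     \<lparr>carrier = UNIV, monoid.mult = (*), one = 1, ring.zero = 0, add = (+),
      module.smult = (\<lambda>c g. cst c * g),
      lact = (\<lambda>x g. lin_ext (\<lambda>c p. cst c * p) (\<lambda>b. act b g) x)\<rparr>"

definition Omega :: "complex \<Rightarrow> complex \<Rightarrow> complex \<Rightarrow> complex \<Rightarrow> complex poly poly affvir_module" where
  "Omega l \<alpha> \<beta> \<gamma> = poly_module (omega_act l \<alpha> \<beta> \<gamma>)"

definition Delta :: "complex \<Rightarrow> complex \<Rightarrow> complex \<Rightarrow> complex \<Rightarrow> complex poly poly affvir_module" where
  "Delta l \<alpha> \<beta> \<gamma> = poly_module (delta_act l \<alpha> \<beta> \<gamma>)"

definition Theta :: "complex \<Rightarrow> complex \<Rightarrow> complex \<Rightarrow> complex \<Rightarrow> complex poly poly affvir_module" where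
  "Theta l \<alpha> \<beta> \<gamma> = poly_module (theta_act l \<alpha> \<beta> \<gamma>)"


section \<open>The universal enveloping algebra and highest weight modules\<close>

text \<open>The tensor algebra of a vector space with basis \<open>'b\<close> is the monoid algebra of the free
  monoid on \<open>'b\<close>. The monoid is written additively because the multiplication on
  \<open>_ \<Rightarrow>\<^sub>0 _\<close> is the convolution with respect to \<open>+\<close>; a separate copy of lists avoids a
  global \<open>monoid_add\<close> instance for \<open>list\<close>.\<close>

datatype 'b tensor_word = Word (letters: "'b list")

instantiation tensor_word :: (type) monoid_add
begin

definition zero_tensor_word :: "'a tensor_word" where
  "zero_tensor_word = Word []"

definition plus_tensor_word :: "'a tensor_word \<Rightarrow> 'a tensor_word \<Rightarrow> 'a tensor_word" where
  "plus_tensor_word u v = Word (letters u @ letters v)"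

instance
  by standard (simp_all add: zero_tensor_word_def plus_tensor_word_def)

end

type_synonym tensor_alg = "gen tensor_word \<Rightarrow>\<^sub>0 complex"

definition emb :: "affvir \<Rightarrow> tensor_alg" where
  "emb = lin_ext scale (\<lambda>b. Poly_Mapping.single (Word [b]) 1)"

definition U_ideal :: "tensor_alg set" where
  "U_ideal = Idl\<^bsub>ring_of_type_algebra\<^esub> {emb x * emb y - emb y * emb x - emb (bracket x y) | x y. True}"

definition U_alg :: "tensor_alg set ring" where
  "U_alg = ring_of_type_algebra Quot U_ideal"

definition U_class :: "tensor_alg \<Rightarrow> tensor_alg set" where
  "U_class p = U_ideal +>\<^bsub>ring_of_type_algebra\<^esub> p"

definition U_module :: "tensor_alg set affvir_module" where
  "U_module =
     \<lparr>carrier = carrier U_alg, monoid.mult = monoid.mult U_alg, one = \<one>\<^bsub>U_alg\<^esub>,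
      ring.zero = \<zero>\<^bsub>U_alg\<^esub>, add = add U_alg,
      module.smult = (\<lambda>c u. U_class (scale c 1) \<otimes>\<^bsub>U_alg\<^esub> u),
      lact = (\<lambda>x u. U_class (emb x) \<otimes>\<^bsub>U_alg\<^esub> u)\<rparr>"

locale left_ideal = additive_subgroup I R
  for I and R (structure) +
  assumes l_closed: "a \<in> I \<Longrightarrow> x \<in> carrier R \<Longrightarrow> x \<otimes> a \<in> I"

definition verma_ideal :: "complex \<Rightarrow> complex \<Rightarrow> complex \<Rightarrow> tensor_alg set set" where
  "verma_ideal \<eta> \<epsilon> \<theta> = (\<lambda>I. left_ideal I U_alg) hull (U_class `
     ({emb (bas (E 0))}
      \<union> (\<Union>i\<in>{0<..}. {emb (bas (E i)), emb (bas (F i)), emb (bas (H i)), emb (bas (D i))})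
      \<union> {emb (bas (D 0)) - scale \<eta> 1, emb (bas (H 0)) - scale \<epsilon> 1, emb (bas Cen) - scale \<theta> 1}))"

definition verma_module ::
    "complex \<Rightarrow> complex \<Rightarrow> complex \<Rightarrow> tensor_alg set set affvir_module" where
  "verma_module \<eta> \<epsilon> \<theta> = quotient_module U_module (verma_ideal \<eta> \<epsilon> \<theta>)"

definition irr_hw_module ::
    "complex \<Rightarrow> complex \<Rightarrow> complex \<Rightarrow> tensor_alg set set set affvir_module" where
  "irr_hw_module \<eta> \<epsilon> \<theta> = quotient_module (verma_module \<eta> \<epsilon> \<theta>)
     (THE J. maximal_proper_submodule J (verma_module \<eta> \<epsilon> \<theta>))"

end

theory Submission
  imports Defs
begin

text \<open>
  Let \<open>M\<close> be one of the three polynomial modules and \<open>V\<close> the irreducible highest weight module.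
  Irreducibility of \<open>M \<otimes> V\<close> rests on the fact that \<open>V\<close> is smooth: a given vector of \<open>V\<close> is
  annihilated by \<open>E i\<close>, \<open>F i\<close>, \<open>H i\<close> and \<open>D i\<close> for all large \<open>i\<close> (\<open>eventually_annihilated\<close>).
  If a submodule \<open>W\<close> contains \<open>\<Sum> g\<^sub>k \<otimes> v\<^sub>k\<close>, it therefore contains \<open>\<Sum> (x g\<^sub>k) \<otimes> v\<^sub>k\<close> for each
  such generator \<open>x\<close> of large index (\<open>family_loop_action\<close>). On polynomials these generators act, up
  to the scalar \<open>\<lambda>\<^sup>i\<close>, by simple operators: \<open>s\<close> is translated by \<open>i\<close>, the result is multiplied by
  \<open>t\<close> or by \<open>s + i \<gamma>\<close>, or \<open>t\<close> is translated by \<open>2\<close> or \<open>-2\<close> and the result multiplied by a fixed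
  polynomial \<open>P\<close> or \<open>Q\<close> in \<open>t\<close>. The three modules differ only in the pair \<open>P\<close>, \<open>Q\<close>.

  Starting from a nonzero element of \<open>W\<close>, the difference of \<open>H i\<close> and \<open>H (i + 1)\<close> lowers the degree
  in \<open>s\<close> by one and keeps a nonzero leading term (\<open>s_leading_descent\<close>). Once \<open>s\<close> is gone, a
  combination of \<open>E i\<close>, \<open>F i\<close> and multiplication by polynomials in \<open>t\<close> lowers the degree in \<open>t\<close>
  (\<open>t_leading_descent\<close>). In the case of \<open>\<Theta>\<close> it multiplies the coefficient of \<open>t\<^sup>n\<close> by
  \<open>2 n (n - 1 - 2 \<beta>)\<close>, and this is nonzero for all \<open>n > 0\<close> exactly if \<open>2 \<beta>\<close> is not a natural
  number. So \<open>W\<close> contains \<open>1 \<otimes> v\<close> with \<open>v \<noteq> 0\<close>, and then \<open>H i\<close> and \<open>D i\<close> generate all \<open>g \<otimes> v\<close>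
  (\<open>tens_all\<close>). The vectors \<open>v\<close> such that \<open>W\<close> contains \<open>g \<otimes> v\<close> for all \<open>g\<close> form a submodule of
  \<open>V\<close>, hence are all of \<open>V\<close>, and \<open>W\<close> is the whole tensor product (\<open>W_full\<close>).

  The tensor product must also be nonzero, which amounts to \<open>V \<noteq> 0\<close>. This is where the theorem of
  Poincare, Birkhoff and Witt enters: the algebra acts on the space with basis the sorted words in
  lowering generators (\<open>acts_relation\<close>), and the empty word is a nonzero highest weight vector of
  the prescribed weight (\<open>one_notin_verma_left\<close>). In the Verma module the nonempty lowering words span
  a hyperplane that contains every proper submodule, because \<open>D 0\<close> and \<open>H 0\<close> separate the highest
  weight from the other weights (\<open>proper_left_ideal_hyperplane\<close>). Hence there is a largest proper
  submodule, and the projection onto the highest weight line along the hyperplane descends to \<open>V\<close> and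
  shows that \<open>1 \<otimes> 1\<close> is nonzero (\<open>one_tens_not_bilin\<close>).

  Throughout, \<open>V\<close> is described as the quotient of the tensor algebra by a left ideal \<open>max_left\<close>, and
  \<open>M \<otimes> V\<close> as a quotient of a space of finitely supported functions, so that most computations
  take place in those spaces, modulo a subspace, rather than with cosets.
\<close>

section \<open>Linear algebra on finitely supported functions\<close>

lemma lookup_scale [simp]: "Poly_Mapping.lookup (scale c x) b = c * Poly_Mapping.lookup x b"
  unfolding scale_def by transfer (simp add: when_def)

interpretation pm: vector_space "scale :: complex \<Rightarrow> ('b \<Rightarrow>\<^sub>0 complex) \<Rightarrow> _"
  by standard (auto intro!: poly_mapping_eqI simp: lookup_add algebra_simps)

lemma vs_scale: "vector_space (scale :: complex \<Rightarrow> ('b \<Rightarrow>\<^sub>0 complex) \<Rightarrow> _)"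
  by standard

lemma scale_single [simp]: "scale c (Poly_Mapping.single k d) = Poly_Mapping.single k (c * d)"
  by (auto intro!: poly_mapping_eqI simp: lookup_single when_def)

lemma sum_scale_single:
  "z = (\<Sum>k\<in>Poly_Mapping.keys z. scale (Poly_Mapping.lookup z k) (Poly_Mapping.single k 1))"
  by (auto intro!: poly_mapping_eqI simp: lookup_sum lookup_single when_def in_keys_iff)

lemma lin_ext_superset:
  assumes "vector_space sc" "finite A" "Poly_Mapping.keys x \<subseteq> A"
  shows "lin_ext sc f x = (\<Sum>b\<in>A. sc (Poly_Mapping.lookup x b) (f b))"
proof -
  interpret vector_space sc by fact
  show ?thesis
    unfolding lin_ext_def using assms(2,3)
    by (intro sum.mono_neutral_left) (auto simp: in_keys_iff)
qed

lemma lin_ext_linear: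
  assumes "vector_space sc"
  shows "Vector_Spaces.linear scale sc (lin_ext sc f)"
proof -
  interpret vector_space sc by fact
  have add: "lin_ext sc f (x + y) = lin_ext sc f x + lin_ext sc f y" for x y
  proof -
    let ?A = "Poly_Mapping.keys x \<union> Poly_Mapping.keys y"
    have "lin_ext sc f (x + y) = (\<Sum>b\<in>?A. sc (Poly_Mapping.lookup (x + y) b) (f b))"
      by (rule lin_ext_superset[OF assms]) (auto dest: subsetD[OF Poly_Mapping.keys_add])
    also have "\<dots> = (\<Sum>b\<in>?A. sc (Poly_Mapping.lookup x b) (f b))
                  + (\<Sum>b\<in>?A. sc (Poly_Mapping.lookup y b) (f b))"
      by (simp add: lookup_add scale_left_distrib sum.distrib)
    also have "\<dots> = lin_ext sc f x + lin_ext sc f y"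
      by (simp add: lin_ext_superset[OF assms, of ?A])
    finally show ?thesis .
  qed
  have "lin_ext sc f (scale c x) = sc c (lin_ext sc f x)" for c x
  proof -
    have "lin_ext sc f (scale c x)
        = (\<Sum>b\<in>Poly_Mapping.keys x. sc (Poly_Mapping.lookup (scale c x) b) (f b))"
      by (rule lin_ext_superset[OF assms]) (auto simp: in_keys_iff)
    then show ?thesis
      by (simp add: lin_ext_def scale_sum_right cong: sum.cong)
  qed
  with add show ?thesis
    by (simp add: linear_iff_module_hom module_hom_iff assms vs_scale pm.module_axioms module_axioms)
qed

lemma lin_ext_single:
  assumes "vector_space sc"
  shows "lin_ext sc f (Poly_Mapping.single k c) = sc c (f k)"
proof -
  interpret vector_space sc by fact
  show ?thesis by (subst lin_ext_superset[OF assms, of "{k}"]) auto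
qed

lemma vs_mult: "vector_space ((*) :: complex \<Rightarrow> _)"
  by standard (auto simp: algebra_simps)

lemma linear_rules:
  assumes "Vector_Spaces.linear s1 s2 f"
  shows "f 0 = 0" "f (x + y) = f x + f y" "f (x - y) = f x - f y" "f (- x) = - f x"
    "f (s1 c x) = s2 c (f x)" "f (\<Sum>i\<in>I. g i) = (\<Sum>i\<in>I. f (g i))"
proof -
  interpret Vector_Spaces.linear s1 s2 f by fact
  show "f 0 = 0" "f (x + y) = f x + f y" "f (x - y) = f x - f y" "f (- x) = - f x"
    "f (s1 c x) = s2 c (f x)" "f (\<Sum>i\<in>I. g i) = (\<Sum>i\<in>I. f (g i))"
    by (rule zero add diff neg scale sum)+
qed

lemmas lin_ext_simps [simp] = linear_rules[OF lin_ext_linear[OF vs_scale]] lin_ext_single[OF vs_scale]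

lemma linear_scaleI:
  assumes "\<And>x y. f (x + y) = f x + f y" "\<And>c x. f (scale c x) = scale c (f x)"
  shows "Vector_Spaces.linear scale scale f"
  using assms by (simp add: linear_iff_module_hom module_hom_iff vs_scale pm.module_axioms)

text \<open>Identities and memberships that are linear in an argument need only be checked on basis elements.\<close>

lemma linear_eq_on_basis:
  assumes "Vector_Spaces.linear scale sc f" "Vector_Spaces.linear scale sc g"
    and "\<And>k. k \<in> Poly_Mapping.keys z \<Longrightarrow> f (Poly_Mapping.single k 1) = g (Poly_Mapping.single k 1)"
  shows "f z = g z"
  by (subst (1 2) sum_scale_single) (simp only: linear_rules[OF assms(1)] linear_rules[OF assms(2)] assms(3) cong: sum.cong)

lemma linear_in_subspace:
  assumes "Vector_Spaces.linear scale scale f" "pm.subspace S"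
    and "\<And>k. k \<in> Poly_Mapping.keys z \<Longrightarrow> f (Poly_Mapping.single k 1) \<in> S"
  shows "f z \<in> S"
  by (subst sum_scale_single)
     (simp only: linear_rules[OF assms(1)], intro pm.subspace_sum pm.subspace_scale assms)

lemma keys_lin_ext: "Poly_Mapping.keys (lin_ext scale f z) \<subseteq> (\<Union>k\<in>Poly_Mapping.keys z. Poly_Mapping.keys (f k))"
proof -
  have sub: "pm.subspace {y. Poly_Mapping.keys y \<subseteq> (\<Union>k\<in>Poly_Mapping.keys z. Poly_Mapping.keys (f k))}"
    by (auto simp: pm.subspace_def in_keys_iff lookup_add subset_iff) (metis add.right_neutral in_keys_iff)+
  have "lin_ext scale f z \<in> {y. Poly_Mapping.keys y \<subseteq> (\<Union>k\<in>Poly_Mapping.keys z. Poly_Mapping.keys (f k))}"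
    by (rule linear_in_subspace[OF lin_ext_linear[OF vs_scale] sub]) auto
  then show ?thesis by simp
qed

lemma lin_ext_cong:
  "(\<And>k. k \<in> Poly_Mapping.keys z \<Longrightarrow> f k = g k) \<Longrightarrow> lin_ext sc f z = lin_ext sc g z"
  by (simp add: lin_ext_def)

lemma in_subspace_cong:
  assumes "pm.subspace V" "p - q \<in> V"
  shows "p \<in> V \<longleftrightarrow> q \<in> V"
  using pm.subspace_add[OF assms, of q] pm.subspace_diff[OF assms(1) _ assms(2), of p] by auto


section \<open>The Jacobi identity\<close>

lemma scale_bas: "scale c (bas b) = Poly_Mapping.single b c"
  by (simp add: bas_def)

lemma bracket_simps [simp]:
  "bracket (x + y) z = bracket x z + bracket y z"
  "bracket (x - y) z = bracket x z - bracket y z"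
  "bracket (- x) z = - bracket x z"
  "bracket (scale c x) z = scale c (bracket x z)"
  "bracket 0 z = 0"
  unfolding bracket_def by simp_all

lemma lin_ext_fun:
  "lin_ext scale (\<lambda>a. f a + g a) x = lin_ext scale f x + lin_ext scale g x"
  "lin_ext scale (\<lambda>a. scale c (f a)) x = scale c (lin_ext scale f x)"
  "lin_ext scale (\<lambda>a. - f a) x = - lin_ext scale f x"
  "lin_ext scale (\<lambda>a. f a - g a) x = lin_ext scale f x - lin_ext scale g x"
  "lin_ext scale (\<lambda>a. 0) x = 0"
  by (simp_all add: lin_ext_def pm.scale_right_distrib sum.distrib pm.scale_sum_right mult.commute
      sum_negf sum_subtractf pm.scale_right_diff_distrib)

lemma bracket_simps_right [simp]:
  "bracket z (x + y) = bracket z x + bracket z y"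
  "bracket z (x - y) = bracket z x - bracket z y"
  "bracket z (- x) = - bracket z x"
  "bracket z (scale c x) = scale c (bracket z x)"
  "bracket z 0 = 0"
  unfolding bracket_def by (simp_all add: lin_ext_fun)

lemma bracket_single [simp]:
  "bracket (Poly_Mapping.single a c) (Poly_Mapping.single b d) = scale (c * d) (gen_bracket a b)"
  unfolding bracket_def by simp

lemma gen_bracket_antisym: "gen_bracket a b = - gen_bracket b a"
proof (cases "\<exists>i j. (a = H i \<and> b = H j \<or> a = D i \<and> b = D j) \<and> i + j = 0")
  case True
  then obtain i where "a = H i \<and> b = H (- i) \<or> a = D i \<and> b = D (- i)"
    by (metis add.commute eq_neg_iff_add_eq_0)
  then show ?thesis
    by (auto simp: scale_bas delta0_def simp flip: single_add single_uminus)
       (simp_all add: minus_divide_left minus_diff_eq flip: single_uminus)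
next
  case False
  then show ?thesis
    by (cases a; cases b)
       (auto simp: scale_bas delta0_def add.commute simp flip: single_uminus)
qed

text \<open>The Jacobi identity, in the form that \<open>bracket (bas a)\<close> is a derivation. Central terms occur only
  if the three indices add up to zero, and only then do their coefficients match.\<close>

lemma gen_jacobi:
  "bracket (bas a) (gen_bracket b c) = bracket (gen_bracket a b) (bas c) + bracket (bas b) (gen_bracket a c)"
proof -
  define ix where "ix = (\<lambda>g. case g of E i \<Rightarrow> i | F i \<Rightarrow> i | H i \<Rightarrow> i | D i \<Rightarrow> i | Cen \<Rightarrow> 0)"
  show ?thesis
  proof (cases "ix a + ix b + ix c = 0")
    case True
    define k where "k = - ix a - ix b"
    have "ix c = k" using True by (simp add: k_def)
    then have "c = E k \<or> c = F k \<or> c = H k \<or> c = D k \<or> c = Cen"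
      by (cases c) (auto simp: ix_def)
    then show ?thesis
      apply (cases a; cases b)
      apply (auto simp: scale_bas ix_def bas_def k_def algebra_simps delta0_def lookup_add lookup_minus
          lookup_single when_def power3_eq_cube intro!: poly_mapping_eqI simp flip: single_uminus)
      apply (simp_all add: field_simps)
      done
  next
    case False
    then show ?thesis
      apply (cases a; cases b; cases c)
                     apply (simp_all add: scale_bas ix_def bas_def algebra_simps delta0_def flip: single_uminus single_add)
      apply (rule arg_cong[where f="Poly_Mapping.single _"], simp)+
      done
  qed
qed

section \<open>A module with a nonzero highest weight vector\<close>

text \<open>The lowering generators span the nilpotent part \<open>n\<^sub>-\<close> of a triangular decomposition. The other
  generators span the subalgebra that acts on a highest weight vector by scalars.\<close>

fun lowering :: "gen \<Rightarrow> bool" where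
  "lowering (E i) \<longleftrightarrow> i < 0"
| "lowering (F i) \<longleftrightarrow> i \<le> 0"
| "lowering (H i) \<longleftrightarrow> i < 0"
| "lowering (D i) \<longleftrightarrow> i < 0"
| "lowering Cen \<longleftrightarrow> False"

text \<open>A numbering of the lowering generators. Every injective numbering would serve the purpose.\<close>

fun rank :: "gen \<Rightarrow> int" where
  "rank (E i) = 4 * i"
| "rank (F i) = 4 * i + 1"
| "rank (H i) = 4 * i + 2"
| "rank (D i) = 4 * i + 3"
| "rank Cen = 0"

lemma rank_inject: "lowering x \<Longrightarrow> lowering y \<Longrightarrow> rank x = rank y \<Longrightarrow> x = y"
  by (cases x; cases y) (auto, presburger+)

definition precedes :: "gen \<Rightarrow> gen list \<Rightarrow> bool" where
  "precedes x N \<longleftrightarrow> lowering x \<and> (\<forall>y\<in>set N. rank x \<le> rank y)"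

fun normal :: "gen list \<Rightarrow> bool" where
  "normal [] \<longleftrightarrow> True"
| "normal (x # N) \<longleftrightarrow> precedes x N \<and> normal N"

abbreviation basis_vec :: "gen list \<Rightarrow> gen list \<Rightarrow>\<^sub>0 complex" where
  "basis_vec N \<equiv> Poly_Mapping.single N 1"

locale highest_weight =
  fixes \<eta> \<epsilon> \<theta> :: complex
begin

fun wt :: "gen \<Rightarrow> complex" where
  "wt (D i) = (if i = 0 then \<eta> else 0)"
| "wt (H i) = (if i = 0 then \<epsilon> else 0)"
| "wt Cen = \<theta>"
| "wt (E i) = 0"
| "wt (F i) = 0"

text \<open>The action of a generator \<open>x\<close> on a sorted word \<open>N\<close> of lowering generators. If \<open>x # N\<close> is sorted,
  it is the result. Otherwise \<open>N = j # N'\<close>, and the relation \<open>x j = j x + [x, j]\<close> dictates the value.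
  In the term \<open>j (x N')\<close> the words of \<open>x N'\<close> need not be shorter than \<open>N\<close>, but those that are not
  admit \<open>j\<close> as a first letter, so that no recursive call is needed for them. This justifies recursion
  on a bound for the length of \<open>N\<close>.\<close>

primrec act_upto :: "nat \<Rightarrow> gen \<Rightarrow> gen list \<Rightarrow> gen list \<Rightarrow>\<^sub>0 complex" where
  "act_upto 0 x N = (if lowering x then basis_vec [x] else Poly_Mapping.single [] (wt x))"
| "act_upto (Suc n) x N = (case N of
      [] \<Rightarrow> if lowering x then basis_vec [x] else Poly_Mapping.single [] (wt x)
    | j # N' \<Rightarrow> if precedes x N then basis_vec (x # N)
        else lin_ext scale (\<lambda>K. if precedes j K then basis_vec (j # K) else act_upto n j K) (act_upto n x N')
           + lin_ext scale (\<lambda>y. act_upto n y N') (gen_bracket x j))"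

definition act :: "gen \<Rightarrow> gen list \<Rightarrow> gen list \<Rightarrow>\<^sub>0 complex" where
  "act x N = act_upto (length N) x N"

definition acts :: "gen \<Rightarrow> (gen list \<Rightarrow>\<^sub>0 complex) \<Rightarrow> gen list \<Rightarrow>\<^sub>0 complex" where
  "acts x = lin_ext scale (act x)"

definition lie_act :: "affvir \<Rightarrow> (gen list \<Rightarrow>\<^sub>0 complex) \<Rightarrow> gen list \<Rightarrow>\<^sub>0 complex" where
  "lie_act A z = lin_ext scale (\<lambda>x. acts x z) A"

text \<open>The possible terms of \<open>x N\<close>: sorted words no longer than \<open>N\<close>, and the word obtained by sorting
  \<open>x\<close> into \<open>N\<close>.\<close>

definition terms_ok :: "gen \<Rightarrow> gen list \<Rightarrow> gen list \<Rightarrow> bool" where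
  "terms_ok x N K \<longleftrightarrow> normal K \<and> (length K \<le> length N \<or>
     length K = Suc (length N) \<and> lowering x \<and> set K = insert x (set N))"

lemma act_upto_precedes: "precedes x N \<Longrightarrow> length N \<le> n \<Longrightarrow> act_upto n x N = basis_vec (x # N)"
  by (cases n; cases N) (auto simp: precedes_def)

text \<open>The shape of the terms and the independence of the bound support each other: the terms of
  \<open>x N'\<close> that reach the recursive call are short enough for the smaller bound.\<close>

lemma act_upto_stable:
  assumes "normal N" "length N \<le> n"
  shows "act_upto (Suc n) x N = act_upto n x N \<and> (\<forall>K\<in>Poly_Mapping.keys (act_upto n x N). terms_ok x N K)"
  using assms
proof (induction n arbitrary: x N)
  case 0
  then show ?case
    by (auto simp: terms_ok_def precedes_def split: if_splits)
next
  case (Suc n)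
  show ?case
  proof (cases N)
    case Nil
    then show ?thesis by (auto simp: terms_ok_def precedes_def split: if_splits)
  next
    case (Cons j N')
    show ?thesis
    proof (cases "precedes x N")
      case True
      with Suc.prems Cons show ?thesis
        by (auto simp: terms_ok_def precedes_def)
    next
      case False
      have N': "normal N'" "length N' \<le> n" "precedes j N'" using Suc.prems Cons by auto
      let ?f = "\<lambda>n K. if precedes j K then basis_vec (j # K) else act_upto n j K"
      have K: "precedes j K \<or> length K \<le> n \<and> length K \<le> length N'" if "K \<in> Poly_Mapping.keys (act_upto n x N')" for K
      proof -
        have "terms_ok x N' K" using Suc.IH[OF N'(1,2), of x] that by blast
        moreover have "precedes j K" if "lowering x" "set K = insert x (set N')"
          using that False N'(3) Cons by (auto simp: precedes_def)
        ultimately show ?thesis using N' by (auto simp: terms_ok_def)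
      qed
      have nK: "normal K" if "K \<in> Poly_Mapping.keys (act_upto n x N')" for K
        using Suc.IH[OF N'(1,2), of x] that by (auto simp: terms_ok_def)
      have 1: "lin_ext scale (?f (Suc n)) (act_upto (Suc n) x N') = lin_ext scale (?f n) (act_upto n x N')"
      proof -
        have "?f (Suc n) K = ?f n K" if "K \<in> Poly_Mapping.keys (act_upto n x N')" for K
          using K[OF that] nK[OF that] Suc.IH[of K j] by (auto simp del: act_upto.simps)
        then show ?thesis
          using Suc.IH[OF N'(1,2), of x] by (auto intro!: lin_ext_cong simp del: act_upto.simps)
      qed
      have 2: "lin_ext scale (\<lambda>y. act_upto (Suc n) y N') (gen_bracket x j) = lin_ext scale (\<lambda>y. act_upto n y N') (gen_bracket x j)"
        using Suc.IH[OF N'(1,2)] by (auto intro!: lin_ext_cong simp del: act_upto.simps)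
      have eq: "act_upto (Suc m) x N = lin_ext scale (?f m) (act_upto m x N')
           + lin_ext scale (\<lambda>y. act_upto m y N') (gen_bracket x j)" for m
        using Cons False by simp
      have 3: "terms_ok x N L" if L: "L \<in> Poly_Mapping.keys (lin_ext scale (?f n) (act_upto n x N'))" for L
      proof -
        obtain K where K': "K \<in> Poly_Mapping.keys (act_upto n x N')" "L \<in> Poly_Mapping.keys (?f n K)"
          using subsetD[OF keys_lin_ext L] by blast
        have ok: "terms_ok x N' K" using Suc.IH[OF N'(1,2), of x] K'(1) by blast
        show ?thesis
        proof (cases "precedes j K")
          case True
          then have "L = j # K" using K' by simp
          then show ?thesis using ok True Cons by (auto simp: terms_ok_def)
        next
          case False
          then have "length K \<le> n" "length K \<le> length N'" "L \<in> Poly_Mapping.keys (act_upto n j K)"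
            using K[OF K'(1)] K' by auto
          then have "terms_ok j K L" using Suc.IH[of K j] nK[OF K'(1)] by blast
          then have "normal L" "length L \<le> Suc (length K)" by (auto simp: terms_ok_def)
          then show ?thesis using \<open>length K \<le> length N'\<close> Cons by (simp add: terms_ok_def)
        qed
      qed
      have 4: "terms_ok x N L" if L: "L \<in> Poly_Mapping.keys (lin_ext scale (\<lambda>y. act_upto n y N') (gen_bracket x j))" for L
      proof -
        obtain y where "L \<in> Poly_Mapping.keys (act_upto n y N')"
          using subsetD[OF keys_lin_ext L] by blast
        then have "terms_ok y N' L" using Suc.IH[OF N'(1,2), of y] by blast
        then have "normal L" "length L \<le> Suc (length N')" by (auto simp: terms_ok_def)
        then show ?thesis using Cons by (simp add: terms_ok_def)
      qed
      show ?thesis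
        unfolding eq using 1 2 3 4 by (auto simp del: act_upto.simps dest!: subsetD[OF Poly_Mapping.keys_add])
    qed
  qed
qed

lemma act_upto_eq_act:
  assumes "normal N" "length N \<le> n"
  shows "act_upto n x N = act x N"
  using assms(2)
proof (induction n rule: dec_induct)
  case base
  then show ?case by (simp add: act_def)
next
  case (step n)
  then show ?case using act_upto_stable[of N n x] assms(1) by (simp del: act_upto.simps)
qed

lemma act_terms: "normal N \<Longrightarrow> K \<in> Poly_Mapping.keys (act x N) \<Longrightarrow> terms_ok x N K"
  using act_upto_stable[of N "length N" x] by (auto simp: act_def simp del: act_upto.simps)

lemma acts_basis_vec [simp]: "acts x (basis_vec N) = act x N"
  by (simp add: acts_def)

lemma acts_single: "acts x (Poly_Mapping.single N c) = scale c (act x N)"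
  by (simp add: acts_def)

lemma acts_linear: "Vector_Spaces.linear scale scale (acts x)"
  unfolding acts_def by (rule lin_ext_linear[OF vs_scale])

lemma lie_act_linear1: "Vector_Spaces.linear scale scale (\<lambda>A. lie_act A z)"
  unfolding lie_act_def by (rule lin_ext_linear[OF vs_scale])

lemmas acts_simps [simp] = linear_rules[OF acts_linear]

lemma lie_act_linear2: "Vector_Spaces.linear scale scale (lie_act A)"
  unfolding lie_act_def by (rule linear_scaleI) (simp_all add: lin_ext_fun)

lemmas lie_act_simps [simp] = linear_rules[OF lie_act_linear1] linear_rules[OF lie_act_linear2]

lemma lie_act_single [simp]: "lie_act (Poly_Mapping.single x c) z = scale c (acts x z)"
  by (simp add: lie_act_def)

lemma act_Nil: "act x [] = (if lowering x then basis_vec [x] else Poly_Mapping.single [] (wt x))"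
  by (simp add: act_def)

lemma act_precedes: "precedes x N \<Longrightarrow> act x N = basis_vec (x # N)"
  by (simp add: act_def act_upto_precedes)

lemma act_Cons:
  assumes "normal (j # N)" "\<not> precedes x (j # N)"
  shows "act x (j # N) = acts j (act x N) + lie_act (gen_bracket x j) (basis_vec N)"
proof -
  have "lin_ext scale (\<lambda>K. if precedes j K then basis_vec (j # K) else act_upto (length N) j K) (act x N)
      = acts j (act x N)"
    unfolding acts_def
  proof (rule lin_ext_cong)
    fix K assume "K \<in> Poly_Mapping.keys (act x N)"
    then have ok: "terms_ok x N K" using act_terms assms(1) by simp
    show "(if precedes j K then basis_vec (j # K) else act_upto (length N) j K) = act j K"
    proof (cases "precedes j K")
      case True
      then show ?thesis by (simp add: act_precedes)
    next
      case False
      moreover have "precedes j K" if "lowering x" "set K = insert x (set N)"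
        using that assms by (auto simp: precedes_def)
      ultimately have "length K \<le> length N" using ok by (auto simp: terms_ok_def)
      then show ?thesis using False ok by (simp add: act_upto_eq_act terms_ok_def)
    qed
  qed
  moreover have "lin_ext scale (\<lambda>y. act_upto (length N) y N) (gen_bracket x j) = lie_act (gen_bracket x j) (basis_vec N)"
    by (simp add: lie_act_def act_def)
  ultimately show ?thesis using assms by (simp add: act_def)
qed

text \<open>The weight is a character of the subalgebra spanned by the generators that are not lowering: it
  vanishes on brackets, so the relations hold on the empty word.\<close>

lemma wt_bracket:
  assumes "\<not> lowering x" "\<not> lowering y"
  shows "lie_act (gen_bracket x y) (basis_vec []) = 0"
  using assms by (cases x; cases y) (auto simp: scale_bas bas_def delta0_def act_Nil not_less add_nonneg_eq_0_iff)

lemma lie_act_relation: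
  assumes "\<And>K x y. K \<in> Poly_Mapping.keys z \<Longrightarrow>
     acts x (acts y (basis_vec K)) - acts y (acts x (basis_vec K)) = lie_act (gen_bracket x y) (basis_vec K)"
  shows "lie_act A (lie_act B z) - lie_act B (lie_act A z) = lie_act (bracket A B) z"
proof -
  have 1: "acts x (acts y z) - acts y (acts x z) = lie_act (gen_bracket x y) z" for x y
    by (rule linear_eq_on_basis[of scale "\<lambda>z. acts x (acts y z) - acts y (acts x z)"])
       (auto intro!: linear_scaleI simp: assms[simplified] pm.scale_right_diff_distrib)
  have 2: "acts x (lie_act B z) - lie_act B (acts x z) = lie_act (bracket (bas x) B) z" for x
    by (rule linear_eq_on_basis[of scale "\<lambda>B. acts x (lie_act B z) - lie_act B (acts x z)"])
       (auto intro!: linear_scaleI simp: 1 bas_def pm.scale_right_diff_distrib)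
  show ?thesis
    by (rule linear_eq_on_basis[of scale "\<lambda>A. lie_act A (lie_act B z) - lie_act B (lie_act A z)"])
       (use 2 in \<open>auto intro!: linear_scaleI simp: bas_def pm.scale_right_diff_distrib\<close>)
qed

lemma lie_act_bas: "lie_act (bas x) z = acts x z"
  by (simp add: bas_def)

text \<open>The core of the Poincare-Birkhoff-Witt theorem, by induction on the length of \<open>N\<close>. If \<open>x\<close> or
  \<open>y\<close> can be put in front of \<open>N\<close>, the relation is the recursion that defines the action. Otherwise
  \<open>N = k # P\<close>, and neither \<open>x\<close> nor \<open>y\<close> is a lowering generator that comes before \<open>k\<close>. Then \<open>k\<close> can
  be moved in front of \<open>x y P\<close> and \<open>y x P\<close>, and the commutators with \<open>k\<close> that appear on the way add up to
  the claim by the Jacobi identity.\<close>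

lemma acts_relation:
  assumes "normal N"
  shows "acts x (act y N) - acts y (act x N) = lie_act (gen_bracket x y) (basis_vec N)"
  using assms
proof (induction "length N" arbitrary: N x y rule: less_induct)
  case less
  have first: "acts x (act y N) - acts y (act x N) = lie_act (gen_bracket x y) (basis_vec N)"
    if "precedes y N" for x y
  proof (cases "precedes x (y # N)")
    case False
    then show ?thesis using that less.prems act_Cons[of y N x] by (simp add: act_precedes)
  next
    case True
    then have x: "precedes x N" by (simp add: precedes_def)
    show ?thesis
    proof (cases "precedes y (x # N)")
      case False
      then show ?thesis using x less.prems act_Cons[of x N y] that
        by (simp add: act_precedes gen_bracket_antisym[of x y])
    next
      case _: True
      with True have "x = y" by (auto simp: precedes_def intro: rank_inject)
      moreover have "gen_bracket y y = 0" by (cases y) (auto simp: delta0_def)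
      ultimately show ?thesis by simp
    qed
  qed
  consider "precedes y N" | "precedes x N" | "\<not> precedes x N" "\<not> precedes y N" by blast
  then show ?case
  proof cases
    case 1
    then show ?thesis by (rule first)
  next
    case 2
    then show ?thesis using first[OF 2, of y] by (simp add: gen_bracket_antisym[of x y] algebra_simps)
  next
    case 3
    show ?thesis
    proof (cases N)
      case Nil
      then show ?thesis using 3 by (simp add: wt_bracket act_Nil acts_single precedes_def mult.commute)
    next
      case (Cons k P)
      have P: "normal P" "precedes k P" using less.prems Cons by auto
      have IH: "acts u (act v K) - acts v (act u K) = lie_act (gen_bracket u v) (basis_vec K)"
        if "normal K" "length K \<le> length P" for u v K
        using less.hyps[of K u v] that Cons by simp
      have IHL: "lie_act A (lie_act B (basis_vec P)) - lie_act B (lie_act A (basis_vec P)) = lie_act (bracket A B) (basis_vec P)" for A B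
        by (rule lie_act_relation) (use IH P in auto)
      \<comment> \<open>The relation for \<open>u\<close> and \<open>k\<close> holds on short terms of \<open>v P\<close> by induction, and on the longest one because \<open>k\<close> precedes it.\<close>
      have swap: "acts u (acts k (act v P)) = acts k (acts u (act v P)) + lie_act (gen_bracket u k) (act v P)"
        if uv: "\<not> precedes u N" "\<not> precedes v N" for u v
      proof -
        have "acts u (acts k (act v P)) - acts k (acts u (act v P)) = lie_act (gen_bracket u k) (act v P)"
        proof (rule linear_eq_on_basis[of scale "\<lambda>z. acts u (acts k z) - acts k (acts u z)"])
          fix K assume "K \<in> Poly_Mapping.keys (act v P)"
          then have ok: "terms_ok v P K" using act_terms P(1) by blast
          show "acts u (acts k (basis_vec K)) - acts k (acts u (basis_vec K)) = lie_act (gen_bracket u k) (basis_vec K)"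
          proof (cases "length K \<le> length P")
            case True
            then show ?thesis using ok IH by (simp add: terms_ok_def)
          next
            case False
            then have K: "normal K" "lowering v" "set K = insert v (set P)" using ok by (auto simp: terms_ok_def)
            then have k: "precedes k K" using P(2) uv Cons by (auto simp: precedes_def)
            then have "\<not> precedes u (k # K)" using uv(1) K(3) Cons P(2) by (auto simp: precedes_def)
            then show ?thesis using k K(1) act_Cons[of k K u] by (simp add: act_precedes)
          qed
        qed (auto intro!: linear_scaleI simp: pm.scale_right_diff_distrib)
        then show ?thesis by (simp add: algebra_simps)
      qed
      have expand: "acts u (act v N) = acts k (acts u (act v P)) + lie_act (gen_bracket u k) (act v P)
          + lie_act (gen_bracket v k) (act u P) + lie_act (bracket (bas u) (gen_bracket v k)) (basis_vec P)"
        if "\<not> precedes u N" "\<not> precedes v N" for u v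
      proof -
        have "acts u (lie_act B (basis_vec P)) = lie_act B (act u P) + lie_act (bracket (bas u) B) (basis_vec P)" for B
          using IHL[of "bas u" B] by (simp add: lie_act_bas algebra_simps)
        then show ?thesis
          using act_Cons[of k P v] that less.prems Cons swap[OF that] by (simp add: algebra_simps)
      qed
      have "acts x (act y N) - acts y (act x N)
         = acts k (acts x (act y P) - acts y (act x P))
           + lie_act (bracket (bas x) (gen_bracket y k) - bracket (bas y) (gen_bracket x k)) (basis_vec P)"
        using expand[of x y] expand[of y x] 3 by (simp add: algebra_simps)
      also have "\<dots> = acts k (lie_act (gen_bracket x y) (basis_vec P)) + lie_act (bracket (gen_bracket x y) (bas k)) (basis_vec P)"
        using IH[of P x y] P by (simp add: gen_jacobi[of x y k])
      also have "\<dots> = lie_act (gen_bracket x y) (basis_vec N)"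
        using IHL[of "gen_bracket x y" "bas k"] P Cons by (simp add: lie_act_bas act_precedes algebra_simps)
      finally show ?thesis .
    qed
  qed
qed

definition normal_space :: "(gen list \<Rightarrow>\<^sub>0 complex) set" where
  "normal_space = {z. Poly_Mapping.keys z \<subseteq> Collect normal}"

lemma acts_normal_space: "z \<in> normal_space \<Longrightarrow> acts x z \<in> normal_space"
  using keys_lin_ext[of "act x" z] act_terms by (fastforce simp: normal_space_def acts_def terms_ok_def)

lemma lie_act_bracket:
  assumes "z \<in> normal_space"
  shows "lie_act (bracket A B) z = lie_act A (lie_act B z) - lie_act B (lie_act A z)"
  by (rule lie_act_relation[symmetric]) (use assms in \<open>auto simp: normal_space_def acts_relation\<close>)

end

section \<open>The tensor algebra and its left ideals\<close>

lemma scale_eq_mult: "scale c (p :: 'a::monoid_add \<Rightarrow>\<^sub>0 complex) = Poly_Mapping.single 0 c * p"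
proof (rule linear_eq_on_basis[of scale "scale c" "(*) (Poly_Mapping.single 0 c)"])
  show "Vector_Spaces.linear scale scale (\<lambda>p :: 'a \<Rightarrow>\<^sub>0 complex. scale c p)"
    by (rule linear_scaleI) (simp_all add: pm.scale_right_distrib mult.commute)
  show "Vector_Spaces.linear scale scale ((*) (Poly_Mapping.single (0::'a) c))"
  proof (rule linear_scaleI)
    fix d and p :: "'a \<Rightarrow>\<^sub>0 complex"
    have "Poly_Mapping.single 0 c * scale d (\<Sum>k\<in>Poly_Mapping.keys p. scale (Poly_Mapping.lookup p k) (Poly_Mapping.single k 1))
      = scale d (Poly_Mapping.single 0 c * (\<Sum>k\<in>Poly_Mapping.keys p. scale (Poly_Mapping.lookup p k) (Poly_Mapping.single k 1)))"
      by (simp add: sum_distrib_left pm.scale_sum_right mult_single mult_ac)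
    then show "Poly_Mapping.single 0 c * scale d p = scale d (Poly_Mapping.single 0 c * p)"
      by (simp only: sum_scale_single[symmetric])
  qed (simp add: distrib_left)
qed (simp add: mult_single)

lemma scale_mult_left [simp]: "scale c p * q = scale c (p * q)" for p :: "'a::monoid_add \<Rightarrow>\<^sub>0 complex"
  by (simp add: scale_eq_mult mult.assoc)

lemma scale_mult_right [simp]: "p * scale c q = scale c (p * q)" for p :: "'a::monoid_add \<Rightarrow>\<^sub>0 complex"
proof -
  have "p * Poly_Mapping.single 0 c = scale c p"
    by (rule linear_eq_on_basis[of scale])
       (auto intro!: linear_scaleI simp: distrib_right pm.scale_right_distrib mult_single mult.commute)
  then show ?thesis by (simp add: scale_eq_mult flip: mult.assoc)
qed

lemma mult_linear_left: "Vector_Spaces.linear scale scale (\<lambda>p. p * q)" for q :: "'a::monoid_add \<Rightarrow>\<^sub>0 complex"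
  by (rule linear_scaleI) (simp_all add: distrib_right)

lemma mult_linear_right: "Vector_Spaces.linear scale scale ((*) p)" for p :: "'a::monoid_add \<Rightarrow>\<^sub>0 complex"
  by (rule linear_scaleI) (simp_all add: distrib_left)

abbreviation letter :: "gen \<Rightarrow> tensor_alg" where
  "letter x \<equiv> Poly_Mapping.single (Word [x]) 1"

lemma emb_linear: "Vector_Spaces.linear scale scale emb"
  unfolding emb_def by (rule lin_ext_linear[OF vs_scale])

lemmas emb_simps [simp] = linear_rules[OF emb_linear]

lemma emb_single: "emb (Poly_Mapping.single x c) = scale c (letter x)"
  by (simp add: emb_def)

lemma emb_bas: "emb (bas x) = letter x"
  by (simp add: bas_def emb_single)

lemma one_word: "(1 :: tensor_alg) = Poly_Mapping.single (Word []) 1"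
  by (simp add: zero_tensor_word_def flip: single_one)

lemma letter_mult_word: "letter x * Poly_Mapping.single (Word w) c = Poly_Mapping.single (Word (x # w)) c"
  by (simp add: mult_single plus_tensor_word_def)

text \<open>Modules generated by one vector are quotients of the tensor algebra, and their submodules correspond
  to the left ideals that contain the kernel.\<close>

definition left_ideal_T :: "tensor_alg set \<Rightarrow> bool" where
  "left_ideal_T L \<longleftrightarrow> pm.subspace L \<and> (\<forall>p. \<forall>q\<in>L. p * q \<in> L)"

text \<open>The letters generate the tensor algebra, so it suffices to multiply by letters.\<close>

lemma left_ideal_TI:
  assumes "pm.subspace L" "\<And>x q. q \<in> L \<Longrightarrow> letter x * q \<in> L"
  shows "left_ideal_T L"
  unfolding left_ideal_T_def
proof (intro conjI allI ballI assms(1))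
  fix p q assume q: "q \<in> L"
  have word: "Poly_Mapping.single (Word w) 1 * q \<in> L" for w
  proof (induction w)
    case Nil
    then show ?case using q by (simp flip: one_word)
  next
    case (Cons x w)
    then show ?case using assms(2)[OF Cons] by (simp add: letter_mult_word flip: mult.assoc)
  qed
  show "p * q \<in> L"
    by (rule linear_in_subspace[OF mult_linear_left assms(1)]) (metis word tensor_word.collapse)
qed

lemma left_ideal_T_UNIV: "left_ideal_T L \<Longrightarrow> 1 \<in> L \<Longrightarrow> L = UNIV"
  unfolding left_ideal_T_def by (metis UNIV_eq_I mult.right_neutral)


section \<open>The universal enveloping algebra\<close>

lemma ring_of_type_algebra_ring: "ring (ring_of_type_algebra :: 'a::ring_1 ring)"
proof -
  have "\<exists>y. y + x = 0 \<and> x + y = 0" for x :: 'a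
    by (rule exI[of _ "- x"]) simp
  then show ?thesis
    unfolding ring_of_type_algebra_def
    by unfold_locales (auto simp: algebra_simps Units_def)
qed

abbreviation TR :: "tensor_alg ring" where "TR \<equiv> ring_of_type_algebra"

lemma TR_simps [simp]:
  "carrier (ring_of_type_algebra :: 'a::ring_1 ring) = UNIV"
  "x \<otimes>\<^bsub>ring_of_type_algebra\<^esub> y = x * (y::'a)" "x \<oplus>\<^bsub>ring_of_type_algebra\<^esub> y = x + (y::'a)"
  "\<zero>\<^bsub>ring_of_type_algebra\<^esub> = (0::'a)" "\<one>\<^bsub>ring_of_type_algebra\<^esub> = (1::'a)"
  by (simp_all add: ring_of_type_algebra_def)

lemma TR_minus [simp]: "\<ominus>\<^bsub>ring_of_type_algebra\<^esub> x = - (x :: 'a::ring_1)"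
proof -
  interpret ring "ring_of_type_algebra :: 'a ring" by (rule ring_of_type_algebra_ring)
  show ?thesis using minus_equality[of "- x" x] by simp
qed

definition commutator_relation :: "affvir \<Rightarrow> affvir \<Rightarrow> tensor_alg" where
  "commutator_relation x y = emb x * emb y - emb y * emb x - emb (bracket x y)"

lemma U_ideal_ideal: "ideal U_ideal TR"
  unfolding U_ideal_def by (rule ring.genideal_ideal[OF ring_of_type_algebra_ring]) simp

lemma commutator_relation_in_U_ideal: "commutator_relation x y \<in> U_ideal"
  unfolding U_ideal_def commutator_relation_def
  using ring.genideal_self[OF ring_of_type_algebra_ring, of "{emb x * emb y - emb y * emb x - emb (bracket x y) |x y. True}"]
  by auto

lemma U_ideal_least:
  assumes "ideal J TR" "\<And>x y. commutator_relation x y \<in> J"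
  shows "U_ideal \<subseteq> J"
  unfolding U_ideal_def
  by (rule ring.genideal_minimal[OF ring_of_type_algebra_ring assms(1)])
     (use assms(2) in \<open>auto simp: commutator_relation_def\<close>)

lemma U_ideal_add: "p \<in> U_ideal \<Longrightarrow> q \<in> U_ideal \<Longrightarrow> p + q \<in> U_ideal"
  using additive_subgroup.a_closed[OF ideal.axioms(1)[OF U_ideal_ideal], of p q] by simp

lemma U_ideal_mult: "p \<in> U_ideal \<Longrightarrow> q * p \<in> U_ideal" "p \<in> U_ideal \<Longrightarrow> p * q \<in> U_ideal"
  using ideal.I_l_closed[OF U_ideal_ideal, of p q] ideal.I_r_closed[OF U_ideal_ideal, of p q] by simp_all

lemma U_ideal_zero: "0 \<in> U_ideal"
  using additive_subgroup.zero_closed[OF ideal.axioms(1)[OF U_ideal_ideal]] by simp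

lemma U_ideal_subspace: "pm.subspace U_ideal"
  using U_ideal_add U_ideal_zero U_ideal_mult(1) by (simp add: pm.subspace_def scale_eq_mult)

lemma U_alg_ring: "ring U_alg"
  unfolding U_alg_def by (rule ideal.quotient_is_ring[OF U_ideal_ideal])

lemma U_class_hom: "U_class \<in> ring_hom TR U_alg"
  using ideal.rcos_ring_hom[OF U_ideal_ideal] unfolding U_alg_def U_class_def[abs_def] .

lemma U_class_simps:
  "U_class (p + q) = U_class p \<oplus>\<^bsub>U_alg\<^esub> U_class q"
  "U_class (p * q) = U_class p \<otimes>\<^bsub>U_alg\<^esub> U_class q"
  "U_class 1 = \<one>\<^bsub>U_alg\<^esub>" "U_class p \<in> carrier U_alg"
  using ring_hom_add[OF U_class_hom, of p q] ring_hom_mult[OF U_class_hom, of p q]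
    ring_hom_one[OF U_class_hom] ring_hom_closed[OF U_class_hom, of p] by simp_all

lemma U_class_zero: "U_class 0 = \<zero>\<^bsub>U_alg\<^esub>"
  using ring_hom_zero[OF U_class_hom ring_of_type_algebra_ring U_alg_ring] by simp

lemma U_carrier: "carrier U_alg = range U_class"
  by (auto simp: U_alg_def FactRing_def A_RCOSETS_def' U_class_def)

lemma U_class_eq_iff: "U_class p = U_class q \<longleftrightarrow> p - q \<in> U_ideal"
proof -
  interpret ideal U_ideal TR by (rule U_ideal_ideal)
  show ?thesis
    unfolding U_class_def using quotient_eq_iff_same_a_r_cos[OF U_ideal_ideal, of p q]
    by (simp add: a_minus_def)
qed

text \<open>Left ideals of the enveloping algebra correspond to left ideals of the tensor algebra that contain
  \<open>U_ideal\<close>; the next two lemmas allow the generation of the Verma ideal to be studied in the tensor algebra.\<close>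

lemma left_ideal_U_preimage:
  assumes "left_ideal I U_alg"
  shows "left_ideal_T {p. U_class p \<in> I}"
proof -
  interpret left_ideal I U_alg by fact
  have "U_class (p * q) \<in> I" if "U_class q \<in> I" for p q
    using l_closed[OF that] by (simp add: U_class_simps)
  moreover have "U_class (p + q) \<in> I" if "U_class p \<in> I" "U_class q \<in> I" for p q
    using a_closed[OF that] by (simp add: U_class_simps)
  moreover have "U_class 0 \<in> I" using zero_closed by (simp add: U_class_zero)
  ultimately show ?thesis by (simp add: left_ideal_T_def pm.subspace_def scale_eq_mult)
qed

lemma left_ideal_U_image:
  assumes "left_ideal_T L"
  shows "left_ideal (U_class ` L) U_alg"
proof -
  interpret U: ring U_alg by (rule U_alg_ring)
  have L: "p * q \<in> L" "p + q' \<in> L" "0 \<in> L" if "q \<in> L" "p \<in> L" "q' \<in> L" for p q q'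
    using assms that by (auto simp: left_ideal_T_def pm.subspace_def)
  have L': "p * q \<in> L" if "q \<in> L" for p q using assms that by (auto simp: left_ideal_T_def)
  have zero: "0 \<in> L" using assms by (simp add: left_ideal_T_def pm.subspace_def)
  have add: "p + q \<in> L" if "p \<in> L" "q \<in> L" for p q using assms that by (simp add: left_ideal_T_def pm.subspace_def)
  have inv: "\<ominus>\<^bsub>U_alg\<^esub> U_class p \<in> U_class ` L" if "p \<in> L" for p
  proof -
    have "- p \<in> L" using L'[OF that, of "-1"] by simp
    moreover have "\<ominus>\<^bsub>U_alg\<^esub> U_class p = U_class (- p)"
      by (rule U.minus_equality) (simp_all add: U_class_simps U_class_zero flip: U_class_simps(1))
    ultimately show ?thesis by simp
  qed
  show ?thesis
  proof (intro left_ideal.intro additive_subgroup.intro left_ideal_axioms.intro U.add.subgroupI)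
    fix a x assume "a \<in> U_class ` L" "x \<in> carrier U_alg"
    then show "x \<otimes>\<^bsub>U_alg\<^esub> a \<in> U_class ` L"
      by (auto simp: U_carrier L' simp flip: U_class_simps)
  qed (use zero inv add in \<open>auto simp: U_class_simps(4) simp flip: U_class_simps(1)\<close>)
qed

lemma left_ideal_Inter:
  assumes "\<And>I. I \<in> \<I> \<Longrightarrow> left_ideal I U_alg" "\<I> \<noteq> {}"
  shows "left_ideal (\<Inter>\<I>) U_alg"
proof -
  interpret U: ring U_alg by (rule U_alg_ring)
  show ?thesis
  proof (intro left_ideal.intro additive_subgroup.intro left_ideal_axioms.intro U.add.subgroups_Inter)
    show "subgroup I (add_monoid U_alg)" if "I \<in> \<I>" for I
      using assms(1)[OF that] by (simp add: left_ideal_def additive_subgroup_def)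
    show "\<I> \<noteq> {}" by fact
    show "x \<otimes>\<^bsub>U_alg\<^esub> a \<in> \<Inter>\<I>" if "a \<in> \<Inter>\<I>" "x \<in> carrier U_alg" for a x
    proof (rule InterI)
      fix I assume I: "I \<in> \<I>"
      then have "a \<in> I" using that(1) by simp
      then show "x \<otimes>\<^bsub>U_alg\<^esub> a \<in> I" by (rule left_ideal.l_closed[OF assms(1)[OF I] _ that(2)])
    qed
  qed
qed


section \<open>The left ideal defining the Verma module\<close>

context highest_weight
begin

definition verma_gens :: "tensor_alg set" where
  "verma_gens = {emb (bas (E 0))}
      \<union> (\<Union>i\<in>{0<..}. {emb (bas (E i)), emb (bas (F i)), emb (bas (H i)), emb (bas (D i))})
      \<union> {emb (bas (D 0)) - scale \<eta> 1, emb (bas (H 0)) - scale \<epsilon> 1, emb (bas Cen) - scale \<theta> 1}"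

definition verma_left :: "tensor_alg set" where
  "verma_left = {p. U_class p \<in> verma_ideal \<eta> \<epsilon> \<theta>}"

lemma verma_ideal_left_ideal: "left_ideal (verma_ideal \<eta> \<epsilon> \<theta>) U_alg"
proof -
  have "left_ideal (carrier U_alg) U_alg"
  proof -
    have "left_ideal_T UNIV" by (simp add: left_ideal_T_def)
    from left_ideal_U_image[OF this] show ?thesis by (simp add: U_carrier)
  qed
  moreover have "U_class ` verma_gens \<subseteq> carrier U_alg" by (auto simp: U_carrier)
  ultimately show ?thesis
    unfolding verma_ideal_def verma_gens_def[symmetric] hull_def by (intro left_ideal_Inter) auto
qed

lemma verma_left_ideal: "left_ideal_T verma_left"
  unfolding verma_left_def by (rule left_ideal_U_preimage[OF verma_ideal_left_ideal])

lemma verma_gens_in_verma_left: "verma_gens \<subseteq> verma_left"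
  unfolding verma_left_def verma_ideal_def verma_gens_def[symmetric]
  using hull_subset[of "U_class ` verma_gens" "\<lambda>I. left_ideal I U_alg"] by auto

lemma U_ideal_in_verma_left: "U_ideal \<subseteq> verma_left"
proof
  fix p assume "p \<in> U_ideal"
  then have "U_class p = U_class 0" by (simp add: U_class_eq_iff)
  moreover have "0 \<in> verma_left" using verma_left_ideal by (simp add: left_ideal_T_def pm.subspace_def)
  ultimately show "p \<in> verma_left" by (simp add: verma_left_def)
qed

primrec word_act :: "gen list \<Rightarrow> (gen list \<Rightarrow>\<^sub>0 complex) \<Rightarrow> gen list \<Rightarrow>\<^sub>0 complex" where
  "word_act [] z = z"
| "word_act (x # w) z = acts x (word_act w z)"

definition tensor_act :: "tensor_alg \<Rightarrow> (gen list \<Rightarrow>\<^sub>0 complex) \<Rightarrow> gen list \<Rightarrow>\<^sub>0 complex" where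
  "tensor_act p z = lin_ext scale (\<lambda>w. word_act (letters w) z) p"

lemma word_act_append: "word_act (v @ w) z = word_act v (word_act w z)"
  by (induction v) auto

lemma word_act_linear: "Vector_Spaces.linear scale scale (word_act w)"
  by (rule linear_scaleI; induction w) simp_all

lemma tensor_act_linear: "Vector_Spaces.linear scale scale (\<lambda>p. tensor_act p z)"
  unfolding tensor_act_def by (rule lin_ext_linear[OF vs_scale])

lemma tensor_act_linear2: "Vector_Spaces.linear scale scale (tensor_act p)"
  unfolding tensor_act_def
  by (rule linear_scaleI) (simp_all add: linear_rules[OF word_act_linear] lin_ext_fun)

lemmas tensor_act_simps [simp] = linear_rules[OF tensor_act_linear] linear_rules[OF tensor_act_linear2]

lemma tensor_act_single [simp]: "tensor_act (Poly_Mapping.single w c) z = scale c (word_act (letters w) z)"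
  by (simp add: tensor_act_def)

lemma tensor_act_mult: "tensor_act (p * q) z = tensor_act p (tensor_act q z)"
proof -
  have 1: "tensor_act (Poly_Mapping.single v 1 * q) z = word_act (letters v) (tensor_act q z)" for v
    by (rule linear_eq_on_basis[of scale "\<lambda>q. tensor_act (Poly_Mapping.single v 1 * q) z"])
       (auto intro!: linear_scaleI simp: distrib_left linear_rules[OF word_act_linear] mult_single
          plus_tensor_word_def word_act_append)
  show ?thesis
    by (rule linear_eq_on_basis[of scale "\<lambda>p. tensor_act (p * q) z"])
       (auto intro!: linear_scaleI simp: distrib_right 1)
qed

lemma tensor_act_emb: "tensor_act (emb x) z = lie_act x z"
  by (rule linear_eq_on_basis[of scale "\<lambda>x. tensor_act (emb x) z"])
     (auto intro!: linear_scaleI simp: emb_single)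

lemma normal_space_subspace: "pm.subspace normal_space"
  by (auto simp: pm.subspace_def normal_space_def in_keys_iff lookup_add subset_iff) (metis add.right_neutral)

lemma tensor_act_normal_space: "z \<in> normal_space \<Longrightarrow> tensor_act p z \<in> normal_space"
proof (rule linear_in_subspace[OF tensor_act_linear normal_space_subspace])
  fix w assume z: "z \<in> normal_space"
  have "word_act v z \<in> normal_space" for v
    by (induction v) (simp_all add: z acts_normal_space)
  then show "tensor_act (Poly_Mapping.single w 1) z \<in> normal_space" by simp
qed

text \<open>The elements of the tensor algebra that annihilate all sorted words form a two-sided ideal, which
  contains the commutator relations because the action respects brackets.\<close>

lemma U_ideal_acts_trivially:
  assumes "p \<in> U_ideal" "z \<in> normal_space"
  shows "tensor_act p z = 0"
proof -
  let ?J = "{p. \<forall>z\<in>normal_space. tensor_act p z = 0}"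
  have "U_ideal \<subseteq> ?J"
  proof (rule U_ideal_least)
    interpret ring TR by (rule ring_of_type_algebra_ring)
    show "ideal ?J TR"
    proof (intro idealI ring_of_type_algebra_ring add.subgroupI)
    qed (auto simp: tensor_act_mult tensor_act_normal_space intro: exI[of _ 0])
    show "commutator_relation x y \<in> ?J" for x y
      by (simp add: commutator_relation_def tensor_act_mult tensor_act_emb lie_act_bracket)
  qed
  then show ?thesis using assms by auto
qed

text \<open>The annihilator of the empty word in the tensor algebra contains the generators of the Verma ideal
  but not \<open>1\<close>. Thus the Verma module is nonzero.\<close>

lemma one_notin_verma_left: "1 \<notin> verma_left"
proof
  assume "1 \<in> verma_left"
  define L where "L = {p. tensor_act p (basis_vec []) = 0}"
  have basis_vec: "basis_vec [] \<in> normal_space" by (simp add: normal_space_def)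
  have L: "left_ideal_T L"
    by (auto simp: L_def left_ideal_T_def pm.subspace_def tensor_act_mult)
  have "verma_gens \<subseteq> L"
    by (auto simp: verma_gens_def L_def emb_bas one_word act_Nil)
  then have "verma_ideal \<eta> \<epsilon> \<theta> \<subseteq> U_class ` L"
    unfolding verma_ideal_def verma_gens_def[symmetric]
    by (intro hull_minimal left_ideal_U_image L) auto
  then obtain p where p: "p \<in> L" "U_class 1 = U_class p"
    using \<open>1 \<in> verma_left\<close> by (auto simp: verma_left_def)
  then have "tensor_act (1 - p) (basis_vec []) = 0"
    using U_ideal_acts_trivially[OF _ basis_vec] p(2) by (simp only: U_class_eq_iff)
  moreover have "basis_vec [] \<noteq> 0"
    by (metis lookup_single_eq lookup_zero one_neq_zero)
  ultimately show False using p(1) by (simp add: L_def one_word)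
qed

end

context highest_weight
begin

section \<open>The maximal left ideal\<close>

abbreviation word :: "gen list \<Rightarrow> tensor_alg" where
  "word w \<equiv> Poly_Mapping.single (Word w) 1"

lemma verma_left_subspace: "pm.subspace verma_left"
  using verma_left_ideal by (simp add: left_ideal_T_def)

lemma verma_left_mult: "p \<in> verma_left \<Longrightarrow> q * p \<in> verma_left"
  using verma_left_ideal by (simp add: left_ideal_T_def)

lemma emb_swap:
  "emb x * (emb y * p) - (emb y * (emb x * p) + emb (bracket x y) * p) \<in> verma_left"
proof -
  have "commutator_relation x y * p \<in> U_ideal"
    by (rule U_ideal_mult(2)[OF commutator_relation_in_U_ideal])
  moreover have "commutator_relation x y * p = emb x * (emb y * p) - (emb y * (emb x * p) + emb (bracket x y) * p)"
    by (simp add: commutator_relation_def algebra_simps)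
  ultimately show ?thesis using U_ideal_in_verma_left by auto
qed

lemma letter_swap:
  assumes "pm.subspace V" "verma_left \<subseteq> V"
  shows "letter x * (letter y * p) \<in> V \<longleftrightarrow> letter y * (letter x * p) + emb (gen_bracket x y) * p \<in> V"
  by (rule in_subspace_cong[OF assms(1)])
     (use emb_swap[of "bas x" "bas y" p] assms(2) in \<open>auto simp: emb_bas bas_def emb_single\<close>)

lemma non_lowering_wt:
  assumes "\<not> lowering x"
  shows "letter x - scale (wt x) 1 \<in> verma_left"
  using assms verma_gens_in_verma_left
  by (cases x) (auto simp: verma_gens_def emb_bas not_less le_less subset_iff)

definition lowering_words :: "tensor_alg set" where
  "lowering_words = {word w | w. w \<noteq> [] \<and> (\<forall>x\<in>set w. lowering x)}"

text \<open>The preimage of the sum of all weight spaces of the Verma module other than the highest one.\<close>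

definition hyperplane :: "tensor_alg set" where
  "hyperplane = pm.span (lowering_words \<union> verma_left)"

text \<open>A generator that is not lowering can be commuted to the right through a lowering word, where it acts
  on \<open>1\<close> by a scalar; the commutators are taken care of by induction on the length of the word.\<close>

lemma span_lowering_words: "pm.span (insert 1 (lowering_words \<union> verma_left)) = UNIV"
proof -
  let ?S = "pm.span (insert 1 (lowering_words \<union> verma_left))"
  have base: "verma_left \<subseteq> ?S" "1 \<in> ?S" by (auto intro: pm.span_base)
  have lw: "word w \<in> ?S" if "\<forall>x\<in>set w. lowering x" for w
    using that by (cases "w = []") (auto intro!: pm.span_base simp: lowering_words_def one_word)
  have low: "letter y * p \<in> ?S" if "lowering y" "p \<in> ?S" for y p
  proof (rule pm.span_induct[OF that(2)])
    show "pm.subspace {p. letter y * p \<in> ?S}"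
      by (auto simp: pm.subspace_def distrib_left pm.span_add pm.span_scale pm.span_zero)
    fix q assume "q \<in> insert 1 (lowering_words \<union> verma_left)"
    then consider w where "q = word w" "\<forall>x\<in>set w. lowering x" | "q \<in> verma_left"
      by (auto simp: lowering_words_def one_word)
    then show "letter y * q \<in> ?S"
    proof cases
      case 1
      have "word (y # w) \<in> ?S" by (rule lw) (use 1 that(1) in simp)
      then show ?thesis by (simp only: 1 letter_mult_word)
    next
      case 2
      then show ?thesis by (intro subsetD[OF base(1)] verma_left_mult)
    qed
  qed
  have step: "letter x * word w \<in> ?S" if "\<forall>x\<in>set w. lowering x" for x w
    using that
  proof (induction w arbitrary: x)
    case Nil
    show ?case
    proof (cases "lowering x")
      case True
      have "word [x] \<in> ?S" by (rule lw) (simp add: True)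
      then show ?thesis by (simp only: letter_mult_word)
    next
      case False
      have "letter x - scale (wt x) 1 \<in> ?S"
        by (rule subsetD[OF base(1) non_lowering_wt[OF False]])
      from in_subspace_cong[OF pm.subspace_span this]
      have "letter x \<in> ?S" by (simp only: pm.span_scale[OF base(2)])
      then show ?thesis by (simp only: letter_mult_word)
    qed
  next
    case (Cons y w)
    show ?case
    proof (cases "lowering x")
      case True
      have "word (x # y # w) \<in> ?S" by (rule lw) (use True Cons.prems in simp)
      then show ?thesis by (simp only: letter_mult_word)
    next
      case False
      have "letter y * (letter x * word w) \<in> ?S"
        by (rule low) (use Cons in auto)
      moreover have "emb (gen_bracket x y) * word w \<in> ?S"
      proof (rule linear_in_subspace[of "\<lambda>b. emb b * word w"])
        show "Vector_Spaces.linear scale scale (\<lambda>b. emb b * word w)"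
          by (rule linear_scaleI) (simp_all add: distrib_right)
        show "emb (Poly_Mapping.single k 1) * word w \<in> ?S" for k
          using Cons by (simp add: emb_single)
      qed (rule pm.subspace_span)
      ultimately have "letter x * (letter y * word w) \<in> ?S"
        by (simp only: letter_swap[OF pm.subspace_span base(1)] pm.span_add)
      then show ?thesis by (simp only: letter_mult_word)
    qed
  qed
  have "left_ideal_T ?S"
  proof (rule left_ideal_TI[OF pm.subspace_span])
    fix x q assume q: "q \<in> ?S"
    show "letter x * q \<in> ?S"
    proof (rule pm.span_induct[OF q])
      show "pm.subspace {q. letter x * q \<in> ?S}"
        by (auto simp: pm.subspace_def distrib_left pm.span_add pm.span_scale pm.span_zero)
      fix q assume "q \<in> insert 1 (lowering_words \<union> verma_left)"
      then consider w where "q = word w" "\<forall>x\<in>set w. lowering x" | "q \<in> verma_left"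
        by (auto simp: lowering_words_def one_word)
      then show "letter x * q \<in> ?S"
      proof cases
        case 1
        then show ?thesis using step by simp
      next
        case 2
        then show ?thesis by (intro subsetD[OF base(1)] verma_left_mult)
      qed
    qed
  qed
  then show ?thesis using left_ideal_T_UNIV base(2) by blast
qed

lemma hyperplane_subspace: "pm.subspace hyperplane"
  unfolding hyperplane_def by (rule pm.subspace_span)

lemma hyperplane_decomp: "\<exists>c. p - scale c 1 \<in> hyperplane"
  using span_lowering_words pm.span_breakdown_eq[of p 1 "lowering_words \<union> verma_left"]
  by (simp add: hyperplane_def)

text \<open>The eigenvalues of \<open>D 0 + \<i> H 0\<close> in the adjoint representation. The imaginary unit keeps the degrees
  for \<open>D 0\<close> and for \<open>H 0\<close> apart, so that a single element separates the weights of interest.\<close>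

fun gen_degree :: "gen \<Rightarrow> complex" where
  "gen_degree (E i) = of_int i + 2 * \<i>"
| "gen_degree (F i) = of_int i - 2 * \<i>"
| "gen_degree (H i) = of_int i"
| "gen_degree (D i) = of_int i"
| "gen_degree Cen = 0"

definition grading :: affvir where
  "grading = bas (D 0) + scale \<i> (bas (H 0))"

definition top_weight :: complex where
  "top_weight = \<eta> + \<i> * \<epsilon>"

definition word_degree :: "gen list \<Rightarrow> complex" where
  "word_degree w = sum_list (map gen_degree w)"

lemma bracket_grading: "bracket grading (bas x) = scale (gen_degree x) (bas x)"
  by (cases x) (simp_all add: grading_def bas_def delta0_def mult.commute flip: single_add)

lemma word_weight: "emb grading * word w - scale (top_weight + word_degree w) (word w) \<in> verma_left"
proof (induction w)
  case Nil
  have "letter (D 0) - scale \<eta> 1 \<in> verma_left" "letter (H 0) - scale \<epsilon> 1 \<in> verma_left"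
    using non_lowering_wt[of "D 0"] non_lowering_wt[of "H 0"] by simp_all
  then have "(letter (D 0) - scale \<eta> 1) + scale \<i> (letter (H 0) - scale \<epsilon> 1) \<in> verma_left"
    by (intro pm.subspace_add pm.subspace_scale verma_left_subspace)
  then show ?case
    by (simp add: grading_def emb_bas top_weight_def word_degree_def pm.scale_right_diff_distrib
        pm.scale_left_distrib algebra_simps flip: one_word)
next
  case (Cons x w)
  let ?m = "top_weight + word_degree w"
  have "letter x * (emb grading * word w - scale ?m (word w)) \<in> verma_left"
    by (rule verma_left_mult[OF Cons])
  from pm.subspace_add[OF verma_left_subspace emb_swap[of grading "bas x" "word w"] this]
  have "emb grading * (letter x * word w) - (scale (gen_degree x) (letter x * word w) + scale ?m (letter x * word w))
      \<in> verma_left"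
    by (simp add: bracket_grading emb_bas right_diff_distrib algebra_simps del: scale_single)
  then show ?case
    by (simp only: letter_mult_word word_degree_def list.map sum_list.Cons
        flip: pm.scale_left_distrib) (simp only: add.left_commute)
qed

lemma lowering_degree:
  assumes "lowering x"
  shows "Re (gen_degree x) \<le> 0" "Re (gen_degree x) = 0 \<Longrightarrow> Im (gen_degree x) = -2"
  using assms by (cases x; simp)+

text \<open>The real part counts the total index, which is negative unless all letters are \<open>F 0\<close>; in that case
  the imaginary part is nonzero.\<close>

lemma lowering_word_degree:
  assumes "w \<noteq> []" "\<forall>x\<in>set w. lowering x"
  shows "word_degree w \<noteq> 0"
proof -
  have "Re (word_degree w) \<le> 0 \<and> (Re (word_degree w) = 0 \<longrightarrow> Im (word_degree w) = - 2 * real (length w))"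
    using assms(2)
  proof (induction w)
    case (Cons x w)
    then have "Re (gen_degree x) \<le> 0" "Re (gen_degree x) = 0 \<longrightarrow> Im (gen_degree x) = -2"
      using lowering_degree by auto
    with Cons show ?case by (auto simp: word_degree_def algebra_simps)
  qed (simp add: word_degree_def)
  then show ?thesis using assms(1) by auto
qed

text \<open>A polynomial in the grading element that annihilates the weight vectors whose weights are listed.\<close>

primrec weight_annihilator :: "complex list \<Rightarrow> tensor_alg" where
  "weight_annihilator [] = 1"
| "weight_annihilator (a # as) = (emb grading - scale a 1) * weight_annihilator as"

lemma weight_annihilator_commute1:
  "(emb grading - scale a 1) * weight_annihilator as = weight_annihilator as * (emb grading - scale a 1)"
proof (induction as)
  case (Cons b as)
  have "(emb grading - scale a 1) * (emb grading - scale b 1) = (emb grading - scale b 1) * (emb grading - scale a 1)"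
    by (simp add: algebra_simps)
  then have "(emb grading - scale a 1) * weight_annihilator (b # as)
      = (emb grading - scale b 1) * ((emb grading - scale a 1) * weight_annihilator as)"
    by (simp only: weight_annihilator.simps flip: mult.assoc)
  then show ?case by (simp only: Cons weight_annihilator.simps mult.assoc)
qed simp

lemma weight_annihilator_append: "weight_annihilator (as @ bs) = weight_annihilator as * weight_annihilator bs"
  by (induction as) (simp_all add: mult.assoc)

lemma weight_annihilator_commute: "weight_annihilator as * weight_annihilator bs = weight_annihilator bs * weight_annihilator as"
proof (induction as)
  case (Cons a as)
  have "weight_annihilator (a # as) * weight_annihilator bs
      = (emb grading - scale a 1) * weight_annihilator bs * weight_annihilator as"
    by (simp only: weight_annihilator.simps mult.assoc Cons)
  then show ?case by (simp only: weight_annihilator_commute1 weight_annihilator.simps mult.assoc)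
qed simp

text \<open>The hyperplane is spanned, modulo the Verma ideal, by weight vectors of weight different from the
  highest one, and the annihilators of the summands of a vector commute.\<close>

lemma weight_annihilator_hyperplane:
  assumes "k \<in> hyperplane"
  shows "\<exists>as. top_weight \<notin> set as \<and> weight_annihilator as * k \<in> verma_left"
  using assms unfolding hyperplane_def
proof (induction rule: pm.span_induct_alt)
  case base
  show ?case by (rule exI[of _ "[]"]) (simp add: pm.subspace_0[OF verma_left_subspace])
next
  case (step c x y)
  obtain bs where bs: "top_weight \<notin> set bs" "weight_annihilator bs * y \<in> verma_left" using step by blast
  obtain as where as: "top_weight \<notin> set as" "weight_annihilator as * x \<in> verma_left"
  proof (cases "x \<in> verma_left")
    case True
    then show ?thesis using that[of "[]"] by simp
  next
    case False
    then obtain w where w: "x = word w" "w \<noteq> []" "\<forall>x\<in>set w. lowering x" using step by (auto simp: lowering_words_def)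
    show ?thesis
    proof (rule that[of "[top_weight + word_degree w]"])
      show "top_weight \<notin> set [top_weight + word_degree w]" using lowering_word_degree w by simp
      show "weight_annihilator [top_weight + word_degree w] * x \<in> verma_left"
        using word_weight[of w] by (simp add: w left_diff_distrib)
    qed
  qed
  have "scale c (weight_annihilator bs * (weight_annihilator as * x)) + weight_annihilator as * (weight_annihilator bs * y) \<in> verma_left"
    by (intro pm.subspace_add pm.subspace_scale verma_left_subspace verma_left_mult[OF as(2)] verma_left_mult[OF bs(2)])
  also have "scale c (weight_annihilator bs * (weight_annihilator as * x)) + weight_annihilator as * (weight_annihilator bs * y)
     = weight_annihilator (as @ bs) * (scale c x + y)"
    using weight_annihilator_commute[of as bs]
    by (simp add: weight_annihilator_append distrib_left flip: mult.assoc)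
  finally show ?case using as bs by (intro exI[of _ "as @ bs"]) simp
qed

lemma weight_annihilator_one:
  "weight_annihilator as - scale (prod_list (map (\<lambda>a. top_weight - a) as)) 1 \<in> verma_left"
proof (induction as)
  case Nil
  then show ?case by (simp add: pm.subspace_0[OF verma_left_subspace])
next
  case (Cons a as)
  let ?c = "prod_list (map (\<lambda>a. top_weight - a) as)"
  have "emb grading - scale top_weight 1 \<in> verma_left"
    using word_weight[of "[]"] by (simp add: word_degree_def flip: one_word)
  then have "(emb grading - scale a 1) * (weight_annihilator as - scale ?c 1) + scale ?c (emb grading - scale top_weight 1) \<in> verma_left"
    by (intro pm.subspace_add pm.subspace_scale verma_left_subspace verma_left_mult Cons)
  then show ?case
    by (simp add: algebra_simps pm.scale_right_diff_distrib pm.scale_left_diff_distrib)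
qed

text \<open>Write \<open>p = c \<cdot> 1 + k\<close> with \<open>c \<noteq> 0\<close> and \<open>k\<close> in the hyperplane. An annihilator of \<open>k\<close> multiplies \<open>1\<close>
  by a nonzero scalar modulo the Verma ideal, so it maps \<open>p\<close> to a nonzero multiple of \<open>1\<close>, up to an element of that ideal.\<close>

lemma proper_left_ideal_hyperplane:
  assumes "left_ideal_T L" "verma_left \<subseteq> L" "p \<in> L" "p \<notin> hyperplane"
  shows "1 \<in> L"
proof -
  have L: "pm.subspace L" "\<And>p q. q \<in> L \<Longrightarrow> p * q \<in> L" using assms(1) by (auto simp: left_ideal_T_def)
  obtain c where c: "p - scale c 1 \<in> hyperplane" using hyperplane_decomp by blast
  with assms(4) have "c \<noteq> 0" by auto
  obtain as where as: "top_weight \<notin> set as" "weight_annihilator as * (p - scale c 1) \<in> verma_left"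
    using weight_annihilator_hyperplane[OF c] by blast
  let ?r = "prod_list (map (\<lambda>a. top_weight - a) as)"
  have r: "?r \<noteq> 0" using as(1) by (auto simp: prod_list_zero_iff)
  have "weight_annihilator as * p - weight_annihilator as * (p - scale c 1) \<in> L"
    using as assms L by (intro pm.subspace_diff) auto
  then have "scale c (weight_annihilator as) \<in> L" by (simp add: algebra_simps)
  moreover have "scale c (weight_annihilator as - scale ?r 1) \<in> L"
    using weight_annihilator_one assms L by (intro pm.subspace_scale) auto
  ultimately have "scale c (weight_annihilator as) - scale c (weight_annihilator as - scale ?r 1) \<in> L"
    by (intro pm.subspace_diff L)
  then have "scale (c * ?r) 1 \<in> L" by (simp add: pm.scale_right_diff_distrib)
  then have "scale (inverse (c * ?r)) (scale (c * ?r) 1) \<in> L"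
    by (rule pm.subspace_scale[OF L(1)])
  moreover have cr: "c * ?r \<noteq> 0" using r \<open>c \<noteq> 0\<close> by simp
  ultimately show ?thesis by (simp only: pm.scale_scale left_inverse[OF cr] pm.scale_one)
qed

lemma one_notin_hyperplane: "1 \<notin> hyperplane"
proof
  assume "1 \<in> hyperplane"
  then obtain as where as: "top_weight \<notin> set as" "weight_annihilator as \<in> verma_left"
    using weight_annihilator_hyperplane by (metis mult.right_neutral)
  let ?r = "prod_list (map (\<lambda>a. top_weight - a) as)"
  have "?r \<noteq> 0" using as(1) by (auto simp: prod_list_zero_iff)
  have "weight_annihilator as - (weight_annihilator as - scale ?r 1) \<in> verma_left"
    by (intro pm.subspace_diff verma_left_subspace as weight_annihilator_one)
  then have "scale ?r 1 \<in> verma_left" by simp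
  then have "scale (inverse ?r) (scale ?r 1) \<in> verma_left"
    by (rule pm.subspace_scale[OF verma_left_subspace])
  then show False using \<open>?r \<noteq> 0\<close> one_notin_verma_left by simp
qed

text \<open>The largest left ideal inside the hyperplane. It is the preimage of the maximal proper submodule of
  the Verma module.\<close>

definition max_left :: "tensor_alg set" where
  "max_left = {p. \<forall>q. q * p \<in> hyperplane}"

lemma max_left_ideal: "left_ideal_T max_left"
  using hyperplane_subspace
  by (auto simp: left_ideal_T_def max_left_def pm.subspace_def distrib_left simp flip: mult.assoc)

lemma max_left_hyperplane: "max_left \<subseteq> hyperplane"
proof
  fix p assume "p \<in> max_left"
  then have "1 * p \<in> hyperplane" unfolding max_left_def by blast
  then show "p \<in> hyperplane" by simp
qed

lemma verma_left_max_left: "verma_left \<subseteq> max_left"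
  using verma_left_mult by (auto simp: max_left_def hyperplane_def intro!: pm.span_base)

lemma one_notin_max_left: "1 \<notin> max_left"
  using max_left_hyperplane one_notin_hyperplane by blast

lemma max_left_greatest:
  assumes "left_ideal_T L" "verma_left \<subseteq> L" "L \<noteq> UNIV"
  shows "L \<subseteq> max_left"
proof
  fix p assume "p \<in> L"
  then have "q * p \<in> L" for q using assms(1) by (simp add: left_ideal_T_def)
  moreover have "1 \<notin> L" using assms left_ideal_T_UNIV by blast
  ultimately show "p \<in> max_left"
    unfolding max_left_def using proper_left_ideal_hyperplane[OF assms(1,2)] by blast
qed

text \<open>The projection onto the highest weight line along the hyperplane.\<close>

definition hw_coeff :: "tensor_alg \<Rightarrow> complex" where
  "hw_coeff p = (THE c. p - scale c 1 \<in> hyperplane)"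

lemma hw_coeff_eqI: 
  assumes "p - scale c 1 \<in> hyperplane"
  shows "hw_coeff p = c"
  unfolding hw_coeff_def
proof (rule the_equality)
  show "p - scale c 1 \<in> hyperplane" by fact
  fix d assume "p - scale d 1 \<in> hyperplane"
  from pm.subspace_diff[OF hyperplane_subspace assms this]
  have "scale (d - c) 1 \<in> hyperplane" by (simp add: pm.scale_left_diff_distrib)
  then have "scale (inverse (d - c)) (scale (d - c) 1) \<in> hyperplane"
    by (rule pm.subspace_scale[OF hyperplane_subspace])
  then show "d = c" using one_notin_hyperplane by (cases "d - c = 0") auto
qed

lemma hw_coeff: "p - scale (hw_coeff p) 1 \<in> hyperplane"
  using hyperplane_decomp[of p] hw_coeff_eqI by metis

lemma hw_coeff_linear: "Vector_Spaces.linear scale (*) hw_coeff"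
proof -
  have "hw_coeff (p + q) = hw_coeff p + hw_coeff q" for p q
    by (rule hw_coeff_eqI) (use pm.subspace_add[OF hyperplane_subspace hw_coeff[of p] hw_coeff[of q]]
      in \<open>simp add: pm.scale_left_distrib algebra_simps\<close>)
  moreover have "hw_coeff (scale c p) = c * hw_coeff p" for c p
    by (rule hw_coeff_eqI) (use pm.subspace_scale[OF hyperplane_subspace hw_coeff[of p], of c]
      in \<open>simp add: pm.scale_right_diff_distrib\<close>)
  ultimately show ?thesis
    by (simp add: linear_iff_module_hom module_hom_iff vs_scale vs_mult pm.module_axioms
        module_iff_vector_space)
qed

lemma hw_coeff_max_left: "p \<in> max_left \<Longrightarrow> hw_coeff p = 0"
  using max_left_hyperplane by (intro hw_coeff_eqI) auto

lemma hw_coeff_one: "hw_coeff 1 = 1"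
  by (rule hw_coeff_eqI) (simp add: pm.subspace_0[OF hyperplane_subspace])

definition loop_gens :: "int \<Rightarrow> gen set" where
  "loop_gens i = {E i, F i, H i, D i}"

text \<open>Smoothness. The property holds for \<open>1\<close> and is inherited by \<open>y p\<close>, because for large \<open>i\<close> the
  bracket of \<open>x\<close> with a fixed generator \<open>y\<close> is a multiple of a generator of large index.\<close>

lemma eventually_annihilated: "\<exists>N. \<forall>i\<ge>N. \<forall>x\<in>loop_gens i. letter x * p \<in> verma_left"
proof -
  let ?S = "{p. \<exists>N. \<forall>i\<ge>N. \<forall>x\<in>loop_gens i. letter x * p \<in> verma_left}"
  have "left_ideal_T ?S"
  proof (rule left_ideal_TI)
    show "pm.subspace ?S"
    proof (rule pm.subspaceI)
      fix p q assume "p \<in> ?S" "q \<in> ?S"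
      then obtain M N where "\<forall>i\<ge>M. \<forall>x\<in>loop_gens i. letter x * p \<in> verma_left"
        "\<forall>i\<ge>N. \<forall>x\<in>loop_gens i. letter x * q \<in> verma_left" by auto
      then have "\<forall>i\<ge>max M N. \<forall>x\<in>loop_gens i. letter x * (p + q) \<in> verma_left"
        by (auto simp: distrib_left intro: pm.subspace_add[OF verma_left_subspace])
      then show "p + q \<in> ?S" by blast
    next
      fix c p assume "p \<in> ?S"
      then show "scale c p \<in> ?S" using pm.subspace_scale[OF verma_left_subspace] by fastforce
    qed (simp add: pm.subspace_0[OF verma_left_subspace])
    fix y p assume "p \<in> ?S"
    then obtain N where N: "letter x * p \<in> verma_left" if "i \<ge> N" "x \<in> loop_gens i" for i x by auto
    define j where "j = (case y of E j \<Rightarrow> j | F j \<Rightarrow> j | H j \<Rightarrow> j | D j \<Rightarrow> j | Cen \<Rightarrow> 0)"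
    have "letter x * (letter y * p) \<in> verma_left" if i: "i \<ge> max N (max (N - j) (1 - j))" and x: "x \<in> loop_gens i" for i x
    proof -
      \<comment> \<open>The index \<open>i + j\<close> is positive, so that no central term occurs.\<close>
      have "i + j \<noteq> 0" using i by simp
      then have "gen_bracket x y \<in> {0} \<union> (\<Union>u\<in>loop_gens (i + j). range (\<lambda>c. Poly_Mapping.single u c))"
        using x by (cases y) (auto simp: loop_gens_def j_def delta0_def scale_bas add.commute bas_def simp flip: single_uminus)
      then have "gen_bracket x y = 0 \<or> (\<exists>u c. u \<in> loop_gens (i + j) \<and> gen_bracket x y = Poly_Mapping.single u c)"
        by blast
      moreover have "letter u * p \<in> verma_left" if "u \<in> loop_gens (i + j)" for u
        by (rule N[OF _ that]) (use i in simp)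
      ultimately have "emb (gen_bracket x y) * p \<in> verma_left"
        using pm.subspace_scale[OF verma_left_subspace] pm.subspace_0[OF verma_left_subspace]
        by (auto simp: emb_single simp del: scale_single)
      moreover have "letter y * (letter x * p) \<in> verma_left"
        by (rule verma_left_mult[OF N[OF _ x]]) (use i in simp)
      ultimately show ?thesis
        using letter_swap[OF verma_left_subspace subset_refl] pm.subspace_add[OF verma_left_subspace] by blast
    qed
    then show "letter y * p \<in> ?S" by blast
  qed
  moreover have "1 \<in> ?S"
  proof -
    have "letter x \<in> verma_left" if "i \<ge> 1" "x \<in> loop_gens i" for i x
      using non_lowering_wt[of x] that by (auto simp: loop_gens_def)
    then show ?thesis by auto
  qed
  ultimately show ?thesis using left_ideal_T_UNIV by blast
qed

end

section \<open>Modules presented as images of spaces of finitely supported functions\<close>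

lemma complex_field_simps [simp]:
  "a \<in> carrier complex_field" "a \<oplus>\<^bsub>complex_field\<^esub> b = a + b"
  "a \<otimes>\<^bsub>complex_field\<^esub> b = a * b" "\<one>\<^bsub>complex_field\<^esub> = 1" "\<zero>\<^bsub>complex_field\<^esub> = 0"
  by (simp_all add: ring_of_type_algebra_def)

lemma complex_field_cring: "cring complex_field"
  by (rule cring_from_type_algebra)

text \<open>A module given as the image of a subspace of finitely supported functions under a linear map
  \<open>\<pi>\<close>. The action on the subspace satisfies the laws of a module only after applying \<open>\<pi>\<close>, as is the
  case for the free space that underlies a tensor product.\<close>

locale presentation =
  fixes M :: "'v affvir_module" (structure)
    and D :: "('b \<Rightarrow>\<^sub>0 complex) set"
    and act :: "affvir \<Rightarrow> ('b \<Rightarrow>\<^sub>0 complex) \<Rightarrow> ('b \<Rightarrow>\<^sub>0 complex)"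
    and \<pi> :: "('b \<Rightarrow>\<^sub>0 complex) \<Rightarrow> 'v"
  assumes subspace: "pm.subspace D"
    and carrier: "carrier M = \<pi> ` D"
    and zero: "\<pi> 0 = \<zero>"
    and add: "a \<in> D \<Longrightarrow> b \<in> D \<Longrightarrow> \<pi> (a + b) = \<pi> a \<oplus> \<pi> b"
    and scale: "a \<in> D \<Longrightarrow> \<pi> (scale c a) = c \<odot> \<pi> a"
    and lact: "a \<in> D \<Longrightarrow> \<pi> (act x a) = x \<rhd> \<pi> a"
    and act_closed: "a \<in> D \<Longrightarrow> act x a \<in> D"
    and act_linear: "Vector_Spaces.linear Defs.scale Defs.scale (act x)"
    and act_add: "a \<in> D \<Longrightarrow> \<pi> (act (x + y) a) = \<pi> (act x a + act y a)"
    and act_scale: "a \<in> D \<Longrightarrow> \<pi> (act (Defs.scale c x) a) = \<pi> (Defs.scale c (act x a))"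
    and act_bracket: "a \<in> D \<Longrightarrow> \<pi> (act (bracket x y) a) = \<pi> (act x (act y a) - act y (act x a))"
begin

lemmas closed = pm.subspace_0[OF subspace] pm.subspace_add[OF subspace] pm.subspace_scale[OF subspace]
  pm.subspace_diff[OF subspace] pm.subspace_neg[OF subspace]

sublocale abelian_group M
proof (rule abelian_groupI)
  show "\<exists>y\<in>carrier M. y \<oplus> x = \<zero>" if x: "x \<in> carrier M" for x
  proof -
    obtain a where a: "a \<in> D" "x = \<pi> a" using x carrier by auto
    show ?thesis
    proof (rule bexI)
      show "\<pi> (- a) \<oplus> x = \<zero>" using add[of "- a" a] a closed(5) zero by simp
      show "\<pi> (- a) \<in> carrier M" using a closed(5) carrier by simp
    qed
  qed
qed (use closed in \<open>auto simp: carrier add_ac simp flip: zero add\<close>)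

lemma neg: "a \<in> D \<Longrightarrow> \<ominus> \<pi> a = \<pi> (- a)"
  by (rule minus_equality) (use closed carrier in \<open>auto simp flip: add zero\<close>)

lemma diff: "a \<in> D \<Longrightarrow> b \<in> D \<Longrightarrow> \<pi> (a - b) = \<pi> a \<ominus> \<pi> b"
  using add[of a "- b"] closed by (simp add: minus_eq neg)

lemma module: "Module.module complex_field M"
proof (rule moduleI[OF complex_field_cring abelian_group_axioms])
qed (use closed in \<open>auto simp: carrier pm.scale_left_distrib pm.scale_right_distrib simp flip: add scale\<close>)

lemma affvir_module: "affvir_module M"
proof (intro affvir_module.intro module affvir_module_axioms.intro)
qed (use closed act_closed in \<open>auto simp: carrier act_add act_scale act_bracket linear_rules[OF act_linear] simp flip: add scale lact diff\<close>)

definition ker :: "('b \<Rightarrow>\<^sub>0 complex) set" where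
  "ker = {a \<in> D. \<pi> a = \<zero>}"

lemma eq_iff:
  assumes "a \<in> D" "b \<in> D"
  shows "\<pi> a = \<pi> b \<longleftrightarrow> a - b \<in> ker"
proof
  note b = closed(5)[OF assms(2)]
  assume eq: "\<pi> a = \<pi> b"
  have "\<pi> (a - b) = \<pi> a \<oplus> \<pi> (- b)" using add[OF assms(1) b] by simp
  also have "\<dots> = \<pi> (b + - b)" using add[OF assms(2) b] by (simp only: eq)
  also have "\<dots> = \<zero>" by (simp add: zero)
  finally show "a - b \<in> ker" using closed(4)[OF assms] by (simp add: ker_def)
next
  assume "a - b \<in> ker"
  then have "\<pi> (a - b) = \<zero>" "a - b \<in> D" by (simp_all add: ker_def)
  moreover have "\<pi> b \<in> carrier M" using assms(2) carrier by simp
  ultimately show "\<pi> a = \<pi> b" using add[of "a - b" b] assms(2) by simp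
qed

text \<open>Submodules correspond to the stable subspaces that contain the kernel.\<close>

lemma submodule_preimage:
  assumes "affvir_submodule N M"
  shows "pm.subspace {a \<in> D. \<pi> a \<in> N}" "ker \<subseteq> {a \<in> D. \<pi> a \<in> N}"
    "\<And>x a. a \<in> {a \<in> D. \<pi> a \<in> N} \<Longrightarrow> act x a \<in> {a \<in> D. \<pi> a \<in> N}"
    "\<pi> ` {a \<in> D. \<pi> a \<in> N} = N" "N \<subseteq> carrier M"
proof -
  interpret affvir_submodule N M by fact
  have N: "\<zero> \<in> N" "u \<oplus> v \<in> N" "c \<odot> u \<in> N" "u \<in> carrier M" if "u \<in> N" "v \<in> N" for u v c
    using one_closed m_closed[OF that] that subset smult_closed by auto
  show "pm.subspace {a \<in> D. \<pi> a \<in> N}"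
    using closed N one_closed by (auto simp: pm.subspace_def add scale zero)
  show "ker \<subseteq> {a \<in> D. \<pi> a \<in> N}" using one_closed by (auto simp: ker_def)
  show "act x a \<in> {a \<in> D. \<pi> a \<in> N}" if "a \<in> {a \<in> D. \<pi> a \<in> N}" for x a
    using that act_closed lact_closed by (simp add: lact)
  show "\<pi> ` {a \<in> D. \<pi> a \<in> N} = N" "N \<subseteq> carrier M" using N carrier by auto
qed

lemma submodule_image:
  assumes "pm.subspace P" "P \<subseteq> D" "\<And>x a. a \<in> P \<Longrightarrow> act x a \<in> P"
  shows "affvir_submodule (\<pi> ` P) M"
proof -
  have P: "0 \<in> P" "\<And>a b. a \<in> P \<Longrightarrow> b \<in> P \<Longrightarrow> a + b \<in> P" "\<And>c a. a \<in> P \<Longrightarrow> Defs.scale c a \<in> P" "\<And>a. a \<in> P \<Longrightarrow> - a \<in> P"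
    using assms(1) pm.subspace_neg by (auto simp: pm.subspace_def)
  interpret m: Module.module complex_field M by (rule module)
  show ?thesis
  proof (intro affvir_submodule.intro affvir_submodule_axioms.intro m.submoduleI)
    fix a assume "a \<in> \<pi> ` P"
    then obtain p where "p \<in> P" "a = \<pi> p" by auto
    then show "\<ominus> a \<in> \<pi> ` P" using neg assms(2) P by auto
  next
    fix a b assume "a \<in> \<pi> ` P" "b \<in> \<pi> ` P"
    then obtain p q where "p \<in> P" "a = \<pi> p" "q \<in> P" "b = \<pi> q" by auto
    then show "a \<oplus> b \<in> \<pi> ` P" using add[of p q] assms(2) P by (metis imageI subsetD)
  next
    fix c a assume "a \<in> \<pi> ` P"
    then obtain p where "p \<in> P" "a = \<pi> p" by auto
    then show "c \<odot> a \<in> \<pi> ` P" using scale[of p c] assms(2) P by (metis imageI subsetD)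
  next
    fix x a assume "a \<in> \<pi> ` P"
    then obtain p where "p \<in> P" "a = \<pi> p" by auto
    then show "x \<rhd> a \<in> \<pi> ` P" using lact[of p x] assms(2,3) by (metis imageI subsetD)
  next
    show "\<zero> \<in> \<pi> ` P" using P(1) by (simp flip: zero)
  qed (use assms carrier in auto)
qed

end

text \<open>For a stable subspace the unions in the definition of the quotient are unions of copies of a single
  coset, so the operations may be computed on representatives.\<close>

lemma quotient_module_ops:
  fixes M :: "'v affvir_module" (structure)
  assumes "Module.module complex_field M" "submodule N complex_field M"
  shows "carrier (quotient_module M N) = (+>) N ` carrier M"
    and "\<zero>\<^bsub>quotient_module M N\<^esub> = N +> \<zero>"
    and "u \<in> carrier M \<Longrightarrow> v \<in> carrier M \<Longrightarrow> (N +> u) \<oplus>\<^bsub>quotient_module M N\<^esub> (N +> v) = N +> (u \<oplus> v)"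
    and "u \<in> carrier M \<Longrightarrow> c \<odot>\<^bsub>quotient_module M N\<^esub> (N +> u) = N +> (c \<odot> u)"
    and "u \<in> carrier M \<Longrightarrow> (\<And>v. v \<in> carrier M \<Longrightarrow> x \<rhd> v \<in> carrier M) \<Longrightarrow>
       (\<And>v w. v \<in> carrier M \<Longrightarrow> w \<in> carrier M \<Longrightarrow> x \<rhd> (v \<oplus> w) = (x \<rhd> v) \<oplus> (x \<rhd> w)) \<Longrightarrow>
       (\<And>v. v \<in> N \<Longrightarrow> x \<rhd> v \<in> N) \<Longrightarrow> x \<rhd>\<^bsub>quotient_module M N\<^esub> (N +> u) = N +> (x \<rhd> u)"
    and "u \<in> carrier M \<Longrightarrow> v \<in> carrier M \<Longrightarrow> N +> u = N +> v \<longleftrightarrow> u \<ominus> v \<in> N"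
proof -
  interpret Module.module complex_field M by fact
  interpret s: submodule N complex_field M by fact
  interpret abelian_subgroup N M
    by (rule abelian_subgroupI3) (auto intro: additive_subgroup.intro s.subgroup_axioms abelian_group_axioms)
  have N: "n \<in> carrier M" if "n \<in> N" for n using that s.subset by auto
  have coset: "(\<Union>v\<in>N +> u. N +> f v) = N +> f u"
    if u: "u \<in> carrier M" and f: "\<And>v. v \<in> carrier M \<Longrightarrow> f v \<in> carrier M"
      and f_add: "\<And>n. n \<in> N \<Longrightarrow> f (n \<oplus> u) = f n \<oplus> f u" and fN: "\<And>n. n \<in> N \<Longrightarrow> f n \<in> N" for f u
  proof -
    have eq: "N +> f v = N +> f u" if v: "v \<in> N +> u" for v
    proof -
      obtain n where n: "n \<in> N" "v = n \<oplus> u" using v by (auto simp: a_r_coset_def')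
      then have "f v \<in> N +> f u" using f_add[OF n(1)] fN[OF n(1)] by (auto simp: a_r_coset_def')
      from a_repr_independence'[OF this f[OF u]] show ?thesis by simp
    qed    show ?thesis by (rule UN_constant_eq[OF a_rcos_self[OF u]]) (intro ballI eq)
  qed
  show "carrier (quotient_module M N) = (+>) N ` carrier M"
    by (auto simp: quotient_module_def A_RCOSETS_def')
  show "\<zero>\<^bsub>quotient_module M N\<^esub> = N +> \<zero>"
    using a_coset_add_zero[of N] s.subset by (simp add: quotient_module_def)
  show "(N +> u) \<oplus>\<^bsub>quotient_module M N\<^esub> (N +> v) = N +> (u \<oplus> v)" if "u \<in> carrier M" "v \<in> carrier M"
    using a_rcos_sum[OF that] by (simp add: quotient_module_def)
  show "c \<odot>\<^bsub>quotient_module M N\<^esub> (N +> u) = N +> (c \<odot> u)" if "u \<in> carrier M"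
  proof -
    have "(\<Union>v\<in>N +> u. N +> (c \<odot> v)) = N +> (c \<odot> u)"
      by (rule coset[OF that]) (use that in \<open>simp_all add: smult_r_distr N\<close>)
    then show ?thesis by (simp add: quotient_module_def)
  qed
  show "x \<rhd>\<^bsub>quotient_module M N\<^esub> (N +> u) = N +> (x \<rhd> u)"
    if "u \<in> carrier M" "\<And>v. v \<in> carrier M \<Longrightarrow> x \<rhd> v \<in> carrier M"
       "\<And>v w. v \<in> carrier M \<Longrightarrow> w \<in> carrier M \<Longrightarrow> x \<rhd> (v \<oplus> w) = (x \<rhd> v) \<oplus> (x \<rhd> w)"
       "\<And>v. v \<in> N \<Longrightarrow> x \<rhd> v \<in> N"
  proof -
    have "(\<Union>v\<in>N +> u. N +> (x \<rhd> v)) = N +> (x \<rhd> u)"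
      by (rule coset[OF that(1)]) (simp_all add: that N)
    then show ?thesis by (simp add: quotient_module_def)
  qed
  show "N +> u = N +> v \<longleftrightarrow> u \<ominus> v \<in> N" if "u \<in> carrier M" "v \<in> carrier M"
  proof -
    have "u \<in> N +> v \<longleftrightarrow> u \<ominus> v \<in> N"
      using a_rcos_module[OF that(2,1)] by (simp add: minus_eq)
    moreover have "u \<in> N +> v \<longleftrightarrow> N +> u = N +> v"
      using a_repr_independence'[of u v] a_rcos_self[OF that(1)] that(2) by auto
    ultimately show ?thesis by simp
  qed
qed

context presentation
begin

text \<open>A quotient of a presented module is presented by the same space. Iterating this turns the three
  quotients that define \<open>irr_hw_module\<close> into one quotient of the tensor algebra.\<close>

lemma quotient_presentation:
  assumes "affvir_submodule N M"
  shows "presentation (quotient_module M N) D act (\<lambda>a. N +> \<pi> a)"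
    and "presentation.ker (quotient_module M N) D (\<lambda>a. N +> \<pi> a) = {a \<in> D. \<pi> a \<in> N}"
proof -
  interpret s: affvir_submodule N M by fact
  interpret m: affvir_module M by (rule affvir_module)
  note ops = quotient_module_ops[OF module s.submodule_axioms]
  have lact_eq: "x \<rhd>\<^bsub>quotient_module M N\<^esub> (N +> u) = N +> (x \<rhd> u)" if "u \<in> carrier M" for x u
    by (rule ops(5)[OF that]) (auto intro: m.lact_closed m.lact_add_right s.lact_closed)
  have C: "\<pi> a \<in> carrier M" if "a \<in> D" for a using that carrier by auto
  have lact_eq': "N +> \<pi> (act x a) = x \<rhd>\<^bsub>quotient_module M N\<^esub> (N +> \<pi> a)" if "a \<in> D" for x a
    using that by (simp add: lact lact_eq C)
  show P: "presentation (quotient_module M N) D act (\<lambda>a. N +> \<pi> a)"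
    by unfold_locales
       (use closed C in \<open>simp_all add: subspace act_linear ops(1-4) lact_eq' zero add scale act_closed
          act_add act_scale act_bracket carrier image_image linear_rules[OF act_linear]\<close>)
  interpret q: presentation "quotient_module M N" D act "\<lambda>a. N +> \<pi> a" by (rule P)
  have "N +> \<pi> a = N +> \<zero> \<longleftrightarrow> \<pi> a \<in> N" if "a \<in> D" for a
  proof -
    have "\<pi> a \<ominus> \<zero> = \<pi> a"
      using diff[OF that closed(1)] by (simp only: zero diff_zero)
    then show ?thesis using ops(6)[OF C[OF that] zero_closed] by (simp only:)
  qed
  then show "q.ker = {a \<in> D. \<pi> a \<in> N}"
    unfolding q.ker_def ops(2) by (simp cong: conj_cong)
qed

end

section \<open>The irreducible highest weight module\<close>

definition left_act :: "affvir \<Rightarrow> tensor_alg \<Rightarrow> tensor_alg" where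
  "left_act x p = emb x * p"

lemma U_module_presentation: "presentation U_module UNIV left_act U_class"
proof
  fix a b :: tensor_alg and c x y
  have "left_act (bracket x y) a - (left_act x (left_act y a) - left_act y (left_act x a))
      = - (commutator_relation x y * a)"
    by (simp add: left_act_def commutator_relation_def algebra_simps)
  moreover have "- (commutator_relation x y * a) \<in> U_ideal"
    by (intro pm.subspace_neg U_ideal_subspace U_ideal_mult commutator_relation_in_U_ideal)
  ultimately show "U_class (left_act (bracket x y) a) = U_class (left_act x (left_act y a) - left_act y (left_act x a))"
    by (simp add: U_class_eq_iff)
  show "U_class (scale c a) = c \<odot>\<^bsub>U_module\<^esub> U_class a"
    by (simp add: U_module_def flip: U_class_simps(2))
qed (simp_all add: U_module_def U_class_zero U_class_simps U_carrier left_act_def distrib_right distrib_left)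

interpretation U: presentation U_module UNIV left_act U_class
  by (rule U_module_presentation)

lemma left_ideal_T_act: "left_ideal_T L \<longleftrightarrow> pm.subspace L \<and> (\<forall>x. \<forall>q\<in>L. left_act x q \<in> L)"
  using left_ideal_TI[of L] by (auto simp: left_ideal_T_def left_act_def simp flip: emb_bas)

context highest_weight
begin

lemma verma_ideal_eq: "verma_ideal \<eta> \<epsilon> \<theta> = U_class ` verma_left"
proof -
  have "verma_ideal \<eta> \<epsilon> \<theta> \<subseteq> carrier U_alg"
    using verma_ideal_left_ideal subgroup.subset
    by (fastforce simp: left_ideal_def additive_subgroup_def)
  then show ?thesis by (auto simp: verma_left_def U_carrier)
qed

definition verma_class :: "tensor_alg \<Rightarrow> tensor_alg set set" where
  "verma_class p = verma_ideal \<eta> \<epsilon> \<theta> +>\<^bsub>U_module\<^esub> U_class p"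

lemma verma_ideal_submodule: "affvir_submodule (verma_ideal \<eta> \<epsilon> \<theta>) U_module"
  unfolding verma_ideal_eq using verma_left_ideal
  by (intro U.submodule_image) (simp_all add: left_ideal_T_act)

sublocale verma: presentation "verma_module \<eta> \<epsilon> \<theta>" UNIV left_act verma_class
  unfolding verma_module_def verma_class_def[abs_def]
  by (rule U.quotient_presentation(1)[OF verma_ideal_submodule])

lemma verma_ker: "verma.ker = verma_left"
  using U.quotient_presentation(2)[OF verma_ideal_submodule]
  by (simp add: verma_module_def verma_class_def[abs_def] verma_left_def)

definition max_submodule :: "tensor_alg set set set" where
  "max_submodule = verma_class ` max_left"

lemma max_submodule_submodule: "affvir_submodule max_submodule (verma_module \<eta> \<epsilon> \<theta>)"
  unfolding max_submodule_def using max_left_ideal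
  by (intro verma.submodule_image) (simp_all add: left_ideal_T_act)

lemma max_submodule_preimage: "{p. verma_class p \<in> max_submodule} = max_left"
proof -
  have "p \<in> max_left" if "verma_class p = verma_class q" "q \<in> max_left" for p q
  proof -
    have "p - q \<in> max_left"
      using that(1) verma_left_max_left by (auto simp: verma.eq_iff verma_ker)
    then show ?thesis using that(2) in_subspace_cong[of max_left p q] max_left_ideal
      by (simp add: left_ideal_T_def)
  qed
  then show ?thesis by (auto simp: max_submodule_def)
qed

text \<open>A proper submodule has a proper left ideal as its preimage, and \<open>max_left\<close> is the largest of these.\<close>

lemma proper_submodule_le:
  assumes "affvir_submodule N (verma_module \<eta> \<epsilon> \<theta>)" "N \<noteq> carrier (verma_module \<eta> \<epsilon> \<theta>)"
  shows "N \<subseteq> max_submodule"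
proof -
  note N = verma.submodule_preimage[OF assms(1)]
  have "{a \<in> UNIV. verma_class a \<in> N} \<noteq> UNIV" using N(4) assms(2) by (auto simp: verma.carrier)
  then have "{a \<in> UNIV. verma_class a \<in> N} \<subseteq> max_left"
    by (intro max_left_greatest) (use N in \<open>auto simp: left_ideal_T_act verma_ker\<close>)
  from image_mono[OF this, of verma_class] show ?thesis
    by (simp only: N(4) max_submodule_def)
qed

lemma max_submodule_proper: "max_submodule \<noteq> carrier (verma_module \<eta> \<epsilon> \<theta>)"
  using max_submodule_preimage one_notin_max_left by (auto simp: verma.carrier)

lemma the_maximal_proper_submodule:
  "(THE J. maximal_proper_submodule J (verma_module \<eta> \<epsilon> \<theta>)) = max_submodule"
proof (rule the_equality)
  show "maximal_proper_submodule max_submodule (verma_module \<eta> \<epsilon> \<theta>)"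
    unfolding maximal_proper_submodule_def
    using max_submodule_submodule max_submodule_proper proper_submodule_le by blast
  show "J = max_submodule" if "maximal_proper_submodule J (verma_module \<eta> \<epsilon> \<theta>)" for J
    using that max_submodule_submodule max_submodule_proper proper_submodule_le[of J]
    unfolding maximal_proper_submodule_def by blast
qed

definition hw_class :: "tensor_alg \<Rightarrow> tensor_alg set set set" where
  "hw_class p = max_submodule +>\<^bsub>verma_module \<eta> \<epsilon> \<theta>\<^esub> verma_class p"

sublocale hw: presentation "irr_hw_module \<eta> \<epsilon> \<theta>" UNIV left_act hw_class
  unfolding irr_hw_module_def the_maximal_proper_submodule hw_class_def[abs_def]
  by (rule verma.quotient_presentation(1)[OF max_submodule_submodule])

lemma hw_ker: "hw.ker = max_left"
  using verma.quotient_presentation(2)[OF max_submodule_submodule] max_submodule_preimage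
  by (simp add: irr_hw_module_def the_maximal_proper_submodule hw_class_def[abs_def])

end

section \<open>Tensor products\<close>

locale tensor_product =
  M: affvir_module M + V: affvir_module V
  for M :: "'v affvir_module" and V :: "'w affvir_module"
begin

abbreviation pure :: "'v \<Rightarrow> 'w \<Rightarrow> 'v \<times> 'w \<Rightarrow>\<^sub>0 complex" where
  "pure u v \<equiv> Poly_Mapping.single (u, v) 1"

definition free_space :: "('v \<times> 'w \<Rightarrow>\<^sub>0 complex) set" where
  "free_space = {z. Poly_Mapping.keys z \<subseteq> carrier M \<times> carrier V}"

definition act :: "affvir \<Rightarrow> ('v \<times> 'w \<Rightarrow>\<^sub>0 complex) \<Rightarrow> 'v \<times> 'w \<Rightarrow>\<^sub>0 complex" where
  "act x = lin_ext scale (\<lambda>(u, v). pure (x \<rhd>\<^bsub>M\<^esub> u) v + pure u (x \<rhd>\<^bsub>V\<^esub> v))"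

definition relations :: "('v \<times> 'w \<Rightarrow>\<^sub>0 complex) set" where
  "relations =
      {pure (u \<oplus>\<^bsub>M\<^esub> u') v - pure u v - pure u' v | u u' v.
           u \<in> carrier M \<and> u' \<in> carrier M \<and> v \<in> carrier V}
      \<union> {pure u (v \<oplus>\<^bsub>V\<^esub> v') - pure u v - pure u v' | u v v'.
           u \<in> carrier M \<and> v \<in> carrier V \<and> v' \<in> carrier V}
      \<union> {pure (c \<odot>\<^bsub>M\<^esub> u) v - Poly_Mapping.single (u, v) c | c u v.
           u \<in> carrier M \<and> v \<in> carrier V}
      \<union> {pure u (c \<odot>\<^bsub>V\<^esub> v) - Poly_Mapping.single (u, v) c | c u v.
           u \<in> carrier M \<and> v \<in> carrier V}"

definition bilin :: "('v \<times> 'w \<Rightarrow>\<^sub>0 complex) set" where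
  "bilin = pm.span relations"

lemma free_space_subspace: "pm.subspace free_space"
  by (auto simp: pm.subspace_def free_space_def in_keys_iff lookup_add subset_iff) (metis add.right_neutral in_keys_iff mem_Sigma_iff)+

lemma pure_in_free_space: "u \<in> carrier M \<Longrightarrow> v \<in> carrier V \<Longrightarrow> Poly_Mapping.single (u, v) c \<in> free_space"
  by (auto simp: free_space_def)

lemma free_product_simps [simp]:
  "carrier (free_product_space M V) = free_space"
  "\<zero>\<^bsub>free_product_space M V\<^esub> = 0"
  "a \<oplus>\<^bsub>free_product_space M V\<^esub> b = a + b"
  "c \<odot>\<^bsub>free_product_space M V\<^esub> a = scale c a"
  "x \<rhd>\<^bsub>free_product_space M V\<^esub> a = act x a"
  by (simp_all add: free_product_space_def free_space_def act_def)

lemma free_product_module: "Module.module complex_field (free_product_space M V)"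
proof (rule moduleI[OF complex_field_cring abelian_groupI])
  show "\<exists>y\<in>carrier (free_product_space M V). y \<oplus>\<^bsub>free_product_space M V\<^esub> x = \<zero>\<^bsub>free_product_space M V\<^esub>"
    if "x \<in> carrier (free_product_space M V)" for x
    using pm.subspace_neg[OF free_space_subspace, of x] that by (intro bexI[of _ "- x"]) simp_all
qed (simp_all add: pm.subspace_add[OF free_space_subspace] pm.subspace_0[OF free_space_subspace]
    pm.subspace_scale[OF free_space_subspace] add_ac pm.scale_left_distrib pm.scale_right_distrib)

lemma free_product_submodule_iff:
  "submodule R complex_field (free_product_space M V) \<longleftrightarrow> pm.subspace R \<and> R \<subseteq> free_space"
proof
  assume "submodule R complex_field (free_product_space M V)"
  then interpret submodule R complex_field "free_product_space M V" .
  show "pm.subspace R \<and> R \<subseteq> free_space"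
    using subset one_closed m_closed smult_closed by (auto simp: pm.subspace_def)
next
  interpret m: Module.module complex_field "free_product_space M V" by (rule free_product_module)
  assume R: "pm.subspace R \<and> R \<subseteq> free_space"
  have "\<ominus>\<^bsub>free_product_space M V\<^esub> a = - a" if "a \<in> free_space" for a
    by (rule m.minus_equality) (simp_all add: that pm.subspace_neg[OF free_space_subspace])
  with R show "submodule R complex_field (free_product_space M V)"
    by (intro m.submoduleI) (auto simp: pm.subspace_add pm.subspace_0 pm.subspace_scale subset_iff pm.subspace_neg)
qed

lemma relations_free_space: "relations \<subseteq> free_space"
  unfolding relations_def
  by (auto intro!: pm.subspace_diff[OF free_space_subspace] pure_in_free_space M.smult_closed V.smult_closed)

lemma bilin_free_space: "bilin \<subseteq> free_space"
  unfolding bilin_def by (rule pm.span_minimal[OF relations_free_space free_space_subspace])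

lemma bilin_subspace: "pm.subspace bilin"
  unfolding bilin_def by (rule pm.subspace_span)

text \<open>The submodules of the free product space are the subspaces of \<open>free_space\<close>, which contains the
  relations, so the hull is a linear span.\<close>

lemma bilinear_relations_eq: "bilinear_relations M V = bilin"
proof -
  have "bilinear_relations M V = (\<lambda>R. pm.subspace R \<and> R \<subseteq> free_space) hull relations"
    unfolding bilinear_relations_def relations_def free_product_submodule_iff ..
  also have "\<dots> = bilin"
  proof (rule hull_unique)
    show "relations \<subseteq> bilin" unfolding bilin_def by (rule pm.span_superset)
    show "pm.subspace bilin \<and> bilin \<subseteq> free_space" using bilin_subspace bilin_free_space by simp
    show "bilin \<subseteq> R" if "relations \<subseteq> R" "pm.subspace R \<and> R \<subseteq> free_space" for R
      unfolding bilin_def using that by (intro pm.span_minimal) auto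
  qed
  finally show ?thesis .
qed

lemma bilin_rules:
  assumes "u \<in> carrier M" "v \<in> carrier V"
  shows "u' \<in> carrier M \<Longrightarrow> pure (u \<oplus>\<^bsub>M\<^esub> u') v - pure u v - pure u' v \<in> bilin"
    and "v' \<in> carrier V \<Longrightarrow> pure u (v \<oplus>\<^bsub>V\<^esub> v') - pure u v - pure u v' \<in> bilin"
    and "pure (c \<odot>\<^bsub>M\<^esub> u) v - Poly_Mapping.single (u, v) c \<in> bilin"
    and "pure u (c \<odot>\<^bsub>V\<^esub> v) - Poly_Mapping.single (u, v) c \<in> bilin"
  using assms unfolding bilin_def relations_def by (auto intro!: pm.span_base)

lemma act_linear: "Vector_Spaces.linear scale scale (act x)"
  unfolding act_def by (rule lin_ext_linear[OF vs_scale])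

lemmas act_simps [simp] = linear_rules[OF act_linear]

lemma act_single [simp]:
  "act x (Poly_Mapping.single (u, v) c) = Poly_Mapping.single (x \<rhd>\<^bsub>M\<^esub> u, v) c + Poly_Mapping.single (u, x \<rhd>\<^bsub>V\<^esub> v) c"
  by (simp add: act_def pm.scale_right_distrib)

lemma linear_free_space:
  assumes "Vector_Spaces.linear scale scale f" "pm.subspace S" "z \<in> free_space"
    and "\<And>u v. u \<in> carrier M \<Longrightarrow> v \<in> carrier V \<Longrightarrow> f (pure u v) \<in> S"
  shows "f z \<in> S"
proof (rule linear_in_subspace[OF assms(1,2)])
  fix k assume "k \<in> Poly_Mapping.keys z"
  then have "fst k \<in> carrier M" "snd k \<in> carrier V" using assms(3) by (auto simp: free_space_def)
  then show "f (Poly_Mapping.single k 1) \<in> S" using assms(4)[of "fst k" "snd k"] by simp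
qed

lemma act_free_space: "z \<in> free_space \<Longrightarrow> act x z \<in> free_space"
  by (erule linear_free_space[OF act_linear free_space_subspace])
     (auto intro!: pm.subspace_add[OF free_space_subspace] pure_in_free_space M.lact_closed V.lact_closed)

text \<open>The action sends each relation to the sum of two relations of the same kind, one for each factor.\<close>

lemma act_bilin:
  assumes "z \<in> bilin"
  shows "act x z \<in> bilin"
proof (rule pm.span_induct[OF assms[unfolded bilin_def]])
  show "pm.subspace {z. act x z \<in> bilin}"
    using bilin_subspace by (simp add: pm.subspace_def)
  fix z assume "z \<in> relations"
  then consider (1) u u' v where "z = pure (u \<oplus>\<^bsub>M\<^esub> u') v - pure u v - pure u' v" "u \<in> carrier M" "u' \<in> carrier M" "v \<in> carrier V"
    | (2) u v v' where "z = pure u (v \<oplus>\<^bsub>V\<^esub> v') - pure u v - pure u v'" "u \<in> carrier M" "v \<in> carrier V" "v' \<in> carrier V"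
    | (3) c u v where "z = pure (c \<odot>\<^bsub>M\<^esub> u) v - Poly_Mapping.single (u, v) c" "u \<in> carrier M" "v \<in> carrier V"
    | (4) c u v where "z = pure u (c \<odot>\<^bsub>V\<^esub> v) - Poly_Mapping.single (u, v) c" "u \<in> carrier M" "v \<in> carrier V"
    unfolding relations_def by blast
  then show "act x z \<in> bilin"
  proof cases
    case 1
    have "act x z = (pure ((x \<rhd>\<^bsub>M\<^esub> u) \<oplus>\<^bsub>M\<^esub> (x \<rhd>\<^bsub>M\<^esub> u')) v - pure (x \<rhd>\<^bsub>M\<^esub> u) v - pure (x \<rhd>\<^bsub>M\<^esub> u') v)
       + (pure (u \<oplus>\<^bsub>M\<^esub> u') (x \<rhd>\<^bsub>V\<^esub> v) - pure u (x \<rhd>\<^bsub>V\<^esub> v) - pure u' (x \<rhd>\<^bsub>V\<^esub> v))"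
      unfolding 1(1) using 1(2-) by (simp add: M.lact_add_right algebra_simps)
    then show ?thesis using 1
      by (simp only: M.lact_closed V.lact_closed pm.subspace_add[OF bilin_subspace] bilin_rules(1))
  next
    case 2
    have "act x z = (pure u ((x \<rhd>\<^bsub>V\<^esub> v) \<oplus>\<^bsub>V\<^esub> (x \<rhd>\<^bsub>V\<^esub> v')) - pure u (x \<rhd>\<^bsub>V\<^esub> v) - pure u (x \<rhd>\<^bsub>V\<^esub> v'))
       + (pure (x \<rhd>\<^bsub>M\<^esub> u) (v \<oplus>\<^bsub>V\<^esub> v') - pure (x \<rhd>\<^bsub>M\<^esub> u) v - pure (x \<rhd>\<^bsub>M\<^esub> u) v')"
      unfolding 2(1) using 2(2-) by (simp add: V.lact_add_right algebra_simps)
    then show ?thesis using 2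
      by (simp only: M.lact_closed V.lact_closed pm.subspace_add[OF bilin_subspace] bilin_rules(2))
  next
    case 3
    have "act x z = (pure (c \<odot>\<^bsub>M\<^esub> (x \<rhd>\<^bsub>M\<^esub> u)) v - Poly_Mapping.single (x \<rhd>\<^bsub>M\<^esub> u, v) c)
       + (pure (c \<odot>\<^bsub>M\<^esub> u) (x \<rhd>\<^bsub>V\<^esub> v) - Poly_Mapping.single (u, x \<rhd>\<^bsub>V\<^esub> v) c)"
      unfolding 3(1) using 3(2-) by (simp add: M.lact_smult_right algebra_simps)
    then show ?thesis using 3
      by (simp only: M.lact_closed V.lact_closed pm.subspace_add[OF bilin_subspace] bilin_rules(3))
  next
    case 4
    have "act x z = (pure u (c \<odot>\<^bsub>V\<^esub> (x \<rhd>\<^bsub>V\<^esub> v)) - Poly_Mapping.single (u, x \<rhd>\<^bsub>V\<^esub> v) c)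
       + (pure (x \<rhd>\<^bsub>M\<^esub> u) (c \<odot>\<^bsub>V\<^esub> v) - Poly_Mapping.single (x \<rhd>\<^bsub>M\<^esub> u, v) c)"
      unfolding 4(1) using 4(2-) by (simp add: V.lact_smult_right algebra_simps)
    then show ?thesis using 4
      by (simp only: M.lact_closed V.lact_closed pm.subspace_add[OF bilin_subspace] bilin_rules(4))
  qed
qed

lemma bilin_minus:
  assumes "u \<in> carrier M" "v \<in> carrier V"
  shows "u' \<in> carrier M \<Longrightarrow> pure (u \<ominus>\<^bsub>M\<^esub> u') v - (pure u v - pure u' v) \<in> bilin"
    and "v' \<in> carrier V \<Longrightarrow> pure u (v \<ominus>\<^bsub>V\<^esub> v') - (pure u v - pure u v') \<in> bilin"
proof -
  assume u': "u' \<in> carrier M"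
  have "(u \<ominus>\<^bsub>M\<^esub> u') \<oplus>\<^bsub>M\<^esub> u' = u"
    using assms u' by (simp add: M.minus_eq M.a_assoc M.l_neg)
  moreover have "u \<ominus>\<^bsub>M\<^esub> u' \<in> carrier M" using assms u' by simp
  ultimately have "- (pure u v - pure (u \<ominus>\<^bsub>M\<^esub> u') v - pure u' v) \<in> bilin"
    using bilin_rules(1)[of "u \<ominus>\<^bsub>M\<^esub> u'" v u'] assms u' by (intro pm.subspace_neg[OF bilin_subspace]) simp
  then show "pure (u \<ominus>\<^bsub>M\<^esub> u') v - (pure u v - pure u' v) \<in> bilin" by (simp add: algebra_simps)
next
  assume v': "v' \<in> carrier V"
  have "(v \<ominus>\<^bsub>V\<^esub> v') \<oplus>\<^bsub>V\<^esub> v' = v"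
    using assms v' by (simp add: V.minus_eq V.a_assoc V.l_neg)
  moreover have "v \<ominus>\<^bsub>V\<^esub> v' \<in> carrier V" using assms v' by simp
  ultimately have "- (pure u v - pure u (v \<ominus>\<^bsub>V\<^esub> v') - pure u v') \<in> bilin"
    using bilin_rules(2)[of u "v \<ominus>\<^bsub>V\<^esub> v'" v'] assms v' by (intro pm.subspace_neg[OF bilin_subspace]) simp
  then show "pure u (v \<ominus>\<^bsub>V\<^esub> v') - (pure u v - pure u v') \<in> bilin" by (simp add: algebra_simps)
qed

text \<open>Modulo the relations the action on the free space satisfies the laws of a module over the algebra.
  All three laws are linear in \<open>z\<close> and hold on pure tensors because they hold in the two factors.\<close>

lemma act_add: "z \<in> free_space \<Longrightarrow> act (x + y) z - (act x z + act y z) \<in> bilin"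
proof (erule linear_free_space[rotated 2])
  show "Vector_Spaces.linear scale scale (\<lambda>z. act (x + y) z - (act x z + act y z))"
    by (rule linear_scaleI) (simp_all add: pm.scale_right_distrib pm.scale_right_diff_distrib)
  fix u v assume uv: "u \<in> carrier M" "v \<in> carrier V"
  have "act (x + y) (pure u v) - (act x (pure u v) + act y (pure u v))
    = (pure ((x \<rhd>\<^bsub>M\<^esub> u) \<oplus>\<^bsub>M\<^esub> (y \<rhd>\<^bsub>M\<^esub> u)) v - pure (x \<rhd>\<^bsub>M\<^esub> u) v - pure (y \<rhd>\<^bsub>M\<^esub> u) v)
    + (pure u ((x \<rhd>\<^bsub>V\<^esub> v) \<oplus>\<^bsub>V\<^esub> (y \<rhd>\<^bsub>V\<^esub> v)) - pure u (x \<rhd>\<^bsub>V\<^esub> v) - pure u (y \<rhd>\<^bsub>V\<^esub> v))"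
    using uv by (simp add: M.lact_add_left V.lact_add_left algebra_simps)
  then show "act (x + y) (pure u v) - (act x (pure u v) + act y (pure u v)) \<in> bilin"
    using uv by (simp only: M.lact_closed V.lact_closed pm.subspace_add[OF bilin_subspace] bilin_rules(1,2))
qed (rule bilin_subspace)

lemma act_scale: "z \<in> free_space \<Longrightarrow> act (scale c x) z - scale c (act x z) \<in> bilin"
proof (erule linear_free_space[rotated 2])
  show "Vector_Spaces.linear scale scale (\<lambda>z. act (scale c x) z - scale c (act x z))"
    by (rule linear_scaleI) (simp_all add: pm.scale_right_distrib pm.scale_right_diff_distrib mult.commute)
  fix u v assume uv: "u \<in> carrier M" "v \<in> carrier V"
  have "act (scale c x) (pure u v) - scale c (act x (pure u v))
    = (pure (c \<odot>\<^bsub>M\<^esub> (x \<rhd>\<^bsub>M\<^esub> u)) v - Poly_Mapping.single (x \<rhd>\<^bsub>M\<^esub> u, v) c)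
    + (pure u (c \<odot>\<^bsub>V\<^esub> (x \<rhd>\<^bsub>V\<^esub> v)) - Poly_Mapping.single (u, x \<rhd>\<^bsub>V\<^esub> v) c)"
    using uv by (simp add: M.lact_scale_left V.lact_scale_left pm.scale_right_distrib algebra_simps)
  then show "act (scale c x) (pure u v) - scale c (act x (pure u v)) \<in> bilin"
    using uv by (simp only: M.lact_closed V.lact_closed pm.subspace_add[OF bilin_subspace] bilin_rules(3,4))
qed (rule bilin_subspace)

lemma act_bracket: "z \<in> free_space \<Longrightarrow> act (bracket x y) z - (act x (act y z) - act y (act x z)) \<in> bilin"
proof (erule linear_free_space[rotated 2])
  show "Vector_Spaces.linear scale scale (\<lambda>z. act (bracket x y) z - (act x (act y z) - act y (act x z)))"
    by (rule linear_scaleI) (simp_all add: pm.scale_right_diff_distrib)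
  fix u v assume uv: "u \<in> carrier M" "v \<in> carrier V"
  let ?M = "\<lambda>x u. x \<rhd>\<^bsub>M\<^esub> u" and ?V = "\<lambda>x v. x \<rhd>\<^bsub>V\<^esub> v"
  have "act (bracket x y) (pure u v) - (act x (act y (pure u v)) - act y (act x (pure u v)))
    = (pure (?M x (?M y u) \<ominus>\<^bsub>M\<^esub> ?M y (?M x u)) v - (pure (?M x (?M y u)) v - pure (?M y (?M x u)) v))
    + (pure u (?V x (?V y v) \<ominus>\<^bsub>V\<^esub> ?V y (?V x v)) - (pure u (?V x (?V y v)) - pure u (?V y (?V x v))))"
    using uv by (simp add: M.lact_bracket V.lact_bracket algebra_simps)
  then show "act (bracket x y) (pure u v) - (act x (act y (pure u v)) - act y (act x (pure u v))) \<in> bilin"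
    using uv by (simp only: M.lact_closed V.lact_closed pm.subspace_add[OF bilin_subspace] bilin_minus)
qed (rule bilin_subspace)

definition coset :: "('v \<times> 'w \<Rightarrow>\<^sub>0 complex) \<Rightarrow> ('v \<times> 'w \<Rightarrow>\<^sub>0 complex) set" where
  "coset z = bilin +>\<^bsub>free_product_space M V\<^esub> z"

lemma coset_eq_iff: "a \<in> free_space \<Longrightarrow> b \<in> free_space \<Longrightarrow> coset a = coset b \<longleftrightarrow> a - b \<in> bilin"
proof -
  interpret m: Module.module complex_field "free_product_space M V" by (rule free_product_module)
  assume ab: "a \<in> free_space" "b \<in> free_space"
  have "\<ominus>\<^bsub>free_product_space M V\<^esub> b = - b"
    by (rule m.minus_equality) (simp_all add: ab pm.subspace_neg[OF free_space_subspace])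
  then have "a \<ominus>\<^bsub>free_product_space M V\<^esub> b = a - b" by (simp add: m.minus_eq)
  then show ?thesis
    using quotient_module_ops(6)[OF free_product_module, of bilin a b] ab
    by (simp add: coset_def free_product_submodule_iff bilin_subspace bilin_free_space)
qed

lemma tensor_presentation: "presentation (M \<otimes>\<^sub>L V) free_space act coset"
proof -
  have B: "submodule bilin complex_field (free_product_space M V)"
    by (simp add: free_product_submodule_iff bilin_subspace bilin_free_space)
  note ops = quotient_module_ops[OF free_product_module B, simplified, folded coset_def]
  note closed = pm.subspace_add[OF free_space_subspace] pm.subspace_diff[OF free_space_subspace]
    pm.subspace_scale[OF free_space_subspace] act_free_space
  show ?thesis
    unfolding tensor_module_def bilinear_relations_eq
  proof (rule presentation.intro)
    show "carrier (quotient_module (free_product_space M V) bilin) = coset ` free_space"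
      using ops(1) by (simp add: coset_def)
  qed (simp_all add: free_space_subspace ops(1-5) closed act_linear act_bilin coset_eq_iff act_add act_scale act_bracket)
qed

lemma tensor_ker: "presentation.ker (M \<otimes>\<^sub>L V) free_space coset = bilin"
proof -
  interpret presentation "M \<otimes>\<^sub>L V" free_space act coset by (rule tensor_presentation)
  show ?thesis
    using coset_eq_iff[OF _ closed(1)] bilin_free_space by (auto simp: ker_def simp flip: zero)
qed

end

section \<open>The polynomial modules\<close>

lemma shift_0 [simp]: "shift i k 0 = 0"
  by (simp add: shift_def)

lemma shift_pCons: "shift i k (pCons a g) = [:pcompose a [:- of_int k, 1:]:] + (svar - of_int i) * shift i k g"
  by (simp add: shift_def map_poly_pCons pcompose_pCons svar_def of_int_poly)

lemma shift_add [simp]: "shift i k (g + h) = shift i k g + shift i k h"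
proof (induction g h rule: poly_induct2)
  case (pCons a g b h)
  then show ?case by (simp add: shift_pCons pcompose_add algebra_simps)
qed simp

lemma shift_smult: "shift i k (smult a g) = smult (pcompose a [:- of_int k, 1:]) (shift i k g)"
  by (induction g) (auto simp: shift_pCons pcompose_mult smult_add_right mult_ac)

lemma shift_const: "shift i k [:a:] = [:pcompose a [:- of_int k, 1:]:]"
  by (simp add: shift_pCons)

lemma shift_mult_const: "shift i k ([:a:] * g) = [:pcompose a [:- of_int k, 1:]:] * shift i k g"
  by (simp add: shift_smult)

lemma shift_svar_mult: "shift i k (svar * g) = (svar - of_int i) * shift i k g"
  by (simp add: svar_def shift_pCons)

lemma shift_diff: "shift i k (g - h) = shift i k g - shift i k h"
  using shift_add[of i k "g - h" h] by simp

lemma shift_of_int_mult: "shift i k (of_int j * g) = of_int j * shift i k g"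
  using shift_mult_const[of i k "of_int j" g] by (simp add: of_int_poly)

lemma shift_mult: "shift i k (g * h) = shift i k g * shift i k h"
proof (induction g)
  case (pCons a g)
  have eq: "pCons a g * h = [:a:] * h + svar * (g * h)" by (simp add: svar_def)
  have "shift i k (pCons a g * h) = [:pcompose a [:- of_int k, 1:]:] * shift i k h
      + (svar - of_int i) * (shift i k g * shift i k h)"
    unfolding eq shift_add shift_mult_const shift_svar_mult pCons(2) ..
  then show ?case by (simp only: shift_pCons distrib_right mult.assoc)
qed simp

lemma shift_shift: "shift i k (shift j m g) = shift (i + j) (k + m) g"
proof (induction g)
  case (pCons a g)
  have "pcompose (pcompose a [:- of_int m, 1:]) [:- of_int k, 1:] = pcompose a [:- of_int (k + m), 1:]"
    by (simp add: pcompose_assoc[symmetric] pcompose_pCons algebra_simps)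
  then show ?case
    using pCons by (simp add: shift_pCons left_diff_distrib distrib_right shift_diff shift_of_int_mult shift_svar_mult)
qed simp

lemma cst_simps: "cst (a + b) = cst a + cst b" "cst (a * b) = cst a * cst b" "cst 0 = 0" "cst 1 = 1"
  "cst (a - b) = cst a - cst b" "cst (- a) = - cst a"
  by (simp_all add: cst_def one_pCons)

lemma cst_mult: "cst c * g = smult [:c:] g"
  by (simp add: cst_def)

lemma vs_cst: "vector_space (\<lambda>c g. cst c * g)"
  by standard (simp_all add: cst_simps algebra_simps)

lemma shift_cst_mult: "shift i k (cst c * g) = cst c * shift i k g"
  by (simp add: cst_mult shift_smult)

text \<open>The common form of the three families: only the polynomials \<open>P\<close> and \<open>Q\<close> in \<open>t\<close> depend on the family.\<close>

fun weight_act ::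
    "complex \<Rightarrow> complex \<Rightarrow> complex poly \<Rightarrow> complex poly \<Rightarrow> gen \<Rightarrow> complex poly poly \<Rightarrow> complex poly poly" where
  "weight_act l c P Q (E i) g = cst (l powi i) * ([:P:] * shift i 2 g)"
| "weight_act l c P Q (F i) g = cst (l powi i) * ([:Q:] * shift i (-2) g)"
| "weight_act l c P Q (H i) g = cst (l powi i) * (tvar * shift i 0 g)"
| "weight_act l c P Q (D i) g = cst (l powi i) * ((svar + cst (of_int i * c)) * shift i 0 g)"
| "weight_act l c P Q Cen g = 0"

text \<open>The relation \<open>[E i, F j] = H (i + j)\<close> on polynomials.\<close>

definition sl2_pair :: "complex poly \<Rightarrow> complex poly \<Rightarrow> bool" where
  "sl2_pair P Q \<longleftrightarrow> P * pcompose Q [:-2, 1:] - Q * pcompose P [:2, 1:] = [:0, 1:]"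

text \<open>An operator on polynomials in \<open>t\<close>, composed of multiplications and of the actions of \<open>E\<close> and \<open>F\<close>, that
  lowers the degree by exactly one. Multiplications are available because \<open>H\<close> acts as \<open>t\<close>.\<close>

definition degree_lowering :: "complex poly \<Rightarrow> complex poly \<Rightarrow> bool" where
  "degree_lowering P Q \<longleftrightarrow> (\<forall>m. \<exists>A b c r. r \<noteq> 0 \<and> (\<forall>q. degree q \<le> Suc m \<longrightarrow>
     (let q' = A * q + smult b (P * pcompose q [:-2, 1:]) + smult c (Q * pcompose q [:2, 1:])
      in degree q' \<le> m \<and> coeff q' m = r * coeff q (Suc m))))"

lemma omega_act_weight_act:
  "omega_act l a b c = weight_act l c [:a:] (smult (- 1 / a) ([:- b, 1/2:] * [:b + 1, 1/2:]))"
proof (intro ext)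
  fix x g show "omega_act l a b c x g = weight_act l c [:a:] (smult (- 1 / a) ([:- b, 1/2:] * [:b + 1, 1/2:])) x g"
    by (cases x; simp add: cst_def tvar_def one_pCons mult.assoc mult.commute field_simps; simp add: add_divide_distrib diff_divide_distrib add.commute)
qed

lemma delta_act_weight_act:
  "delta_act l a b c = weight_act l c (smult (- 1 / a) ([:b, 1/2:] * [:- b - 1, 1/2:])) [:a:]"
proof (intro ext)
  fix x g show "delta_act l a b c x g = weight_act l c (smult (- 1 / a) ([:b, 1/2:] * [:- b - 1, 1/2:])) [:a:] x g"
    by (cases x; simp add: cst_def tvar_def one_pCons mult.assoc mult.commute field_simps; simp add: add_divide_distrib diff_divide_distrib add.commute)
qed

lemma theta_act_weight_act:
  "theta_act l a b c = weight_act l c (smult a [:b, 1/2:]) (smult (- 1 / a) [:- b, 1/2:])"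
proof (intro ext)
  fix x g show "theta_act l a b c x g = weight_act l c (smult a [:b, 1/2:]) (smult (- 1 / a) [:- b, 1/2:]) x g"
    by (cases x) (simp_all add: cst_def tvar_def one_pCons mult.assoc mult.commute field_simps)
qed

lemma sl2_pair_omega: "a \<noteq> 0 \<Longrightarrow> sl2_pair [:a:] (smult (- 1 / a) ([:- b, 1/2:] * [:b + 1, 1/2:]))"
  by (simp add: sl2_pair_def pcompose_pCons pcompose_mult field_simps)

lemma sl2_pair_delta: "a \<noteq> 0 \<Longrightarrow> sl2_pair (smult (- 1 / a) ([:b, 1/2:] * [:- b - 1, 1/2:])) [:a:]"
  by (simp add: sl2_pair_def pcompose_pCons pcompose_mult field_simps)

lemma sl2_pair_theta: "a \<noteq> 0 \<Longrightarrow> sl2_pair (smult a [:b, 1/2:]) (smult (- 1 / a) [:- b, 1/2:])"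
  by (simp add: sl2_pair_def pcompose_pCons pcompose_mult field_simps)

lemma coeff_pcompose_translation:
  fixes g :: "'a::comm_ring_1 poly"
  assumes "degree g \<le> n"
  shows "coeff (pcompose g [:c, 1:]) m = (\<Sum>a\<le>n. of_nat (a choose m) * c ^ (a - m) * coeff g a)"
proof -
  have power: "coeff ([:c, 1:] ^ a) m = of_nat (a choose m) * c ^ (a - m)" for a
  proof (cases "m \<le> a")
    case True
    then show ?thesis by (simp add: coeff_linear_poly_power)
  next
    case False
    have "degree ([:c, 1:] ^ a) \<le> a" using degree_power_le[of "[:c, 1:]" a] by simp
    then show ?thesis using False by (simp add: coeff_eq_0 binomial_eq_0)
  qed
  have "pcompose g [:c, 1:] = (\<Sum>a\<le>degree g. smult (coeff g a) ([:c, 1:] ^ a))"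
    by (simp add: pcompose_altdef poly_altdef degree_map_poly coeff_map_poly)
  also have "\<dots> = (\<Sum>a\<le>n. smult (coeff g a) ([:c, 1:] ^ a))"
    by (rule sum.mono_neutral_left) (use assms in \<open>auto simp: coeff_eq_0\<close>)
  finally have "coeff (pcompose g [:c, 1:]) m = (\<Sum>a\<le>n. coeff g a * coeff ([:c, 1:] ^ a) m)"
    by (simp add: coeff_sum)
  then show ?thesis by (simp add: power mult_ac)
qed

lemma coeff_pcompose_top:
  fixes g :: "'a::comm_ring_1 poly"
  assumes "degree g \<le> n"
  shows "m > n \<Longrightarrow> coeff (pcompose g [:c, 1:]) m = 0"
    and "coeff (pcompose g [:c, 1:]) n = coeff g n"
    and "n = Suc m \<Longrightarrow> coeff (pcompose g [:c, 1:]) m = coeff g m + of_nat (Suc m) * c * coeff g (Suc m)"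
    and "n = Suc (Suc m) \<Longrightarrow> coeff (pcompose g [:c, 1:]) m = coeff g m + of_nat (Suc m) * c * coeff g (Suc m)
        + of_nat (Suc (Suc m) choose 2) * c\<^sup>2 * coeff g (Suc (Suc m))"
proof -
  have z: "(\<Sum>a<m. of_nat (a choose m) * c ^ (a - m) * coeff g a) = 0" for m
    by (intro sum.neutral) (auto simp: binomial_eq_0)
  note f = coeff_pcompose_translation[OF assms]
  show "coeff (pcompose g [:c, 1:]) m = 0" if "m > n"
    unfolding f using that by (intro sum.neutral) (auto simp: binomial_eq_0)
  show "coeff (pcompose g [:c, 1:]) n = coeff g n"
    unfolding f using z[of n] by (simp flip: lessThan_Suc_atMost)
  show "coeff (pcompose g [:c, 1:]) m = coeff g m + of_nat (Suc m) * c * coeff g (Suc m)" if "n = Suc m"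
    unfolding f using z[of m] that by (simp flip: lessThan_Suc_atMost)
  have "Suc (Suc m) choose m = Suc (Suc m) choose 2" using binomial_symmetric[of m "Suc (Suc m)"] by (simp add: numeral_2_eq_2)
  then show "coeff (pcompose g [:c, 1:]) m = coeff g m + of_nat (Suc m) * c * coeff g (Suc m)
        + of_nat (Suc (Suc m) choose 2) * c\<^sup>2 * coeff g (Suc (Suc m))" if "n = Suc (Suc m)"
    unfolding f using z[of m] that by (simp add: power2_eq_square flip: lessThan_Suc_atMost del: binomial_Suc_Suc)
qed

lemma translation_difference:
  fixes q :: "complex poly"
  assumes "degree q \<le> Suc m"
  shows "degree (pcompose q [:e, 1:] - q) \<le> m"
    and "coeff (pcompose q [:e, 1:] - q) m = of_nat (Suc m) * e * coeff q (Suc m)"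
proof -
  show "degree (pcompose q [:e, 1:] - q) \<le> m"
  proof (intro degree_le allI impI)
    fix k assume "k > m"
    then consider "k = Suc m" | "k > Suc m" by linarith
    then show "coeff (pcompose q [:e, 1:] - q) k = 0"
      using assms coeff_pcompose_top(1,2)[OF assms] by cases (simp_all add: coeff_eq_0)
  qed
  show "coeff (pcompose q [:e, 1:] - q) m = of_nat (Suc m) * e * coeff q (Suc m)"
    by (simp add: coeff_pcompose_top(3)[OF assms refl])
qed

lemma degree_lowering_omega:
  assumes "a \<noteq> 0"
  shows "degree_lowering [:a:] Q"
  unfolding degree_lowering_def Let_def
proof
  fix m
  have eq: "[:-1:] * q + smult (1 / a) ([:a:] * pcompose q [:-2, 1:]) + smult 0 (Q * pcompose q [:2, 1:])
      = pcompose q [:-2, 1:] - q" for q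
    using assms by simp
  show "\<exists>A b c r. r \<noteq> 0 \<and> (\<forall>q. degree q \<le> Suc m \<longrightarrow>
      degree (A * q + smult b ([:a:] * pcompose q [:-2, 1:]) + smult c (Q * pcompose q [:2, 1:])) \<le> m \<and>
      coeff (A * q + smult b ([:a:] * pcompose q [:-2, 1:]) + smult c (Q * pcompose q [:2, 1:])) m
        = r * coeff q (Suc m))"
    by (rule exI[of _ "[:-1:]"], rule exI[of _ "1 / a"], rule exI[of _ 0], rule exI[of _ "of_nat (Suc m) * (-2)"],
        unfold eq, rule conjI, simp del: of_nat_Suc, intro allI impI conjI; erule translation_difference)
qed

lemma degree_lowering_delta:
  assumes "a \<noteq> 0"
  shows "degree_lowering P [:a:]"
  unfolding degree_lowering_def Let_def
proof
  fix m
  have eq: "[:-1:] * q + smult 0 (P * pcompose q [:-2, 1:]) + smult (1 / a) ([:a:] * pcompose q [:2, 1:])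
      = pcompose q [:2, 1:] - q" for q
    using assms by simp
  show "\<exists>A b c r. r \<noteq> 0 \<and> (\<forall>q. degree q \<le> Suc m \<longrightarrow>
      degree (A * q + smult b (P * pcompose q [:-2, 1:]) + smult c ([:a:] * pcompose q [:2, 1:])) \<le> m \<and>
      coeff (A * q + smult b (P * pcompose q [:-2, 1:]) + smult c ([:a:] * pcompose q [:2, 1:])) m
        = r * coeff q (Suc m))"
    by (rule exI[of _ "[:-1:]"], rule exI[of _ 0], rule exI[of _ "1 / a"], rule exI[of _ "of_nat (Suc m) * 2"],
        unfold eq, rule conjI, simp del: of_nat_Suc, intro allI impI conjI; erule translation_difference)
qed

lemma choose_two_of_nat: "of_nat (n choose 2) = (of_nat n * (of_nat n - 1) / 2 :: complex)"
proof (induction n)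
  case (Suc n)
  have "Suc n choose 2 = (n choose 2) + n" by (simp add: numeral_2_eq_2)
  then show ?case using Suc by (simp add: field_simps)
qed (simp add: numeral_2_eq_2)

text \<open>The operator is \<open>(t/2 + b) (q(t - 2) - q(t)) + (t/2 - b) (q(t + 2) - q(t))\<close>. The first order terms of the
  two differences cancel in the part with factor \<open>t/2\<close>. What remains in degree \<open>n - 1\<close>, where \<open>n\<close> is the
  degree of \<open>q\<close>, is \<open>2 n (n - 1)\<close> from the second order terms and \<open>- 4 n b\<close> from the part with factor \<open>b\<close>.\<close>

lemma degree_lowering_theta:
  assumes "a \<noteq> 0" "2 * b \<notin> \<nat>"
  shows "degree_lowering (smult a [:b, 1/2:]) (smult (- 1 / a) [:- b, 1/2:])"
  unfolding degree_lowering_def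
proof (intro allI)
  fix m
  let ?q' = "\<lambda>q. [:0, -1:] * q + smult (1 / a) (smult a [:b, 1/2:] * pcompose q [:-2, 1:])
    + smult (- a) (smult (- 1 / a) [:- b, 1/2:] * pcompose q [:2, 1:])"
  let ?r = "2 * of_nat (Suc m) * (of_nat m - 2 * b)"
  have q': "?q' q = [:0, -1:] * q + [:b, 1/2:] * pcompose q [:-2, 1:] + [:- b, 1/2:] * pcompose q [:2, 1:]" for q
    using assms(1) by (simp del: mult_pCons_left smult_pCons)
  have "2 * b \<noteq> of_nat m" using assms(2) by (metis of_nat_in_Nats)
  then have r: "?r \<noteq> 0" by (simp del: of_nat_Suc)
  have c0: "coeff ([:x, y:] * p) 0 = x * coeff p 0" for x y :: complex and p by (simp add: coeff_pCons)
  have cS: "coeff ([:x, y:] * p) (Suc k) = x * coeff p (Suc k) + y * coeff p k" for x y :: complex and p k by (simp add: coeff_pCons)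
  have step: "degree (?q' q) \<le> m \<and> coeff (?q' q) m = ?r * coeff q (Suc m)" if d: "degree q \<le> Suc m" for q
  proof
    note top = coeff_pcompose_top(1,2)[OF d]
    note sub = coeff_pcompose_top(3)[OF d refl]
    show "degree (?q' q) \<le> m"
    proof (intro degree_le allI impI)
      fix k assume "k > m"
      then consider "k = Suc m" | "k = Suc (Suc m)" | j where "k = Suc j" "j > Suc m"
        by (metis Suc_lessE less_antisym not_less_eq)
      then show "coeff (?q' q) k = 0"
        unfolding q' using d by cases (simp_all add: cS top sub coeff_eq_0 field_simps)
    qed
    show "coeff (?q' q) m = ?r * coeff q (Suc m)"
    proof (cases m)
      case 0
      then show ?thesis unfolding q' by (simp add: c0 sub[unfolded 0] algebra_simps del: mult_pCons_left coeff_pcompose_0)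
    next
      case (Suc j)
      have ch: "of_nat (Suc (Suc j) choose 2) = (of_nat (Suc j) * of_nat (Suc (Suc j)) / 2 :: complex)"
        using choose_two_of_nat[of "Suc (Suc j)"] by (simp add: mult.commute)
      note sub2 = coeff_pcompose_top(4)[OF d[unfolded Suc] refl]
      show ?thesis unfolding q' Suc
        unfolding coeff_add cS sub[unfolded Suc] sub2 ch by (simp add: algebra_simps power2_eq_square add_divide_distrib)
    qed
  qed
  show "\<exists>A ba c r. r \<noteq> 0 \<and> (\<forall>q. degree q \<le> Suc m \<longrightarrow>
     (let q' = A * q + smult ba (smult a [:b, 1/2:] * pcompose q [:-2, 1:]) + smult c (smult (- 1 / a) [:- b, 1/2:] * pcompose q [:2, 1:])
      in degree q' \<le> m \<and> coeff q' m = r * coeff q (Suc m)))"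
    unfolding Let_def
    by (rule exI[of _ "[:0, -1:]"], rule exI[of _ "1/a"], rule exI[of _ "- a"], rule exI[of _ ?r], rule conjI[OF r], intro allI impI, erule step)
qed

locale weight_module =
  fixes l c :: complex and P Q :: "complex poly"
  assumes l: "l \<noteq> 0" and sl2: "sl2_pair P Q"
begin

lemma weight_act_linear:
  "weight_act l c P Q x (g + h) = weight_act l c P Q x g + weight_act l c P Q x h"
  "weight_act l c P Q x (cst k * g) = cst k * weight_act l c P Q x g"
  by (cases x; simp only: weight_act.simps shift_add distrib_left shift_cst_mult mult.left_commute
      add_0_left mult_zero_right)+

definition poly_act :: "affvir \<Rightarrow> complex poly poly \<Rightarrow> complex poly poly" where
  "poly_act x g = lin_ext (\<lambda>c p. cst c * p) (\<lambda>b. weight_act l c P Q b g) x"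

lemma poly_act_linear1: "Vector_Spaces.linear scale (\<lambda>c p. cst c * p) (\<lambda>x. poly_act x g)"
  unfolding poly_act_def by (rule lin_ext_linear[OF vs_cst])

lemma poly_act_linear2:
  "poly_act x (g + h) = poly_act x g + poly_act x h" "poly_act x (cst k * g) = cst k * poly_act x g"
  by (simp_all add: poly_act_def lin_ext_def weight_act_linear sum.distrib distrib_left sum_distrib_left
      mult.left_commute)

lemma poly_act_single: "poly_act (Poly_Mapping.single b k) g = cst k * weight_act l c P Q b g"
  by (simp add: poly_act_def lin_ext_single[OF vs_cst])

fun index :: "gen \<Rightarrow> int" where
  "index (E i) = i" | "index (F i) = i" | "index (H i) = i" | "index (D i) = i" | "index Cen = 0"

fun tstep :: "gen \<Rightarrow> int" where
  "tstep (E i) = 2" | "tstep (F i) = -2" | "tstep (H i) = 0" | "tstep (D i) = 0" | "tstep Cen = 0"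

text \<open>Each generator acts as a scalar times a multiplication after a translation; its data are the
  multiplier and the translation by \<open>index\<close> in \<open>s\<close> and by \<open>tstep\<close> in \<open>t\<close>. Commutators then
  reduce to an identity between multipliers.\<close>

fun factor :: "gen \<Rightarrow> complex poly poly" where
  "factor (E i) = [:P:]" | "factor (F i) = [:Q:]" | "factor (H i) = tvar"
| "factor (D i) = svar + cst (of_int i * c)" | "factor Cen = 0"

lemma weight_act_eq: "weight_act l c P Q x g = cst (l powi index x) * (factor x * shift (index x) (tstep x) g)"
  by (cases x) (simp_all only: weight_act.simps index.simps tstep.simps factor.simps mult_zero_left mult_zero_right)

lemma weight_act_commutator:
  "weight_act l c P Q x (weight_act l c P Q y g) - weight_act l c P Q y (weight_act l c P Q x g)
   = cst (l powi (index x + index y)) * ((factor x * shift (index x) (tstep x) (factor y)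
       - factor y * shift (index y) (tstep y) (factor x)) * shift (index x + index y) (tstep x + tstep y) g)"
proof -
  have "weight_act l c P Q x (weight_act l c P Q y g) = cst (l powi (index x + index y)) *
      ((factor x * shift (index x) (tstep x) (factor y)) * shift (index x + index y) (tstep x + tstep y) g)" for x y
  proof -
    have "weight_act l c P Q x (weight_act l c P Q y g) = cst (l powi index x) * (factor x *
        (cst (l powi index y) * shift (index x) (tstep x) (factor y * shift (index y) (tstep y) g)))"
      by (simp only: weight_act_eq shift_cst_mult)
    then show ?thesis
      using l by (simp only: shift_mult shift_shift power_int_add cst_simps mult_ac simp_thms)
  qed
  from this[of x y] this[of y x] show ?thesis
    by (simp only: left_diff_distrib right_diff_distrib add.commute)
qed

lemma factor_shift:
  "shift i k tvar = tvar - cst (of_int k)"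
  "shift i k (svar + cst d) = svar - cst (of_int i) + cst d"
  "shift i k [:R:] = [:pcompose R [:- of_int k, 1:]:]"
proof -
  show "shift i k tvar = tvar - cst (of_int k)"
    by (simp add: tvar_def shift_const pcompose_pCons cst_def)
  show "shift i k (svar + cst d) = svar - cst (of_int i) + cst d"
  proof -
    have one: "shift i k 1 = 1" using shift_const[of i k 1] by (simp only: pcompose_1 one_pCons[symmetric])
    have "shift i k svar = svar - of_int i" using shift_svar_mult[of i k 1] one by simp
    then show ?thesis using shift_const[of i k "[:d:]"] by (simp add: cst_def of_int_poly)
  qed
qed (rule shift_const)

lemmas poly_act_rules = linear_rules[OF poly_act_linear1] poly_act_single

lemma weight_act_zero: "weight_act l c P Q x 0 = 0"
  by (cases x) simp_all

lemma gen_bracket_weight_act: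
  "poly_act (gen_bracket x y) g = weight_act l c P Q x (weight_act l c P Q y g) - weight_act l c P Q y (weight_act l c P Q x g)"
proof -
  let ?W = "weight_act l c P Q"
  let ?comm = "\<lambda>x y. poly_act (gen_bracket x y) g = ?W x (?W y g) - ?W y (?W x g)"
  have PQ: "[:P:] * [:pcompose Q [:-2, 1:]:] - [:Q:] * [:pcompose P [:2, 1:]:] = tvar"
    using sl2 by (simp add: sl2_pair_def tvar_def mult.commute)
  have ef: "?comm (E i) (F j)" for i j
    unfolding weight_act_commutator
    by (simp add: factor_shift PQ bas_def poly_act_rules cst_simps del: mult_pCons_left mult_pCons_right)
  have cen: "poly_act (gen_bracket x Cen) g = 0" "poly_act (gen_bracket Cen x) g = 0" for x
    by (cases x; simp add: poly_act_rules)+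
  have anti: ?thesis if "?comm y x"
    unfolding gen_bracket_antisym[of x y] by (simp only: that poly_act_rules minus_diff_eq)
  have hh: "?comm (H i) (H j)" for i j
    unfolding weight_act_commutator by (simp add: factor_shift poly_act_rules bas_def)
  have he: "?comm (H i) (E j)" for i j
    unfolding weight_act_commutator by (simp add: factor_shift bas_def poly_act_rules algebra_simps cst_simps(3) del: shift_add mult_pCons_left mult_pCons_right)
  have hf: "?comm (H i) (F j)" for i j
    unfolding weight_act_commutator by (simp add: factor_shift bas_def poly_act_rules algebra_simps cst_simps(3) del: shift_add mult_pCons_left mult_pCons_right)
  have dh: "?comm (D i) (H j)" for i j
    unfolding weight_act_commutator by (simp add: factor_shift bas_def poly_act_rules algebra_simps cst_simps(3) del: shift_add mult_pCons_left mult_pCons_right)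
  have de: "?comm (D i) (E j)" for i j
    unfolding weight_act_commutator by (simp add: factor_shift bas_def poly_act_rules algebra_simps cst_simps(3) del: shift_add mult_pCons_left mult_pCons_right)
  have df: "?comm (D i) (F j)" for i j
    unfolding weight_act_commutator by (simp add: factor_shift bas_def poly_act_rules algebra_simps cst_simps(3) del: shift_add mult_pCons_left mult_pCons_right)
  have dd: "?comm (D i) (D j)" for i j
    unfolding weight_act_commutator factor.simps index.simps tstep.simps factor_shift by (simp add: bas_def poly_act_rules algebra_simps cst_simps del: shift_add mult_pCons_left mult_pCons_right)
  have same: "?comm (E i) (E j)"
    "?comm (F i) (F j)" for i j
    unfolding weight_act_commutator by (simp_all add: factor_shift poly_act_rules)
  show ?thesis
    by (cases x; cases y)
       (use hh he hf dh de df dd ef same cen anti in \<open>simp_all only: weight_act.simps(5) poly_act_linear2 weight_act_zero diff_self\<close>)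
qed

lemma poly_act_bracket: "poly_act (bracket x y) g = poly_act x (poly_act y g) - poly_act y (poly_act x g)"
proof -
  let ?sc = "\<lambda>c p. cst c * p"
  have lin: "Vector_Spaces.linear scale ?sc f"
    if "\<And>x y. f (x + y) = f x + f y" "\<And>c x. f (scale c x) = cst c * f x" for f :: "affvir \<Rightarrow> complex poly poly"
    using that by (simp add: linear_iff_module_hom module_hom_iff vs_scale vs_cst pm.module_axioms module_iff_vector_space)
  note rules = poly_act_rules poly_act_linear2 weight_act_linear
  have diff: "poly_act x (g - h) = poly_act x g - poly_act x h" for x g h
    using poly_act_linear2(1)[of x "g - h" h] by simp
  have 1: "poly_act (bracket (bas a) y) g = poly_act (bas a) (poly_act y g) - poly_act y (poly_act (bas a) g)" for a
    by (rule linear_eq_on_basis[of ?sc "\<lambda>y. poly_act (bracket (bas a) y) g"])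
       (auto intro!: lin simp: rules diff gen_bracket_weight_act bas_def right_diff_distrib cst_simps)
  show ?thesis
    by (rule linear_eq_on_basis[of ?sc "\<lambda>x. poly_act (bracket x y) g"])
       (use 1 in \<open>auto intro!: lin simp: rules diff bas_def right_diff_distrib cst_simps\<close>)
qed

lemma poly_module_simps [simp]:
  "carrier (poly_module (weight_act l c P Q)) = UNIV"
  "\<zero>\<^bsub>poly_module (weight_act l c P Q)\<^esub> = 0"
  "g \<oplus>\<^bsub>poly_module (weight_act l c P Q)\<^esub> h = g + h"
  "k \<odot>\<^bsub>poly_module (weight_act l c P Q)\<^esub> g = cst k * g"
  "x \<rhd>\<^bsub>poly_module (weight_act l c P Q)\<^esub> g = poly_act x g"
  by (simp_all add: poly_module_def poly_act_def)

lemma poly_module_abelian_group: "abelian_group (poly_module (weight_act l c P Q))"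
proof (rule abelian_groupI)
  show "\<exists>y\<in>carrier (poly_module (weight_act l c P Q)). y \<oplus>\<^bsub>poly_module (weight_act l c P Q)\<^esub> x
      = \<zero>\<^bsub>poly_module (weight_act l c P Q)\<^esub>" for x
    by (rule bexI[of _ "- x"]) simp_all
qed (simp_all add: add_ac)

lemma poly_module_affvir_module: "affvir_module (poly_module (weight_act l c P Q))"
proof (intro affvir_module.intro affvir_module_axioms.intro moduleI complex_field_cring poly_module_abelian_group)
  interpret abelian_group "poly_module (weight_act l c P Q)" by (rule poly_module_abelian_group)
  have neg: "\<ominus>\<^bsub>poly_module (weight_act l c P Q)\<^esub> g = - g" for g
    by (rule minus_equality) simp_all
  show "bracket x y \<rhd>\<^bsub>poly_module (weight_act l c P Q)\<^esub> v =
      x \<rhd>\<^bsub>poly_module (weight_act l c P Q)\<^esub> (y \<rhd>\<^bsub>poly_module (weight_act l c P Q)\<^esub> v) \<ominus>\<^bsub>poly_module (weight_act l c P Q)\<^esub>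
      y \<rhd>\<^bsub>poly_module (weight_act l c P Q)\<^esub> (x \<rhd>\<^bsub>poly_module (weight_act l c P Q)\<^esub> v)" for x y v
    by (simp add: minus_eq neg poly_act_bracket)
qed (simp_all add: cst_simps distrib_left distrib_right mult.assoc poly_act_rules poly_act_linear2)

end

section \<open>Irreducibility of the tensor product\<close>

lemma coeff_degrees_bounded:
  fixes g :: "'k \<Rightarrow> complex poly poly"
  assumes "finite K"
  shows "\<exists>m. \<forall>k\<in>K. \<forall>a. degree (coeff (g k) a) \<le> m"
proof -
  have one: "\<exists>m. \<forall>a. degree (coeff h a) \<le> m" for h :: "complex poly poly"
  proof -
    have "degree (coeff h a) \<le> Max ((\<lambda>a. degree (coeff h a)) ` {..degree h})" for a
      by (cases "a \<le> degree h") (auto intro: Max_ge simp: coeff_eq_0)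
    then show ?thesis by blast
  qed
  have "\<forall>h :: complex poly poly. \<exists>m. \<forall>a. degree (coeff h a) \<le> m" using one by blast
  from choice[OF this] obtain f where f: "\<And>(h :: complex poly poly) a. degree (coeff h a) \<le> f h" by blast
  have "degree (coeff (g k) a) \<le> Max ((\<lambda>k. f (g k)) ` K)" if "k \<in> K" for k a
    by (rule order_trans[OF f Max_ge]) (use that assms in auto)
  then show ?thesis by blast
qed

definition st_monom :: "nat \<Rightarrow> nat \<Rightarrow> complex poly poly" where
  "st_monom a b = monom (monom 1 b) a"

lemma poly2_expand:
  assumes "degree g \<le> n" "\<And>a. degree (coeff g a) \<le> m"
  shows "g = (\<Sum>(a, b)\<in>{..n} \<times> {..m}. cst (coeff (coeff g a) b) * st_monom a b)"
proof -
  have m: "cst k * st_monom a b = monom (monom k b) a" for k a b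
    by (simp add: cst_mult st_monom_def smult_monom)
  have "g = (\<Sum>a\<le>n. monom (coeff g a) a)"
    using poly_as_sum_of_monoms'[OF assms(1)] by simp
  also have "\<dots> = (\<Sum>a\<le>n. \<Sum>b\<le>m. monom (monom (coeff (coeff g a) b) b) a)"
  proof (intro sum.cong refl)
    fix a
    have "coeff g a = (\<Sum>b\<le>m. monom (coeff (coeff g a) b) b)"
      using poly_as_sum_of_monoms'[OF assms(2)] by simp
    then have "monom (coeff g a) a = monom (\<Sum>b\<le>m. monom (coeff (coeff g a) b) b) a" by simp
    also have "\<dots> = (\<Sum>b\<le>m. monom (monom (coeff (coeff g a) b) b) a)"
      by (induction m) (simp_all flip: add_monom)
    finally show "monom (coeff g a) a = (\<Sum>b\<le>m. monom (monom (coeff (coeff g a) b) b) a)" .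
  qed
  also have "\<dots> = (\<Sum>(a, b)\<in>{..n} \<times> {..m}. cst (coeff (coeff g a) b) * st_monom a b)"
    by (simp add: m sum.cartesian_product)
  finally show ?thesis .
qed

locale irreducibility = weight_module l c P Q + highest_weight \<eta> \<epsilon> \<theta>
  for l c :: complex and P Q :: "complex poly" and \<eta> \<epsilon> \<theta> :: complex +
  assumes lowering: "degree_lowering P Q"
begin

sublocale T: tensor_product "poly_module (weight_act l c P Q)" "irr_hw_module \<eta> \<epsilon> \<theta>"
  by (intro tensor_product.intro poly_module_affvir_module hw.affvir_module)

definition tens :: "complex poly poly \<Rightarrow> tensor_alg \<Rightarrow> complex poly poly \<times> tensor_alg set set set \<Rightarrow>\<^sub>0 complex" where
  "tens g p = T.pure g (hw_class p)"

text \<open>Equality in the tensor product, stated for representatives.\<close>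

definition equiv_mod (infix \<open>\<approx>\<close> 50) where
  "z \<approx> w \<longleftrightarrow> z - w \<in> T.bilin"

lemma equiv_refl [simp]: "z \<approx> z"
  by (simp add: equiv_mod_def pm.subspace_0[OF T.bilin_subspace])

lemma equiv_sym: "z \<approx> w \<Longrightarrow> w \<approx> z"
  using pm.subspace_neg[OF T.bilin_subspace, of "z - w"] by (simp add: equiv_mod_def)

lemma equiv_trans [trans]: "z \<approx> w \<Longrightarrow> w \<approx> x \<Longrightarrow> z \<approx> x"
  using pm.subspace_add[OF T.bilin_subspace, of "z - w" "w - x"] by (simp add: equiv_mod_def)

lemma equiv_add: "z \<approx> w \<Longrightarrow> z' \<approx> w' \<Longrightarrow> z + z' \<approx> w + w'"
  using pm.subspace_add[OF T.bilin_subspace, of "z - w" "z' - w'"] by (simp add: equiv_mod_def algebra_simps)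

lemma equiv_sum: "(\<And>i. i \<in> I \<Longrightarrow> f i \<approx> h i) \<Longrightarrow> (\<Sum>i\<in>I. f i) \<approx> (\<Sum>i\<in>I. h i)"
proof -
  assume "\<And>i. i \<in> I \<Longrightarrow> f i \<approx> h i"
  then have "(\<Sum>i\<in>I. f i - h i) \<in> T.bilin"
    by (intro pm.subspace_sum[OF T.bilin_subspace]) (simp add: equiv_mod_def)
  then show ?thesis by (simp add: equiv_mod_def sum_subtractf)
qed

lemma hw_class_simps:
  "hw_class (p + q) = hw_class p \<oplus>\<^bsub>irr_hw_module \<eta> \<epsilon> \<theta>\<^esub> hw_class q"
  "hw_class (scale k p) = k \<odot>\<^bsub>irr_hw_module \<eta> \<epsilon> \<theta>\<^esub> hw_class p"
  "hw_class p \<in> carrier (irr_hw_module \<eta> \<epsilon> \<theta>)"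
  by (simp_all add: hw.add hw.scale hw.carrier)

lemma tens_add_left: "tens (g + h) p \<approx> tens g p + tens h p"
  using T.bilin_rules(1)[of g "hw_class p" h] hw_class_simps(3)
  by (simp add: equiv_mod_def tens_def diff_diff_eq)

lemma tens_add_right: "tens g (p + q) \<approx> tens g p + tens g q"
  using T.bilin_rules(2)[of g "hw_class p" "hw_class q"] hw_class_simps(3)
  by (simp add: equiv_mod_def tens_def hw_class_simps diff_diff_eq)

lemma tens_scale_left: "tens (cst k * g) p \<approx> scale k (tens g p)"
  using T.bilin_rules(3)[of g "hw_class p" k] hw_class_simps(3)
  by (simp add: equiv_mod_def tens_def)

lemma tens_scale_right: "tens g (scale k p) \<approx> scale k (tens g p)"
  using T.bilin_rules(4)[of g "hw_class p" k] hw_class_simps(3)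
  by (simp add: equiv_mod_def tens_def hw_class_simps)

lemma tens_zero:
  assumes "p \<in> max_left"
  shows "tens g p \<approx> 0"
proof -
  have "hw_class p = hw_class (scale 0 p)"
    using assms by (simp add: hw.eq_iff hw_ker)
  then show ?thesis using tens_scale_right[of g 0 p] by (simp add: tens_def)
qed

lemma tens_zero_left: "tens 0 p \<approx> 0"
  using tens_scale_left[of 0 0 p] by simp

lemma tens_sum_left: "tens (\<Sum>i\<in>I. f i) p \<approx> (\<Sum>i\<in>I. tens (f i) p)"
proof (induction I rule: infinite_finite_induct)
  case (insert x F)
  then show ?case
    using equiv_trans[OF tens_add_left equiv_add[OF equiv_refl insert.IH]] by simp
qed (simp_all add: tens_zero_left)

lemma zero_max_left: "0 \<in> max_left"
  using max_left_ideal by (simp add: left_ideal_T_def pm.subspace_0)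

lemma max_left_subspace: "pm.subspace max_left"
  using max_left_ideal by (simp add: left_ideal_T_def)

lemma tens_sum_right: "tens g (\<Sum>i\<in>I. f i) \<approx> (\<Sum>i\<in>I. tens g (f i))"
proof (induction I rule: infinite_finite_induct)
  case (insert x F)
  then show ?case
    using equiv_trans[OF tens_add_right equiv_add[OF equiv_refl insert.IH]] by simp
qed (simp_all add: tens_zero zero_max_left)

lemma tens_act: "T.act x (tens g p) = tens (poly_act x g) p + tens g (left_act x p)"
  by (simp add: tens_def hw.lact)

lemma tens_free_space: "tens g p \<in> T.free_space"
  unfolding tens_def by (rule T.pure_in_free_space) (simp_all add: hw_class_simps)

definition family :: "'k set \<Rightarrow> ('k \<Rightarrow> complex poly poly) \<Rightarrow> ('k \<Rightarrow> tensor_alg) \<Rightarrow> complex poly poly \<times> tensor_alg set set set \<Rightarrow>\<^sub>0 complex" where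
  "family K g v = (\<Sum>k\<in>K. tens (g k) (v k))"

text \<open>The component in \<open>V\<close> of a family at the monomial \<open>s\<^sup>a t\<^sup>b\<close>, as a representative in the tensor algebra.\<close>

definition coeff_sum :: "'k set \<Rightarrow> ('k \<Rightarrow> complex poly poly) \<Rightarrow> ('k \<Rightarrow> tensor_alg) \<Rightarrow> nat \<Rightarrow> nat \<Rightarrow> tensor_alg" where
  "coeff_sum K g v a b = (\<Sum>k\<in>K. scale (coeff (coeff (g k) a) b) (v k))"

lemma family_expand:
  assumes "\<And>k. k \<in> K \<Longrightarrow> degree (g k) \<le> n" "\<And>k a. k \<in> K \<Longrightarrow> degree (coeff (g k) a) \<le> m"
  shows "family K g v \<approx> (\<Sum>(a, b)\<in>{..n} \<times> {..m}. tens (st_monom a b) (coeff_sum K g v a b))"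
proof -
  let ?I = "{..n} \<times> {..m}"
  let ?c = "\<lambda>k a b. coeff (coeff (g k) a) b"
  have 1: "tens (g k) (v k) \<approx> (\<Sum>(a, b)\<in>?I. scale (?c k a b) (tens (st_monom a b) (v k)))" if "k \<in> K" for k
  proof -
    have "tens (g k) (v k) = tens (\<Sum>(a, b)\<in>?I. cst (?c k a b) * st_monom a b) (v k)"
      using poly2_expand[OF assms(1)[OF that] assms(2)[OF that]] by (rule arg_cong)
    also have "\<dots> \<approx> (\<Sum>x\<in>?I. tens (case x of (a, b) \<Rightarrow> cst (?c k a b) * st_monom a b) (v k))"
      by (rule tens_sum_left)
    also have "\<dots> \<approx> (\<Sum>(a, b)\<in>?I. scale (?c k a b) (tens (st_monom a b) (v k)))"
      by (rule equiv_sum) (auto intro: tens_scale_left)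
    finally show ?thesis .
  qed
  have 2: "tens (st_monom a b) (coeff_sum K g v a b) \<approx> (\<Sum>k\<in>K. scale (?c k a b) (tens (st_monom a b) (v k)))" for a b
    unfolding coeff_sum_def
    by (rule equiv_trans[OF tens_sum_right]) (auto intro: equiv_sum tens_scale_right)
  have "family K g v \<approx> (\<Sum>k\<in>K. \<Sum>(a, b)\<in>?I. scale (?c k a b) (tens (st_monom a b) (v k)))"
    unfolding family_def by (rule equiv_sum) (rule 1)
  also have "\<dots> = (\<Sum>(a, b)\<in>?I. \<Sum>k\<in>K. scale (?c k a b) (tens (st_monom a b) (v k)))"
    by (subst sum.swap) (simp add: case_prod_unfold)
  also have "\<dots> \<approx> (\<Sum>(a, b)\<in>?I. tens (st_monom a b) (coeff_sum K g v a b))"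
    by (rule equiv_sum) (auto intro: equiv_sym[OF 2])
  finally show ?thesis .
qed

lemma family_restrict:
  assumes "finite I" "J \<subseteq> I" "\<And>i. i \<in> I - J \<Longrightarrow> u i \<in> max_left"
  shows "family I s u \<approx> family J s u"
proof -
  have "family I s u = family (I - J) s u + family J s u"
    unfolding family_def by (rule sum.subset_diff[OF assms(2,1)])
  also have "\<dots> \<approx> 0 + family J s u"
  proof (rule equiv_add[OF _ equiv_refl])
    have "(\<Sum>k\<in>I - J. tens (s k) (u k)) \<approx> (\<Sum>k\<in>I - J. 0)"
      by (rule equiv_sum) (auto intro: tens_zero assms(3))
    then show "family (I - J) s u \<approx> 0" by (simp add: family_def)
  qed
  finally show ?thesis by simp
qed

lemma hw_class_surj: "A \<in> carrier (irr_hw_module \<eta> \<epsilon> \<theta>) \<Longrightarrow> \<exists>p. A = hw_class p"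
  by (auto simp: hw.carrier)

lemma free_space_family:
  assumes "z \<in> T.free_space"
  shows "\<exists>K g v. finite (K :: (complex poly poly \<times> tensor_alg set set set) set) \<and> z \<approx> family K g v"
proof -
  define r where "r = (\<lambda>A. SOME p. A = hw_class p)"
  have r: "hw_class (r A) = A" if "A \<in> carrier (irr_hw_module \<eta> \<epsilon> \<theta>)" for A
    using someI_ex[OF hw_class_surj[OF that]] by (simp add: r_def)
  let ?K = "Poly_Mapping.keys z" and ?c = "Poly_Mapping.lookup z"
  have "z = (\<Sum>k\<in>?K. scale (?c k) (Poly_Mapping.single k 1))" by (rule sum_scale_single)
  also have "\<dots> = (\<Sum>k\<in>?K. scale (?c k) (tens (fst k) (r (snd k))))"
    using assms by (intro sum.cong refl) (auto simp: T.free_space_def tens_def r)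
  also have "\<dots> \<approx> (\<Sum>k\<in>?K. tens (fst k) (scale (?c k) (r (snd k))))"
    by (rule equiv_sum) (rule equiv_sym[OF tens_scale_right])
  finally have "z \<approx> family ?K fst (\<lambda>k. scale (?c k) (r (snd k)))" by (simp add: family_def)
  then show ?thesis using finite_keys by blast
qed

end

locale stable_subspace = irreducibility l c P Q \<eta> \<epsilon> \<theta>
  for l c :: complex and P Q :: "complex poly" and \<eta> \<epsilon> \<theta> :: complex +
  fixes W :: "(complex poly poly \<times> tensor_alg set set set \<Rightarrow>\<^sub>0 complex) set"
  assumes W: "pm.subspace W" "T.bilin \<subseteq> W" "\<And>x z. z \<in> W \<Longrightarrow> T.act x z \<in> W"
begin

lemma W_cong: "z \<approx> w \<Longrightarrow> z \<in> W \<longleftrightarrow> w \<in> W"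
  using W(2) by (intro in_subspace_cong[OF W(1)]) (auto simp: equiv_mod_def)

lemma family_add:
  assumes "family K g v \<in> W" "family K h v \<in> W"
  shows "family K (\<lambda>k. g k + h k) v \<in> W"
proof -
  have "family K (\<lambda>k. g k + h k) v \<approx> (\<Sum>k\<in>K. tens (g k) (v k) + tens (h k) (v k))"
    unfolding family_def by (rule equiv_sum) (rule tens_add_left)
  also have "\<dots> = family K g v + family K h v" by (simp add: family_def sum.distrib)
  finally show ?thesis using W_cong pm.subspace_add[OF W(1) assms] by blast
qed

lemma family_scale:
  assumes "family K g v \<in> W"
  shows "family K (\<lambda>k. cst a * g k) v \<in> W"
proof -
  have "family K (\<lambda>k. cst a * g k) v \<approx> (\<Sum>k\<in>K. scale a (tens (g k) (v k)))"
    unfolding family_def by (rule equiv_sum) (rule tens_scale_left)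
  also have "\<dots> = scale a (family K g v)" by (simp add: family_def pm.scale_sum_right)
  finally show ?thesis using W_cong pm.subspace_scale[OF W(1) assms] by blast
qed

text \<open>For large \<open>i\<close> the second summand of \<open>x (g \<otimes> v) = x g \<otimes> v + g \<otimes> x v\<close> vanishes for the finitely many
  \<open>v\<close> that occur.\<close>

lemma family_loop_action:
  assumes "finite K" "family K g v \<in> W"
  shows "\<exists>N. \<forall>i\<ge>N. \<forall>x\<in>loop_gens i. family K (\<lambda>k. weight_act l c P Q x (g k)) v \<in> W"
proof -
  have "\<forall>k. \<exists>N. \<forall>i\<ge>N. \<forall>x\<in>loop_gens i. letter x * v k \<in> verma_left"
    using eventually_annihilated by blast
  from choice[OF this] obtain N
    where N: "\<And>k i x. i \<ge> N k \<Longrightarrow> x \<in> loop_gens i \<Longrightarrow> letter x * v k \<in> verma_left" by blast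
  have "family K (\<lambda>k. weight_act l c P Q x (g k)) v \<in> W" if i: "i \<ge> Max (insert 0 (N ` K))" and x: "x \<in> loop_gens i" for i x
  proof -
    have "T.act (bas x) (family K g v) = (\<Sum>k\<in>K. tens (weight_act l c P Q x (g k)) (v k) + tens (g k) (letter x * v k))"
      by (simp add: family_def tens_act left_act_def emb_bas bas_def poly_act_single cst_simps emb_single)
    also have "\<dots> \<approx> (\<Sum>k\<in>K. tens (weight_act l c P Q x (g k)) (v k) + 0)"
    proof (intro equiv_sum equiv_add equiv_refl tens_zero)
      fix k assume "k \<in> K"
      then have "N k \<le> i" using i assms(1) by simp
      then show "letter x * v k \<in> max_left" using N x verma_left_max_left by blast
    qed
    also have "\<dots> = family K (\<lambda>k. weight_act l c P Q x (g k)) v" by (simp add: family_def)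
    finally show ?thesis using W_cong W(3)[OF assms(2)] by blast
  qed
  then show ?thesis by blast
qed

lemma family_loop_action_normalized:
  assumes "finite K" "family K g v \<in> W"
  shows "\<exists>N. \<forall>i\<ge>N. family K (\<lambda>k. tvar * shift i 0 (g k)) v \<in> W
     \<and> family K (\<lambda>k. (svar + cst (of_int i * c)) * shift i 0 (g k)) v \<in> W
     \<and> family K (\<lambda>k. [:P:] * shift i 2 (g k)) v \<in> W
     \<and> family K (\<lambda>k. [:Q:] * shift i (-2) (g k)) v \<in> W"
proof -
  obtain N where N: "\<And>i x. i \<ge> N \<Longrightarrow> x \<in> loop_gens i \<Longrightarrow> family K (\<lambda>k. weight_act l c P Q x (g k)) v \<in> W"
    using family_loop_action[OF assms] by blast
  have unit: "cst (inverse (l powi i)) * (cst (l powi i) * h) = h" for i h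
    using l by (simp flip: mult.assoc cst_simps(2)) (simp add: cst_simps)
  have "family K (\<lambda>k. tvar * shift i 0 (g k)) v \<in> W
     \<and> family K (\<lambda>k. (svar + cst (of_int i * c)) * shift i 0 (g k)) v \<in> W
     \<and> family K (\<lambda>k. [:P:] * shift i 2 (g k)) v \<in> W
     \<and> family K (\<lambda>k. [:Q:] * shift i (-2) (g k)) v \<in> W" if "i \<ge> N" for i
    using family_scale[OF N[OF that, of "H i"], of "inverse (l powi i)"]
      family_scale[OF N[OF that, of "D i"], of "inverse (l powi i)"]
      family_scale[OF N[OF that, of "E i"], of "inverse (l powi i)"]
      family_scale[OF N[OF that, of "F i"], of "inverse (l powi i)"]
    by (simp only: weight_act.simps unit) (simp add: loop_gens_def)
  then show ?thesis by blast
qed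

lemma family_t_mult:
  assumes "finite K" "family K (\<lambda>k. [:q k:]) v \<in> W"
  shows "family K (\<lambda>k. [:[:0, 1:] * q k:]) v \<in> W"
  using family_loop_action_normalized[OF assms] by (auto simp: shift_const tvar_def)

lemma family_t_poly_mult:
  assumes "finite K" "family K (\<lambda>k. [:q k:]) v \<in> W"
  shows "family K (\<lambda>k. [:A * q k:]) v \<in> W"
proof (induction A)
  case 0
  show ?case using family_scale[OF assms(2), of 0] by (simp add: cst_simps)
next
  case (pCons a A)
  have "family K (\<lambda>k. cst a * [:q k:] + [:[:0, 1:] * (A * q k):]) v \<in> W"
    by (intro family_add family_scale assms family_t_mult pCons.IH)
  moreover have "cst a * [:q k:] + [:[:0, 1:] * (A * q k):] = [:pCons a A * q k:]" for k
    by (simp add: cst_def)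
  ultimately show ?case by (simp only:)
qed

text \<open>Some element of \<open>W\<close> has degree at most \<open>n\<close> in \<open>s\<close> and a nonzero coefficient at \<open>s\<^sup>n\<close>; the
  predicate \<open>t_leading\<close> is the analogue for \<open>t\<close> among the elements free of \<open>s\<close>. Membership in \<open>max_left\<close>
  means that a coefficient vanishes in \<open>V\<close>.\<close>

definition s_leading :: "nat \<Rightarrow> bool" where
  "s_leading n \<longleftrightarrow> (\<exists>(K :: (nat \<times> nat) set) g v. finite K \<and> family K g v \<in> W \<and> (\<forall>k\<in>K. degree (g k) \<le> n)
     \<and> (\<exists>b. coeff_sum K g v n b \<notin> max_left))"

definition t_leading :: "nat \<Rightarrow> bool" where
  "t_leading m \<longleftrightarrow> (\<exists>(K :: nat set) q v. finite K \<and> family K (\<lambda>k. [:q k:]) v \<in> W \<and> (\<forall>k\<in>K. degree (q k) \<le> m)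
     \<and> (\<Sum>k\<in>K. scale (coeff (q k) m) (v k)) \<notin> max_left)"

text \<open>A nonzero element has a nonzero coefficient. The terms above the largest power of \<open>s\<close> with this
  property are zero in the tensor product and may be dropped.\<close>

lemma nontrivial_s_leading:
  assumes "z \<in> W" "z \<in> T.free_space" "z \<notin> T.bilin"
  shows "\<exists>n. s_leading n"
proof -
  obtain K :: "(complex poly poly \<times> tensor_alg set set set) set" and g v where
    K: "finite K" "z \<approx> family K g v" using free_space_family[OF assms(2)] by blast
  obtain m where m: "\<And>k a. k \<in> K \<Longrightarrow> degree (coeff (g k) a) \<le> m"
    using coeff_degrees_bounded[OF K(1), of g] by blast
  define N where "N = Max (insert 0 (degree ` g ` K))"
  have N: "degree (g k) \<le> N" if "k \<in> K" for k
    unfolding N_def using that K(1) by (intro Max_ge) auto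
  define u where "u = (\<lambda>(a, b). coeff_sum K g v a b)"
  define s where "s = (\<lambda>(a, b). st_monom a b)"
  let ?I = "{..N} \<times> {..m}"
  have z: "z \<approx> family ?I s u"
    using equiv_trans[OF K(2) family_expand[of K g N m v]] N m
    by (simp add: family_def u_def s_def case_prod_unfold)
  have ex: "\<exists>a b. a \<le> N \<and> b \<le> m \<and> u (a, b) \<notin> max_left"
  proof (rule ccontr)
    assume "\<not> ?thesis"
    then have "family ?I s u \<approx> family {} s u" by (intro family_restrict) auto
    from equiv_trans[OF z this] have "z \<approx> 0" by (simp add: family_def)
    then show False using assms(3) by (simp add: equiv_mod_def)
  qed
  define A where "A = {a. a \<le> N \<and> (\<exists>b\<le>m. u (a, b) \<notin> max_left)}"
  have A: "finite A" "A \<noteq> {}" using ex by (auto simp: A_def)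
  define n where "n = Max A"
  have "n \<in> A" using A Max_in by (simp add: n_def)
  then obtain b where b: "n \<le> N" "b \<le> m" "u (n, b) \<notin> max_left" by (auto simp: A_def)
  have top: "u (a, b) \<in> max_left" if "a \<le> N" "b \<le> m" "a > n" for a b
  proof (rule ccontr)
    assume "u (a, b) \<notin> max_left"
    then have "a \<in> A" using that by (auto simp: A_def)
    then show False using Max_ge[OF A(1), of a] that(3) by (simp add: n_def)
  qed
  let ?J = "{..n} \<times> {..m}"
  have "family ?I s u \<approx> family ?J s u"
  proof (rule family_restrict)
    show "u k \<in> max_left" if "k \<in> ?I - ?J" for k
      using that top[of "fst k" "snd k"] by (cases k) (auto simp: not_le)
  qed (use b(1) in auto)
  with z have "z \<approx> family ?J s u" by (rule equiv_trans)
  from W_cong[OF this] have J: "family ?J s u \<in> W" using assms(1) by simp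
  have deg: "\<forall>k\<in>?J. degree (s k) \<le> n"
  proof
    fix k assume "k \<in> ?J"
    moreover have "degree (st_monom a b) \<le> a" for a b by (simp add: st_monom_def degree_monom_le)
    ultimately show "degree (s k) \<le> n" by (cases k) (auto simp: s_def intro: order_trans)
  qed
  have "coeff_sum ?J s u n b = (\<Sum>k\<in>?J. if k = (n, b) then u (n, b) else 0)"
    unfolding coeff_sum_def
  proof (intro sum.cong refl)
    fix k :: "nat \<times> nat"
    obtain a b' where k: "k = (a, b')" by fastforce
    show "scale (coeff (coeff (s k) n) b) (u k) = (if k = (n, b) then u (n, b) else 0)"
      by (cases "a = n"; cases "b' = b") (simp_all add: k s_def st_monom_def)
  qed
  also have "\<dots> = u (n, b)" by (subst sum.delta) (use b in auto)
  finally have "coeff_sum ?J s u n b = u (n, b)" .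
  then have "coeff_sum ?J s u n b \<notin> max_left" by (simp only: b not_False_eq_True)
  then have nz: "\<exists>b. coeff_sum ?J s u n b \<notin> max_left" by (rule exI)
  have "s_leading n"
    unfolding s_leading_def
    by (rule exI[of _ ?J], rule exI[of _ s], rule exI[of _ u]) (intro conjI J deg nz, simp)
  then show ?thesis ..
qed

text \<open>The elements \<open>H i\<close> and \<open>H (i + 1)\<close>, freed of their scalars, differ by \<open>t\<close> times a difference operator
  in \<open>s\<close> with step \<open>1\<close>, which multiplies the leading coefficient by the degree.\<close>

lemma s_leading_descent:
  assumes "s_leading (Suc n)"
  shows "s_leading n"
proof -
  obtain K :: "(nat \<times> nat) set" and g v b where K: "finite K" "family K g v \<in> W"
    and deg: "\<And>k. k \<in> K \<Longrightarrow> degree (g k) \<le> Suc n" and b: "coeff_sum K g v (Suc n) b \<notin> max_left"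
    using assms unfolding s_leading_def by blast
  obtain i where i: "family K (\<lambda>k. tvar * shift i 0 (g k)) v \<in> W"
      "family K (\<lambda>k. tvar * shift (i + 1) 0 (g k)) v \<in> W"
    using family_loop_action_normalized[OF K] by (metis le_add_same_cancel1 order_refl zero_le_one)
  define h where "h = (\<lambda>k. tvar * (shift i 0 (g k) - shift (i + 1) 0 (g k)))"
  have "family K (\<lambda>k. tvar * shift i 0 (g k) + cst (-1) * (tvar * shift (i + 1) 0 (g k))) v \<in> W"
    by (intro family_add family_scale i)
  then have h: "family K h v \<in> W" by (simp add: h_def cst_simps right_diff_distrib)
  have shift0: "shift j 0 f = pcompose f [:- of_int j, 1:]" for j and f :: "complex poly poly"
    by (simp add: shift_def map_poly_idI)
  have t: "coeff (tvar * f) a = [:0, 1:] * coeff f a" for f a by (simp add: tvar_def)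
  have hdeg: "degree (h k) \<le> n" and hcoeff: "coeff (h k) n = [:0, 1:] * (of_nat (Suc n) * coeff (g k) (Suc n))"
    if "k \<in> K" for k
  proof -
    note top = coeff_pcompose_top[OF deg[OF that]]
    show "degree (h k) \<le> n"
    proof (intro degree_le allI impI)
      fix a assume "a > n"
      then consider "a = Suc n" | "a > Suc n" by linarith
      then show "coeff (h k) a = 0"
        by cases (simp_all add: h_def t shift0 top(1,2) del: mult_pCons_left)
    qed
    show "coeff (h k) n = [:0, 1:] * (of_nat (Suc n) * coeff (g k) (Suc n))"
      unfolding h_def t coeff_diff shift0 top(3)[OF refl] by (simp add: algebra_simps del: mult_pCons_left)
  qed
  have "coeff_sum K h v n (Suc b) = (\<Sum>k\<in>K. scale (of_nat (Suc n)) (scale (coeff (coeff (g k) (Suc n)) b) (v k)))"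
    unfolding coeff_sum_def by (intro sum.cong refl) (simp add: hcoeff of_nat_poly del: of_nat_Suc)
  also have "\<dots> = scale (of_nat (Suc n)) (coeff_sum K g v (Suc n) b)"
    by (simp only: coeff_sum_def pm.scale_sum_right)
  finally have eq: "coeff_sum K h v n (Suc b) = scale (of_nat (Suc n)) (coeff_sum K g v (Suc n) b)" .
  have "coeff_sum K h v n (Suc b) \<notin> max_left"
  proof
    assume "coeff_sum K h v n (Suc b) \<in> max_left"
    then have "scale (inverse (of_nat (Suc n))) (scale (of_nat (Suc n)) (coeff_sum K g v (Suc n) b)) \<in> max_left"
      unfolding eq by (rule pm.subspace_scale[OF max_left_subspace])
    then show False using b by (simp del: of_nat_Suc)
  qed
  then show ?thesis unfolding s_leading_def using K(1) h hdeg by blast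
qed

lemma s_leading_t_leading:
  assumes "s_leading 0"
  shows "\<exists>m. t_leading m"
proof -
  obtain K :: "(nat \<times> nat) set" and g v b0 where K: "finite K" "family K g v \<in> W"
    and deg: "\<And>k. k \<in> K \<Longrightarrow> degree (g k) \<le> 0" and b0: "coeff_sum K g v 0 b0 \<notin> max_left"
    using assms unfolding s_leading_def by blast
  obtain m where m: "\<And>k a. k \<in> K \<Longrightarrow> degree (coeff (g k) a) \<le> m"
    using coeff_degrees_bounded[OF K(1), of g] by blast
  define u where "u = coeff_sum K g v 0"
  define s :: "nat \<Rightarrow> complex poly poly" where "s = (\<lambda>b. [:monom 1 b:])"
  have "family K g v \<approx> (\<Sum>(a, b)\<in>{..0} \<times> {..m}. tens (st_monom a b) (coeff_sum K g v a b))"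
    by (rule family_expand) (use deg m in auto)
  also have "\<dots> = (\<Sum>b\<le>m. tens (st_monom 0 b) (coeff_sum K g v 0 b))"
    by (simp flip: sum.cartesian_product)
  also have "\<dots> = family {..m} s u"
    by (simp add: family_def s_def u_def st_monom_def monom_0)
  finally have fam: "family K g v \<approx> family {..m} s u" .
  have zero: "u b = 0" if "b > m" for b
    unfolding u_def coeff_sum_def
  proof (intro sum.neutral ballI)
    fix k assume "k \<in> K"
    then have "coeff (coeff (g k) 0) b = 0"
      by (rule coeff_eq_0[OF le_less_trans[OF m that]])
    then show "scale (coeff (coeff (g k) 0) b) (v k) = 0" by simp
  qed
  then have "b0 \<le> m" using b0 zero_max_left by (metis not_le u_def)
  define B where "B = {b. b \<le> m \<and> u b \<notin> max_left}"
  have B: "finite B" "B \<noteq> {}" using b0 \<open>b0 \<le> m\<close> by (auto simp: B_def u_def)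
  define n where "n = Max B"
  have n: "n \<le> m" "u n \<notin> max_left" using Max_in[OF B] by (auto simp: B_def n_def)
  have top: "u b \<in> max_left" if "b \<le> m" "b > n" for b
  proof (rule ccontr)
    assume "u b \<notin> max_left"
    then have "b \<in> B" using that by (auto simp: B_def)
    then show False using Max_ge[OF B(1), of b] that(2) by (simp add: n_def)
  qed
  have "family {..m} s u \<approx> family {..n} s u"
    using n(1) top by (intro family_restrict) auto
  with fam have "family K g v \<approx> family {..n} s u" by (rule equiv_trans)
  then have W: "family {..n} s u \<in> W" using K(2) W_cong by blast
  have "(\<Sum>b\<le>n. scale (coeff (monom 1 b) n) (u b)) = (\<Sum>b\<le>n. if b = n then u n else 0)"
    by (intro sum.cong refl) auto
  also have "\<dots> = u n" by simp
  finally have "(\<Sum>b\<le>n. scale (coeff (monom 1 b) n) (u b)) \<notin> max_left" using n by simp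
  moreover have "\<forall>b\<in>{..n}. degree (monom (1 :: complex) b) \<le> n" by (auto simp: degree_monom_eq)
  ultimately show ?thesis unfolding t_leading_def using W[unfolded s_def]
    by (intro exI[of _ n] exI[of _ "{..n}"] exI[of _ "monom 1"] exI[of _ u]) simp
qed

lemma t_leading_descent:
  assumes "t_leading (Suc m)"
  shows "t_leading m"
proof -
  obtain K :: "nat set" and q v where K: "finite K" "family K (\<lambda>k. [:q k:]) v \<in> W"
    and deg: "\<And>k. k \<in> K \<Longrightarrow> degree (q k) \<le> Suc m"
    and lead: "(\<Sum>k\<in>K. scale (coeff (q k) (Suc m)) (v k)) \<notin> max_left"
    using assms unfolding t_leading_def by blast
  obtain A x y r where r: "r \<noteq> 0" and low: "\<And>q. degree q \<le> Suc m \<Longrightarrow>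
      degree (A * q + smult x (P * pcompose q [:-2, 1:]) + smult y (Q * pcompose q [:2, 1:])) \<le> m \<and>
      coeff (A * q + smult x (P * pcompose q [:-2, 1:]) + smult y (Q * pcompose q [:2, 1:])) m = r * coeff q (Suc m)"
    using lowering unfolding degree_lowering_def Let_def by blast
  define q' where "q' = (\<lambda>k. A * q k + smult x (P * pcompose (q k) [:-2, 1:]) + smult y (Q * pcompose (q k) [:2, 1:]))"
  obtain i where "family K (\<lambda>k. [:P:] * shift i 2 [:q k:]) v \<in> W" "family K (\<lambda>k. [:Q:] * shift i (-2) [:q k:]) v \<in> W"
    using family_loop_action_normalized[OF K] by blast
  then have "family K (\<lambda>k. [:A * q k:] + cst x * ([:P:] * shift i 2 [:q k:]) + cst y * ([:Q:] * shift i (-2) [:q k:])) v \<in> W"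
    by (intro family_add family_scale family_t_poly_mult K)
  moreover have "[:A * q k:] + cst x * ([:P:] * shift i 2 [:q k:]) + cst y * ([:Q:] * shift i (-2) [:q k:]) = [:q' k:]" for k
    by (simp add: q'_def shift_const cst_def mult.commute)
  ultimately have q': "family K (\<lambda>k. [:q' k:]) v \<in> W" by (simp only:)
  have "(\<Sum>k\<in>K. scale (coeff (q' k) m) (v k)) = (\<Sum>k\<in>K. scale r (scale (coeff (q k) (Suc m)) (v k)))"
    using low deg by (intro sum.cong refl) (simp add: q'_def)
  also have "\<dots> = scale r (\<Sum>k\<in>K. scale (coeff (q k) (Suc m)) (v k))"
    by (simp only: pm.scale_sum_right)
  finally have eq: "(\<Sum>k\<in>K. scale (coeff (q' k) m) (v k)) = scale r (\<Sum>k\<in>K. scale (coeff (q k) (Suc m)) (v k))" .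
  have "(\<Sum>k\<in>K. scale (coeff (q' k) m) (v k)) \<notin> max_left"
  proof
    assume "(\<Sum>k\<in>K. scale (coeff (q' k) m) (v k)) \<in> max_left"
    then have "scale (inverse r) (scale r (\<Sum>k\<in>K. scale (coeff (q k) (Suc m)) (v k))) \<in> max_left"
      unfolding eq by (rule pm.subspace_scale[OF max_left_subspace])
    then show False using lead r by simp
  qed
  moreover have "\<forall>k\<in>K. degree (q' k) \<le> m" using low deg by (simp add: q'_def)
  ultimately show ?thesis unfolding t_leading_def using K(1) q' by blast
qed

lemma s_leading_zero: "s_leading n \<Longrightarrow> s_leading 0"
  by (induction n) (blast dest: s_leading_descent)+

lemma t_leading_zero: "t_leading n \<Longrightarrow> t_leading 0"
  by (induction n) (blast dest: t_leading_descent)+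

lemma t_leading_zero_tens:
  assumes "t_leading 0"
  shows "\<exists>p. p \<notin> max_left \<and> tens 1 p \<in> W"
proof -
  obtain K :: "nat set" and q v where K: "finite K" "family K (\<lambda>k. [:q k:]) v \<in> W"
    and deg: "\<And>k. k \<in> K \<Longrightarrow> degree (q k) \<le> 0"
    and lead: "(\<Sum>k\<in>K. scale (coeff (q k) 0) (v k)) \<notin> max_left"
    using assms unfolding t_leading_def by blast
  have q: "[:q k:] = cst (coeff (q k) 0) * 1" if k: "k \<in> K" for k
  proof -
    obtain x where "q k = [:x:]" using degree_eq_zeroE[of "q k"] deg[OF k] by blast
    then show ?thesis by (simp add: cst_def)
  qed
  have "family K (\<lambda>k. [:q k:]) v = (\<Sum>k\<in>K. tens (cst (coeff (q k) 0) * 1) (v k))"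
    unfolding family_def by (intro sum.cong refl arg_cong2[where f = tens] q)
  also have "\<dots> \<approx> (\<Sum>k\<in>K. tens 1 (scale (coeff (q k) 0) (v k)))"
    by (rule equiv_sum) (rule equiv_trans[OF tens_scale_left equiv_sym[OF tens_scale_right]])
  also have "\<dots> \<approx> tens 1 (\<Sum>k\<in>K. scale (coeff (q k) 0) (v k))"
    by (rule equiv_sym[OF tens_sum_right])
  finally have "tens 1 (\<Sum>k\<in>K. scale (coeff (q k) 0) (v k)) \<in> W" using K(2) W_cong by simp
  with lead show ?thesis by blast
qed

lemma family_singleton: "family {()} (\<lambda>_. g) (\<lambda>_. p) = tens g p"
  by (simp add: family_def)

text \<open>By induction on the degree in \<open>s\<close>: multiplication by polynomials in \<open>t\<close> comes from \<open>H i\<close>, and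
  \<open>D i\<close> sends \<open>h(t) s\<^sup>n\<close> to \<open>h(t) s\<^sup>n\<^sup>+\<^sup>1\<close> plus terms of lower degree in \<open>s\<close>.\<close>

lemma tens_all:
  assumes "tens 1 p \<in> W"
  shows "tens g p \<in> W"
proof -
  note fam = family_singleton[of _ p]
  have base: "tens [:q:] p \<in> W" for q
    using family_t_poly_mult[of "{()}" "\<lambda>_. 1" "\<lambda>_. p" q] assms by (simp add: fam flip: one_pCons)
  have "\<forall>g. degree g \<le> n \<longrightarrow> tens g p \<in> W" for n
  proof (induction n)
    case 0
    then show ?case using base degree_eq_zeroE by (metis le_zero_eq)
  next
    case (Suc n)
    show ?case
    proof (intro allI impI)
      fix g :: "complex poly poly" assume deg: "degree g \<le> Suc n"
      define h where "h = monom (coeff g (Suc n)) n"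
      have hd: "degree h \<le> n" by (simp add: h_def degree_monom_le)
      then have "family {()} (\<lambda>_. h) (\<lambda>_. p) \<in> W" using Suc by (simp add: fam)
      from family_loop_action_normalized[OF _ this] obtain i where
        i: "tens ((svar + cst (of_int i * c)) * shift i 0 h) p \<in> W" by (auto simp: fam)
      define f where "f = (svar + cst (of_int i * c)) * shift i 0 h"
      have sh: "shift i 0 h = pcompose h [:- of_int i, 1:]" by (simp add: shift_def map_poly_idI)
      have fcoeff: "coeff f (Suc a) = coeff (shift i 0 h) a + [:of_int i * c:] * coeff (shift i 0 h) (Suc a)" for a
        by (simp add: f_def svar_def cst_def distrib_right)
      have fg: "degree (g - f) \<le> n"
      proof (intro degree_le allI impI)
        fix a assume "a > n"
        then obtain a' where a': "a = Suc a'" "a' \<ge> n" by (cases a) auto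
        show "coeff (g - f) a = 0"
        proof (cases "a' = n")
          case True
          then show ?thesis
            using coeff_pcompose_top(1,2)[OF hd] by (simp add: a' fcoeff sh) (simp add: h_def)
        next
          case False
          then have "a' > n" using a' by simp
          then show ?thesis using coeff_pcompose_top(1)[OF hd] deg by (simp add: a' fcoeff sh coeff_eq_0)
        qed
      qed
      have "tens (f + (g - f)) p \<approx> tens f p + tens (g - f) p" by (rule tens_add_left)
      moreover have "tens f p + tens (g - f) p \<in> W"
        using i Suc fg by (intro pm.subspace_add[OF W(1)]) (auto simp: f_def)
      ultimately show "tens g p \<in> W" using W_cong by simp
    qed
  qed
  then show ?thesis by blast
qed

text \<open>The set \<open>L\<close> of all \<open>p\<close> such that \<open>W\<close> contains \<open>g \<otimes> p\<close> for every \<open>g\<close> is a left ideal, since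
  \<open>g \<otimes> x p = x (g \<otimes> p) - x g \<otimes> p\<close>. It contains the Verma ideal and an element
  outside \<open>max_left\<close>, hence is everything.\<close>

lemma W_full:
  assumes "z \<in> W" "z \<in> T.free_space" "z \<notin> T.bilin"
  shows "T.free_space \<subseteq> W"
proof -
  obtain p where p: "p \<notin> max_left" "tens 1 p \<in> W"
    using nontrivial_s_leading[OF assms] s_leading_zero s_leading_t_leading t_leading_zero t_leading_zero_tens
    by blast
  define L where "L = {p. \<forall>g. tens g p \<in> W}"
  have sub: "pm.subspace L"
  proof (rule pm.subspaceI)
    show "0 \<in> L" using W_cong[OF tens_zero[OF zero_max_left]] pm.subspace_0[OF W(1)] by (simp add: L_def)
    show "x + y \<in> L" if "x \<in> L" "y \<in> L" for x y
      using that pm.subspace_add[OF W(1)] W_cong[OF tens_add_right] by (simp add: L_def)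
    show "scale k x \<in> L" if "x \<in> L" for k x
      using that pm.subspace_scale[OF W(1)] W_cong[OF tens_scale_right] by (simp add: L_def)
  qed
  have "left_ideal_T L"
    unfolding left_ideal_T_act
  proof (intro conjI allI ballI sub)
    fix x q assume q: "q \<in> L"
    have "tens g (left_act x q) \<in> W" for g
    proof -
      have "T.act x (tens g q) - tens (poly_act x g) q \<in> W"
        using q by (intro pm.subspace_diff[OF W(1)] W(3)) (auto simp: L_def)
      then show ?thesis by (simp add: tens_act)
    qed
    then show "left_act x q \<in> L" by (simp add: L_def)
  qed
  moreover have "verma_left \<subseteq> L"
    using W_cong[OF tens_zero] pm.subspace_0[OF W(1)] verma_left_max_left by (auto simp: L_def)
  moreover have "p \<in> L" using tens_all[OF p(2)] by (simp add: L_def)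
  ultimately have "L = UNIV" using max_left_greatest p(1) by blast
  then have tens: "tens g q \<in> W" for g q by (auto simp: L_def)
  show ?thesis
  proof
    fix y assume "y \<in> T.free_space"
    then obtain K :: "(complex poly poly \<times> tensor_alg set set set) set" and g v where
      "y \<approx> family K g v" using free_space_family by blast
    moreover have "family K g v \<in> W"
      unfolding family_def by (intro pm.subspace_sum[OF W(1)] tens)
    ultimately show "y \<in> W" using W_cong by blast
  qed
qed

end

context irreducibility
begin

text \<open>The functional \<open>g \<otimes> v \<mapsto> g(0, 0) \<cdot> hw_coeff v\<close>. The choice of a representative of \<open>v\<close> is harmless as
  \<open>hw_coeff\<close> vanishes on \<open>max_left\<close>.\<close>

definition constant_coeff :: "(complex poly poly \<times> tensor_alg set set set \<Rightarrow>\<^sub>0 complex) \<Rightarrow> complex" where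
  "constant_coeff = lin_ext (*) (\<lambda>(g, A). coeff (coeff g 0) 0 * hw_coeff (SOME p. hw_class p = A))"

lemma hw_coeff_some: "hw_coeff (SOME q. hw_class q = hw_class p) = hw_coeff p"
proof -
  have "hw_class (SOME q. hw_class q = hw_class p) = hw_class p" by (rule someI) simp
  then have "(SOME q. hw_class q = hw_class p) - p \<in> max_left" by (simp add: hw.eq_iff hw_ker)
  then show ?thesis
    using hw_coeff_max_left[of "(SOME q. hw_class q = hw_class p) - p"] by (simp add: linear_rules(3)[OF hw_coeff_linear])
qed

lemma one_tens_not_bilin: "tens 1 1 \<notin> T.bilin"
proof
  assume "tens 1 1 \<in> T.bilin"
  note lin = linear_rules[OF lin_ext_linear[OF vs_mult, of "\<lambda>(g, A). coeff (coeff g 0) 0 * hw_coeff (SOME p. hw_class p = A)"],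
      folded constant_coeff_def]
  have single: "constant_coeff (Poly_Mapping.single (g, hw_class p) k) = k * (coeff (coeff g 0) 0 * hw_coeff p)" for g p k
    unfolding constant_coeff_def by (simp add: lin_ext_single[OF vs_mult] hw_coeff_some)
  have "constant_coeff z = 0" if "z \<in> T.bilin" for z
  proof (rule pm.span_induct[OF that[unfolded T.bilin_def]])
    show "pm.subspace {z. constant_coeff z = 0}" by (simp add: pm.subspace_def lin)
    show "constant_coeff z = 0" if "z \<in> T.relations" for z
      using that unfolding T.relations_def
      by (auto simp: hw.carrier lin single linear_rules[OF hw_coeff_linear] distrib_left distrib_right cst_mult
          simp flip: hw.add hw.scale)
  qed
  with \<open>tens 1 1 \<in> T.bilin\<close> have "constant_coeff (tens 1 1) = 0" by blast
  then show False by (simp add: tens_def single hw_coeff_one)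
qed

theorem irreducible: "irreducible_affvir_module (poly_module (weight_act l c P Q) \<otimes>\<^sub>L irr_hw_module \<eta> \<epsilon> \<theta>)"
proof -
  let ?M = "poly_module (weight_act l c P Q) \<otimes>\<^sub>L irr_hw_module \<eta> \<epsilon> \<theta>"
  interpret p: presentation ?M T.free_space T.act T.coset by (rule T.tensor_presentation)
  show ?thesis
  proof (intro irreducible_affvir_module.intro irreducible_affvir_module_axioms.intro p.affvir_module)
    have "tens 1 1 \<notin> p.ker" using one_tens_not_bilin T.tensor_ker by simp
    then have "T.coset (tens 1 1) \<noteq> \<zero>\<^bsub>?M\<^esub>" by (simp add: p.ker_def tens_free_space)
    moreover have "T.coset (tens 1 1) \<in> carrier ?M"
      unfolding p.carrier by (rule imageI[OF tens_free_space])
    ultimately show "carrier ?M \<noteq> {\<zero>\<^bsub>?M\<^esub>}" by auto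
  next
    fix N assume N: "affvir_submodule N ?M"
    note pre = p.submodule_preimage[OF N, unfolded T.tensor_ker]
    define W where "W = {a \<in> T.free_space. T.coset a \<in> N}"
    interpret stable_subspace l c P Q \<eta> \<epsilon> \<theta> W
      by unfold_locales (use pre in \<open>auto simp: W_def\<close>)
    show "N = {\<zero>\<^bsub>?M\<^esub>} \<or> N = carrier ?M"
    proof (cases "W \<subseteq> T.bilin")
      case True
      have "T.coset a = \<zero>\<^bsub>?M\<^esub>" if "a \<in> W" for a
        using that True T.tensor_ker by (auto simp: p.ker_def)
      moreover have "W \<noteq> {}" using pm.subspace_0[OF W(1)] by blast
      ultimately have "T.coset ` W = {\<zero>\<^bsub>?M\<^esub>}" by auto
      then show ?thesis using pre(4) by (simp add: W_def)
    next
      case False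
      then obtain z where "z \<in> W" "z \<notin> T.bilin" by blast
      then have "T.free_space \<subseteq> W" using W_full by (auto simp: W_def)
      then have "W = T.free_space" by (auto simp: W_def)
      then show ?thesis using pre(4) p.carrier by (simp add: W_def)
    qed
  qed
qed

end

theorem theorem3p1:
  fixes lam \<alpha> \<beta> \<gamma> \<eta> \<epsilon> \<theta> :: complex
    and M :: "complex poly poly affvir_module"
  assumes "lam \<noteq> 0" and "\<alpha> \<noteq> 0"
    and "M = Omega lam \<alpha> \<beta> \<gamma> \<or> M = Delta lam \<alpha> \<beta> \<gamma> \<or> (M = Theta lam \<alpha> \<beta> \<gamma> \<and> 2 * \<beta> \<notin> \<nat>)"
  shows "irreducible_affvir_module (M \<otimes>\<^sub>L irr_hw_module \<eta> \<epsilon> \<theta>)"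
proof -
  have "\<exists>P Q. M = poly_module (weight_act lam \<gamma> P Q) \<and> sl2_pair P Q \<and> degree_lowering P Q"
    using assms(3)
  proof (elim disjE conjE)
    assume "M = Omega lam \<alpha> \<beta> \<gamma>"
    then show ?thesis
      unfolding Omega_def omega_act_weight_act
      using sl2_pair_omega[OF assms(2)] degree_lowering_omega[OF assms(2)] by blast
  next
    assume "M = Delta lam \<alpha> \<beta> \<gamma>"
    then show ?thesis
      unfolding Delta_def delta_act_weight_act
      using sl2_pair_delta[OF assms(2)] degree_lowering_delta[OF assms(2)] by blast
  next
    assume "M = Theta lam \<alpha> \<beta> \<gamma>" "2 * \<beta> \<notin> \<nat>"
    then show ?thesis
      unfolding Theta_def theta_act_weight_act
      using sl2_pair_theta[OF assms(2)] degree_lowering_theta[OF assms(2)] by blast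
  qed
  then obtain P Q where PQ: "M = poly_module (weight_act lam \<gamma> P Q)" "sl2_pair P Q" "degree_lowering P Q"
    by blast
  interpret irreducibility lam \<gamma> P Q \<eta> \<epsilon> \<theta>
    using PQ assms(1) by unfold_locales
  show ?thesis unfolding PQ(1) by (rule irreducible)
qed

end
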